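(* Let $V$ be an $n$-dimensional $k$-vector space, $(\mathbf F,\mathbf F')$ a pair of weakly opposite partial flags, $\mathfrak q=\mathfrak p_{\mathbf F}\cap\mathfrak p_{\mathbf F'}$ the associated seaweed Lie algebra, $\mathfrak n$ its nilpotent radical, $\mathbf Q=\mathbf P_{\mathbf F}\cap\mathbf P_{\mathbf F'}\subseteq\mathrm{GL}(V)$, and let $Q$, $\mathbf d=(\dim Y_s)_{1\le s\le l}$ be the quiver and dimension vector attached to $(\mathbf F,\mathbf F')$ as in the context. Then there is a bijection between the $\mathbf Q$-orbits in $\mathfrak n$ and the $\mathrm{GL}(\mathbf d)$-orbits in $\mathrm{Rep}_\Delta(\tilde Q,\mathcal I,\mathbf d)$. In particular, $\mathfrak n$ contains an open $\mathbf Q$-orbit if and only if $\mathrm{Rep}_\Delta(\tilde Q,\mathcal I,\mathbf d)$ contains an open $\mathrm{GL}(\mathbf d)$-orbit.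
   Context: $k$ is algebraically closed of characteristic zero. For $\mathbf a=(a_i)_{0\le i\le r}$ with $0=a_0<\dots<a_r=n$, a partial flag of type $\mathbf a$ is $0=V_0\subset V_1\subset\cdots\subset V_r=V$ with $\dim V_i=a_i$. For a flag $\mathbf F$, $\mathfrak p_{\mathbf F}\subseteq\mathfrak{gl}(V)$ and $\mathbf P_{\mathbf F}\subseteq\mathrm{GL}(V)$ denote its stabilizers. A pair $(\mathbf F,\mathbf F')$ of flags of types $\mathbf a=(a_i)_{0\le i\le r}$, $\mathbf b=(b_j)_{0\le j\le r'}$ is weakly opposite if there is a basis $e_1,\dots,e_n$ of $V$ with $V_i=\mathrm{Vect}(e_1,\dots,e_{a_i})$ and $V'_j=\mathrm{Vect}(e_{n-b_j+1},\dots,e_n)$ for $j>0$. Fix such a basis. Let $0=m_0<m_1<\dots<m_l=n$ be the elements of $\{a_i\}\cup\{n-b_j\}$, $E_s=\mathrm{Vect}(e_{m_{s-1}+1},\dots,e_{m_s})$ for $1\le s\le l$, $u(s)=\min\{i:E_s\subseteq V_i\}$, $\ell(s)=\min\{j:E_s\subseteq V'_j\}$, and $Y_s=V_{u(s)}\cap V'_{\ell(s)}$. For each $1\le s\le l-1$ exactly one of $Y_s\cap Y_{s+1}=0$, $Y_s\subsetneq Y_{s+1}$, $Y_{s+1}\subsetneq Y_s$ holds. $Q$ is the quiver with vertices $1,\dots,l$ and, for $1\le s\le l-1$, an arrow $\alpha_s:s\to s+1$ if $Y_s\subsetneq Y_{s+1}$, an arrow $\alpha_s:s+1\to s$ if $Y_{s+1}\subsetneq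 Y_s$, and no arrow otherwise (each connected component is of type $A$). The nilpotent radical $\mathfrak n$ of $\mathfrak q$ is the set of $x\in\mathfrak q$ whose diagonal blocks with respect to $V=E_1\oplus\dots\oplus E_l$ vanish. Double quiver $\tilde Q$ (arrows $\alpha$ and reversed $\alpha^*$), paths composed right to left, ideal $\mathcal I\subseteq k\tilde Q$ generated by $\alpha^*\alpha-\sum_{\gamma\in Q_1,t(\gamma)=s(\alpha)}\gamma\gamma^*$ ($\alpha\in Q_1$) and $\beta^*\alpha$ ($\alpha\neq\beta$, $t(\alpha)=t(\beta)$). $\mathrm{Rep}(\tilde Q,\mathcal I,\mathbf d)$ is the variety of representations of $(\tilde Q,\mathcal I)$ on the spaces $k^{d_i}$, with $\mathrm{GL}(\mathbf d)=\prod_i\mathrm{GL}_{d_i}(k)$ acting by conjugation; $\mathrm{Rep}_\Delta(\tilde Q,\mathcal I,\mathbf d)$ is the subset of representations $M$ such that every $M_\alpha$ ($\alpha\in Q_1$) is injective and $\mathrm{Im}(M_\alpha)\cap\sum_{\beta\in Q_1\setminus\{\alpha\},t(\beta)=t(\alpha)}\mathrm{Im}(M_\beta)=0$ (the $\Delta$-filtered modules). *)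

theory Defs
  imports "HOL-Analysis.Analysis" "HOL-Computational_Algebra.Polynomial"
begin

inductive_set polyfun :: "(('i \<Rightarrow> 'k::comm_ring_1) \<Rightarrow> 'k) set" where
  const: "(\<lambda>x. c) \<in> polyfun"
| coord: "(\<lambda>x. x i) \<in> polyfun"
| add: "p \<in> polyfun \<Longrightarrow> q \<in> polyfun \<Longrightarrow> (\<lambda>x. p x + q x) \<in> polyfun"
| mult: "p \<in> polyfun \<Longrightarrow> q \<in> polyfun \<Longrightarrow> (\<lambda>x. p x * q x) \<in> polyfun"

definition zar_closed :: "('i \<Rightarrow> 'k::comm_ring_1) set \<Rightarrow> bool" where
  "zar_closed Z \<longleftrightarrow> (\<exists>P. P \<subseteq> polyfun \<and> Z = {x. \<forall>p\<in>P. p x = 0})"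

definition zar_open_in :: "('i \<Rightarrow> 'k::comm_ring_1) set \<Rightarrow> ('i \<Rightarrow> 'k) set \<Rightarrow> bool" where
  "zar_open_in S U \<longleftrightarrow> (\<exists>Z. zar_closed Z \<and> U = S - Z)"

definition breaks :: "nat \<Rightarrow> (nat \<Rightarrow> nat) \<Rightarrow> nat \<Rightarrow> (nat \<Rightarrow> nat) \<Rightarrow> nat \<Rightarrow> nat set" where
  "breaks n a r b r' = {a i | i. i \<le> r} \<union> {n - b j | j. j \<le> r'}"

definition mpts :: "nat \<Rightarrow> (nat \<Rightarrow> nat) \<Rightarrow> nat \<Rightarrow> (nat \<Rightarrow> nat) \<Rightarrow> nat \<Rightarrow> nat \<Rightarrow> nat" where
  "mpts n a r b r' s = sorted_list_of_set (breaks n a r b r') ! s"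

definition nvert :: "nat \<Rightarrow> (nat \<Rightarrow> nat) \<Rightarrow> nat \<Rightarrow> (nat \<Rightarrow> nat) \<Rightarrow> nat \<Rightarrow> nat" where
  "nvert n a r b r' = card (breaks n a r b r') - 1"

definition stab_alg :: "(nat \<Rightarrow> ('k::field ^ 'n) set) \<Rightarrow> nat \<Rightarrow> ('k ^ 'n ^ 'n) set" where
  "stab_alg F r = {x. \<forall>i\<le>r. \<forall>v\<in>F i. x *v v \<in> F i}"

definition stab_grp :: "(nat \<Rightarrow> ('k::field ^ 'n) set) \<Rightarrow> nat \<Rightarrow> ('k ^ 'n ^ 'n) set" where
  "stab_grp F r = {g. invertible g \<and> (\<forall>i\<le>r. (\<lambda>v. g *v v) ` F i = F i)}"

text \<open>Nilpotent radical: elements of q whose diagonal blocks w.r.t. V = E_1 + ... + E_l vanish.\<close>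
definition nilrad :: "(nat \<Rightarrow> ('k::field ^ 'n) set) \<Rightarrow> nat \<Rightarrow> (nat \<Rightarrow> ('k ^ 'n) set) \<Rightarrow> nat
    \<Rightarrow> (nat \<Rightarrow> ('k ^ 'n) set) \<Rightarrow> nat \<Rightarrow> ('k ^ 'n ^ 'n) set" where
  "nilrad F r F' r' E l = {x \<in> stab_alg F r \<inter> stab_alg F' r'.
      \<forall>s\<in>{1..l}. \<forall>v\<in>E s. x *v v \<in> vec.span (\<Union>t\<in>{1..l} - {s}. E t)}"

definition conj_orbit :: "('k::field ^ 'n ^ 'n) set \<Rightarrow> 'k ^ 'n ^ 'n \<Rightarrow> ('k ^ 'n ^ 'n) set" where
  "conj_orbit G x = {g ** x ** matrix_inv g | g. g \<in> G}"

definition conj_orbits :: "('k::field ^ 'n ^ 'n) set \<Rightarrow> ('k ^ 'n ^ 'n) set \<Rightarrow> ('k ^ 'n ^ 'n) set set" where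
  "conj_orbits G N = {conj_orbit G x | x. x \<in> N}"

definition matcoords :: "'k ^ 'n ^ 'n \<Rightarrow> ('n \<times> 'n \<Rightarrow> 'k)" where
  "matcoords x = (\<lambda>(i, j). x $ i $ j)"

definition Eblk :: "(nat \<Rightarrow> 'k::field ^ 'n) \<Rightarrow> (nat \<Rightarrow> nat) \<Rightarrow> nat \<Rightarrow> (nat \<Rightarrow> nat) \<Rightarrow> nat
    \<Rightarrow> nat \<Rightarrow> ('k ^ 'n) set" where
  "Eblk e a r b r' s = vec.span (e ` {mpts CARD('n) a r b r' (s - 1)<..mpts CARD('n) a r b r' s})"

definition Yspace :: "(nat \<Rightarrow> ('k::field ^ 'n) set) \<Rightarrow> nat \<Rightarrow> (nat \<Rightarrow> ('k ^ 'n) set) \<Rightarrow> nat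
    \<Rightarrow> (nat \<Rightarrow> ('k ^ 'n) set) \<Rightarrow> nat \<Rightarrow> ('k ^ 'n) set" where
  "Yspace F r F' r' E s = F (LEAST i. i \<le> r \<and> E s \<subseteq> F i) \<inter> F' (LEAST j. j \<le> r' \<and> E s \<subseteq> F' j)"

text \<open>Arrows of Q are indexed by s in {1..l-1}; an arrow of the double quiver is (s, False) = alpha_s
or (s, True) = alpha_s^*.\<close>

definition arrs :: "(nat \<Rightarrow> 'v set) \<Rightarrow> nat \<Rightarrow> nat set" where
  "arrs Y l = {s. 1 \<le> s \<and> s < l \<and> (Y s \<subset> Y (Suc s) \<or> Y (Suc s) \<subset> Y s)}"

definition qsrc :: "(nat \<Rightarrow> 'v set) \<Rightarrow> nat \<times> bool \<Rightarrow> nat" where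
  "qsrc Y \<alpha> = (case \<alpha> of (s, st) \<Rightarrow>
     (if Y s \<subset> Y (Suc s) then (if st then Suc s else s) else (if st then s else Suc s)))"

definition qtgt :: "(nat \<Rightarrow> 'v set) \<Rightarrow> nat \<times> bool \<Rightarrow> nat" where
  "qtgt Y \<alpha> = (case \<alpha> of (s, st) \<Rightarrow> qsrc Y (s, \<not> st))"

type_synonym 'k mat = "nat \<Rightarrow> nat \<Rightarrow> 'k"

definition mat_on :: "nat \<Rightarrow> nat \<Rightarrow> 'k::zero mat \<Rightarrow> bool" where
  "mat_on p q A \<longleftrightarrow> (\<forall>i j. p \<le> i \<or> q \<le> j \<longrightarrow> A i j = 0)"

definition vec_on :: "nat \<Rightarrow> (nat \<Rightarrow> 'k::zero) \<Rightarrow> bool" where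
  "vec_on p v \<longleftrightarrow> (\<forall>i. p \<le> i \<longrightarrow> v i = 0)"

definition mmul :: "nat \<Rightarrow> 'k::comm_ring_1 mat \<Rightarrow> 'k mat \<Rightarrow> 'k mat" where
  "mmul k A B = (\<lambda>i j. \<Sum>t<k. A i t * B t j)"

definition mapp :: "nat \<Rightarrow> 'k::comm_ring_1 mat \<Rightarrow> (nat \<Rightarrow> 'k) \<Rightarrow> (nat \<Rightarrow> 'k)" where
  "mapp k A v = (\<lambda>i. \<Sum>t<k. A i t * v t)"

definition idm :: "nat \<Rightarrow> 'k::comm_ring_1 mat" where
  "idm p = (\<lambda>i j. if i = j \<and> i < p then 1 else 0)"

definition img :: "nat \<Rightarrow> 'k::comm_ring_1 mat \<Rightarrow> (nat \<Rightarrow> 'k) set" where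
  "img k A = {mapp k A v | v. vec_on k v}"

definition is_rep :: "(nat \<Rightarrow> 'v set) \<Rightarrow> nat \<Rightarrow> (nat \<Rightarrow> nat) \<Rightarrow> (nat \<times> bool \<Rightarrow> 'k::comm_ring_1 mat) \<Rightarrow> bool" where
  "is_rep Y l d M \<longleftrightarrow>
     (\<forall>\<alpha>. if fst \<alpha> \<in> arrs Y l then mat_on (d (qtgt Y \<alpha>)) (d (qsrc Y \<alpha>)) (M \<alpha>)
           else M \<alpha> = (\<lambda>i j. 0))
   \<and> (\<forall>s\<in>arrs Y l.
        mmul (d (qtgt Y (s, False))) (M (s, True)) (M (s, False))
        = (\<lambda>i j. \<Sum>g\<in>{g\<in>arrs Y l. qtgt Y (g, False) = qsrc Y (s, False)}.
              mmul (d (qsrc Y (g, False))) (M (g, False)) (M (g, True)) i j))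
   \<and> (\<forall>s\<in>arrs Y l. \<forall>s'\<in>arrs Y l. s \<noteq> s' \<and> qtgt Y (s, False) = qtgt Y (s', False) \<longrightarrow>
        mmul (d (qtgt Y (s, False))) (M (s', True)) (M (s, False)) = (\<lambda>i j. 0))"

definition RepD :: "(nat \<Rightarrow> 'v set) \<Rightarrow> nat \<Rightarrow> (nat \<Rightarrow> nat) \<Rightarrow> (nat \<times> bool \<Rightarrow> 'k::comm_ring_1 mat) set" where
  "RepD Y l d = {M. is_rep Y l d M \<and>
     (\<forall>s\<in>arrs Y l.
        (\<forall>v. vec_on (d (qsrc Y (s, False))) v \<and>
             mapp (d (qsrc Y (s, False))) (M (s, False)) v = (\<lambda>i. 0) \<longrightarrow> v = (\<lambda>i. 0))
      \<and> img (d (qsrc Y (s, False))) (M (s, False)) \<inter>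
          {(\<lambda>i. \<Sum>\<beta>\<in>{\<beta>\<in>arrs Y l - {s}. qtgt Y (\<beta>, False) = qtgt Y (s, False)}. w \<beta> i) | w.
             \<forall>\<beta>\<in>{\<beta>\<in>arrs Y l - {s}. qtgt Y (\<beta>, False) = qtgt Y (s, False)}.
               w \<beta> \<in> img (d (qsrc Y (\<beta>, False))) (M (\<beta>, False))}
        \<subseteq> {\<lambda>i. 0})}"

definition isGL :: "nat \<Rightarrow> (nat \<Rightarrow> nat) \<Rightarrow> (nat \<Rightarrow> 'k::comm_ring_1 mat) \<Rightarrow> (nat \<Rightarrow> 'k mat) \<Rightarrow> bool" where
  "isGL l d g h \<longleftrightarrow> (\<forall>i\<in>{1..l}. mat_on (d i) (d i) (g i) \<and> mat_on (d i) (d i) (h i) \<and>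
       mmul (d i) (g i) (h i) = idm (d i) \<and> mmul (d i) (h i) (g i) = idm (d i))"

definition gl_act :: "(nat \<Rightarrow> 'v set) \<Rightarrow> nat \<Rightarrow> (nat \<Rightarrow> nat) \<Rightarrow> (nat \<Rightarrow> 'k::comm_ring_1 mat)
    \<Rightarrow> (nat \<Rightarrow> 'k mat) \<Rightarrow> (nat \<times> bool \<Rightarrow> 'k mat) \<Rightarrow> (nat \<times> bool \<Rightarrow> 'k mat)" where
  "gl_act Y l d g h M = (\<lambda>\<alpha>. if fst \<alpha> \<in> arrs Y l
      then mmul (d (qsrc Y \<alpha>)) (mmul (d (qtgt Y \<alpha>)) (g (qtgt Y \<alpha>)) (M \<alpha>)) (h (qsrc Y \<alpha>))
      else M \<alpha>)"

definition gl_orbit :: "(nat \<Rightarrow> 'v set) \<Rightarrow> nat \<Rightarrow> (nat \<Rightarrow> nat) \<Rightarrow> (nat \<times> bool \<Rightarrow> 'k::comm_ring_1 mat)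
    \<Rightarrow> (nat \<times> bool \<Rightarrow> 'k mat) set" where
  "gl_orbit Y l d M = {gl_act Y l d g h M | g h. isGL l d g h}"

definition gl_orbits :: "(nat \<Rightarrow> 'v set) \<Rightarrow> nat \<Rightarrow> (nat \<Rightarrow> nat) \<Rightarrow> (nat \<times> bool \<Rightarrow> 'k::comm_ring_1 mat) set set" where
  "gl_orbits Y l d = {gl_orbit Y l d M | M. M \<in> RepD Y l d}"

definition repcoords :: "(nat \<times> bool \<Rightarrow> 'k mat) \<Rightarrow> ((nat \<times> bool) \<times> nat \<times> nat \<Rightarrow> 'k)" where
  "repcoords M = (\<lambda>(\<alpha>, i, j). M \<alpha> i j)"

end

(* Each Y_s is the sum of E_s and of the Y_t over the arrows t -> s, and x in n maps Y_s into the sum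
   of those Y_t. Hence x is recorded by the inclusions Y_s -> Y_t along the arrows together with the
   components Y_t -> Y_s of x; this is a Delta-filtered representation psi x. Conversely, given M, choosing
   complements of the sums of images gives, vertex by vertex along the quiver, isomorphisms
   G_t : Y_t -> M_t that turn the maps M_alpha into inclusions, so M is isomorphic to some psi x;
   isomorphisms psi x -> psi x' are restrictions of elements of Q.
   For the topology, psi is linear, so an open orbit of representations pulls back to an open orbit in n.
   In the other direction, once the complements are fixed, G_t is polynomial in M, and wherever it stays
   invertible M |-> x is regular by Cramer's rule; clearing denominators turns a polynomial on n that
   detects an orbit into a polynomial that detects the corresponding orbit near a given M. *)
theory Submission
  imports Defs
begin

section \<open>Coordinate projections\<close>

text \<open>The spaces Y_s have varying dimensions, while a matrix type has a fixed size. All maps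
  are therefore kept as square matrices of size n: a map from Y_s to Y_t is a matrix fixed by the
  coordinate projections \<open>p t\<close> on the left and \<open>p s\<close> on the right, and
  composition is the ordinary product. In this form the relations have a direct meaning. For an
  arrow \<alpha> from s to t, the vanishing of the mixed products says that the endomorphism at t
  maps Y_s into Y_s; the other relation says that it then restricts on Y_s to the endomorphism at s.
  So the relations let the maps at the vertices glue to one endomorphism of V. Complements that suit
  one M need not suit another, so the inverse of psi is only built locally. Openness in the space of
  representations is accordingly proved point by point, with one polynomial for each representation
  in the orbit.\<close>

definition prj :: "'n::finite set \<Rightarrow> 'k::semiring_1 ^ 'n ^ 'n" where
  "prj X = (\<chi> i j. if i = j \<and> i \<in> X then 1 else 0)"

lemma prj_mult_nth: "(prj X ** A) $ i $ j = (if i \<in> X then A $ i $ j else 0)"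
  by (simp add: prj_def matrix_matrix_mult_def if_distrib[of "\<lambda>c. c * _"] cong: if_cong)

lemma mult_prj_nth: "(A ** prj X) $ i $ j = (if j \<in> X then A $ i $ j else 0)"
proof -
  have "(A ** prj X) $ i $ j = (\<Sum>k\<in>UNIV. A $ i $ k * (if k = j \<and> k \<in> X then 1 else 0))"
    by (simp add: matrix_matrix_mult_def prj_def)
  also have "\<dots> = (\<Sum>k\<in>UNIV. if k = j then (if j \<in> X then A $ i $ j else 0) else 0)"
    by (rule sum.cong) auto
  finally show ?thesis by simp
qed

lemma prj_vec_nth: "(prj X *v v) $ i = (if i \<in> X then v $ i else 0)"
  by (simp add: prj_def matrix_vector_mult_def if_distrib[of "\<lambda>c. c * _"] cong: if_cong)

lemma prj_prj: "prj X ** prj Y = prj (X \<inter> Y)"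
  by (simp add: vec_eq_iff prj_mult_nth) (simp add: prj_def)

lemma prj_UNIV: "prj UNIV = mat 1"
  by (simp add: prj_def mat_def)

lemma prj_empty: "prj {} = 0"
  by (simp add: prj_def vec_eq_iff)

lemma prj_Un: "X \<inter> Y = {} \<Longrightarrow> prj (X \<union> Y) = prj X + prj Y"
  by (auto simp: prj_def vec_eq_iff)

lemma prj_UN:
  assumes "finite S" "\<And>s t. s \<in> S \<Longrightarrow> t \<in> S \<Longrightarrow> s \<noteq> t \<Longrightarrow> X s \<inter> X t = {}"
  shows "prj (\<Union>s\<in>S. X s) = (\<Sum>s\<in>S. prj (X s))"
  using assms
proof (induction S rule: finite_induct)
  case empty
  then show ?case by (simp add: prj_empty)
next
  case (insert s S)
  have "X s \<inter> (\<Union>t\<in>S. X t) = {}"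
    using insert.hyps insert.prems by blast
  then show ?case
    using insert by (simp add: prj_Un)
qed

lemma prj_absorb_left: "prj X ** A = A \<longleftrightarrow> (\<forall>i j. A $ i $ j \<noteq> 0 \<longrightarrow> i \<in> X)"
  by (auto simp: vec_eq_iff prj_mult_nth)

lemma prj_absorb_right: "A ** prj X = A \<longleftrightarrow> (\<forall>i j. A $ i $ j \<noteq> 0 \<longrightarrow> j \<in> X)"
  by (auto simp: vec_eq_iff mult_prj_nth)

text \<open>Translates an inclusion between coordinate subspaces into a zero pattern of the entries;
  the stabilizer and radical conditions are all checked through this dictionary.\<close>

lemma prj_mult_prj_iff:
  "prj X ** g ** prj Z = g ** prj Z \<longleftrightarrow> (\<forall>i j. g $ i $ j \<noteq> 0 \<longrightarrow> j \<in> Z \<longrightarrow> i \<in> X)"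
  by (auto simp: vec_eq_iff mult_prj_nth prj_mult_nth)

lemma matrix_add_rdistrib': "((A + B) ** C) = (A ** C) + (B ** C)"
  for A B :: "'k::semiring_1 ^ 'm ^ 'n"
  by (simp add: vec_eq_iff matrix_matrix_mult_def distrib_right sum.distrib)

lemma matrix_mult_sum_right: "A ** (\<Sum>s\<in>S. f s) = (\<Sum>s\<in>S. A ** f s)"
  for f :: "_ \<Rightarrow> 'k::semiring_1 ^ 'm ^ 'n"
  by (induction S rule: infinite_finite_induct) (simp_all add: matrix_add_ldistrib)

lemma matrix_mult_sum_left: "(\<Sum>s\<in>S. f s) ** A = (\<Sum>s\<in>S. f s ** A)"
  for f :: "_ \<Rightarrow> 'k::semiring_1 ^ 'm ^ 'n"
  by (induction S rule: infinite_finite_induct) (simp_all add: matrix_add_rdistrib')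

lemma matrix_sum_mult_vec: "(\<Sum>s\<in>S. f s) *v v = (\<Sum>s\<in>S. f s *v v)"
  for f :: "_ \<Rightarrow> 'k::semiring_1 ^ 'm ^ 'n"
  by (induction S rule: infinite_finite_induct) (simp_all add: matrix_vector_mult_add_rdistrib)

lemma matrix_mult_vec_sum: "A *v (\<Sum>s\<in>S. f s) = (\<Sum>s\<in>S. A *v f s)"
  for A :: "'k::semiring_1 ^ 'm ^ 'n"
  by (induction S rule: infinite_finite_induct) (simp_all add: matrix_vector_right_distrib)

section \<open>Inverses, Cramer's rule and invertibility on a coordinate subspace\<close>

lemma matrix_inv_inverse:
  assumes "invertible A"
  shows "A ** matrix_inv A = mat 1" "matrix_inv A ** A = mat 1"
  using someI_ex[OF assms[unfolded invertible_def]] by (simp_all add: matrix_inv_def)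

lemma matrix_inv_unique:
  fixes A :: "'k::field ^ 'n ^ 'n"
  assumes "A ** B = mat 1"
  shows "matrix_inv A = B"
proof -
  have "invertible A" using assms invertible_right_inverse by blast
  then have "matrix_inv A ** (A ** B) = B"
    by (simp add: matrix_mul_assoc matrix_inv_inverse)
  then show ?thesis using assms by simp
qed

text \<open>Column \<open>j\<close> of the inverse solves A y = e_j, so Cramer's rule writes each
  entry as a quotient of determinants, hence of polynomials in the entries of
  \<open>A\<close>.\<close>

lemma matrix_inv_nth:
  fixes A :: "'k::field ^ 'n ^ 'n"
  assumes "det A \<noteq> 0"
  shows "matrix_inv A $ i $ j = det (\<chi> p q. if q = i then axis j 1 $ p else A $ p $ q) / det A"
proof -
  have "A *v (matrix_inv A *v axis j 1) = axis j 1"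
    using assms by (simp add: matrix_vector_mul_assoc matrix_inv_inverse invertible_det_nz)
  then have "matrix_inv A *v axis j 1
      = (\<chi> k. det (\<chi> p q. if q = k then axis j 1 $ p else A $ p $ q) / det A)"
    using cramer[OF assms] by blast
  moreover have "(matrix_inv A *v axis j 1) $ i = matrix_inv A $ i $ j"
    by (simp add: matrix_vector_mult_def axis_def if_distrib[of "\<lambda>c. _ * c"] cong: if_cong)
  ultimately show ?thesis by simp
qed

text \<open>\<open>G\<close> restricts to an automorphism of the coordinate subspace indexed by \<open>X\<close>, with inverse \<open>K\<close>,
  and both are extended by zero to the other coordinates.\<close>

definition inv_on :: "'n::finite set \<Rightarrow> 'k::field ^ 'n ^ 'n \<Rightarrow> 'k ^ 'n ^ 'n \<Rightarrow> bool" where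
  "inv_on X G K \<longleftrightarrow> prj X ** G = G \<and> G ** prj X = G \<and> prj X ** K = K \<and> K ** prj X = K
     \<and> G ** K = prj X \<and> K ** G = prj X"

lemma inv_onD:
  assumes "inv_on X G K"
  shows "prj X ** G = G" "G ** prj X = G" "prj X ** K = K" "K ** prj X = K"
    "G ** K = prj X" "K ** G = prj X"
  using assms by (auto simp: inv_on_def)

lemma inv_on_sym: "inv_on X G K \<Longrightarrow> inv_on X K G"
  by (auto simp: inv_on_def)

lemma prj_Compl_orth:
  shows "prj X ** G = G \<Longrightarrow> prj (- X) ** G = 0" "G ** prj X = G \<Longrightarrow> G ** prj (- X) = 0"
proof -
  assume "prj X ** G = G"
  then have "prj (- X) ** G = prj (- X) ** prj X ** G"
    by (simp add: matrix_mul_assoc[symmetric])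
  then show "prj (- X) ** G = 0" by (simp add: prj_prj prj_empty)
next
  assume "G ** prj X = G"
  then have "G ** prj (- X) = G ** prj X ** prj (- X)"
    by simp
  then show "G ** prj (- X) = 0" by (simp add: matrix_mul_assoc[symmetric] prj_prj prj_empty)
qed

text \<open>\<open>G + prj (- X)\<close> is block diagonal, with \<open>G\<close> on the coordinates
  in \<open>X\<close> and the identity elsewhere. Its full determinant thus tests invertibility on
  \<open>X\<close> whatever the size of \<open>X\<close>, and its inverse cut down to
  \<open>X\<close> is the partner of \<open>G\<close>.\<close>

lemma inv_on_of_det:
  fixes G :: "'k::field ^ 'n ^ 'n"
  assumes "prj X ** G = G" "G ** prj X = G" "det (G + prj (- X)) \<noteq> 0"
  shows "inv_on X G (prj X ** matrix_inv (G + prj (- X)) ** prj X)"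
proof -
  let ?H = "G + prj (- X)"
  let ?J = "matrix_inv ?H"
  have J: "?H ** ?J = mat 1" "?J ** ?H = mat 1"
    using assms(3) by (simp_all add: matrix_inv_inverse invertible_det_nz)
  have HX: "?H ** prj X = G" "prj X ** ?H = G"
    by (simp_all add: matrix_add_rdistrib' matrix_add_ldistrib assms prj_prj prj_empty)
  \<comment> \<open>\<open>prj X\<close> commutes with \<open>?H\<close>, both products being
    \<open>G\<close>, so it commutes with the inverse.\<close>
  have "prj X ** ?J = ?J ** (?H ** prj X) ** ?J"
    by (simp add: matrix_mul_assoc J)
  also have "\<dots> = ?J ** (prj X ** ?H) ** ?J"
    by (simp only: HX)
  also have "\<dots> = ?J ** prj X"
    by (simp add: matrix_mul_assoc[symmetric] J)
  finally have c: "prj X ** ?J = ?J ** prj X" .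
  have JG: "?J ** G = prj X"
    by (metis HX(1) J(2) matrix_mul_assoc matrix_mul_lid)
  have GJ: "G ** ?J = prj X"
    by (metis HX(2) J(1) matrix_mul_assoc matrix_mul_rid)
  have "G ** (prj X ** ?J ** prj X) = G ** ?J ** prj X"
    using assms(2) by (simp add: matrix_mul_assoc)
  moreover have "prj X ** ?J ** prj X ** G = prj X ** (?J ** G)"
    using assms(1) by (simp add: matrix_mul_assoc[symmetric])
  moreover have "prj X ** (prj X ** ?J ** prj X) = prj X ** ?J ** prj X"
    by (simp add: matrix_mul_assoc prj_prj)
  moreover have "prj X ** ?J ** prj X ** prj X = prj X ** ?J ** prj X"
    by (simp add: matrix_mul_assoc[symmetric] prj_prj)
  ultimately show ?thesis
    unfolding inv_on_def by (simp add: assms JG GJ prj_prj)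
qed

text \<open>The inverse is \<open>K + prj (- X)\<close>: mixed products vanish because the factors
  live on complementary coordinates.\<close>

lemma det_of_inv_on:
  fixes G :: "'k::field ^ 'n ^ 'n"
  assumes "inv_on X G K"
  shows "det (G + prj (- X)) \<noteq> 0"
proof -
  note i = inv_onD[OF assms]
  have "(G + prj (- X)) ** (K + prj (- X)) = prj X + prj (- X)"
    by (simp add: matrix_add_rdistrib' matrix_add_ldistrib i prj_prj prj_Compl_orth)
  also have "\<dots> = mat 1"
    by (simp add: prj_Un[symmetric] prj_UNIV)
  finally show ?thesis
    using invertible_det_nz invertible_right_inverse by blast
qed

section \<open>Coordinate subspaces and extension of injective maps\<close>

lemma mult_axis: "A *v axis j 1 = (\<chi> i. A $ i $ j)"
  for A :: "'k::semiring_1 ^ 'n ^ 'm"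
  by (simp add: matrix_vector_mult_def axis_def vec_eq_iff if_distrib[of "\<lambda>c. _ * c"] cong: if_cong)

lemma span_axis: "vec.span ((\<lambda>j. axis j 1) ` X) = {v :: 'k::field ^ 'n. prj X *v v = v}"
proof (rule vec.span_unique)
  show "(\<lambda>j. axis j 1) ` X \<subseteq> {v :: 'k ^ 'n. prj X *v v = v}"
    by (auto simp: vec_eq_iff prj_vec_nth axis_def)
  show "vec.subspace {v :: 'k ^ 'n. prj X *v v = v}"
    by (rule vec.subspaceI) (auto simp: matrix_vector_right_distrib vector_scalar_commute)
  fix T :: "('k ^ 'n) set"
  assume T: "(\<lambda>j. axis j 1) ` X \<subseteq> T" "vec.subspace T"
  show "{v. prj X *v v = v} \<subseteq> T"
  proof
    fix v :: "'k ^ 'n" assume "v \<in> {v. prj X *v v = v}"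
    then have v: "v $ i = 0" if "i \<notin> X" for i
      using that by (metis (mono_tags, lifting) mem_Collect_eq prj_vec_nth)
    have "v = (\<Sum>i\<in>UNIV. v $ i *s axis i 1)" by (simp add: basis_expansion)
    also have "\<dots> \<in> T"
      using T v by (intro vec.subspace_sum[OF T(2)]) (metis image_subset_iff vec.subspace_0 vec.subspace_scale vector_mul_eq_0)
    finally show "v \<in> T" .
  qed
qed

lemma inj_axis: "inj (\<lambda>j. axis j 1 :: 'k::field ^ 'n)"
  by (auto simp: inj_def axis_eq_axis)

lemma independent_axis: "vec.independent ((\<lambda>j. axis j 1 :: 'k::field ^ 'n) ` X)"
  by (rule vec.independent_mono[OF vec.independent_Basis]) (auto simp: cart_basis_def)

text \<open>This is the choice of a complement. The images under \<open>H\<close> of the unit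
  vectors in \<open>Z\<close> are independent in k^X and extend to a basis of k^X; the added basis
  vectors become the remaining columns of \<open>G\<close>.\<close>

lemma extend_injective:
  fixes H :: "'k::field ^ 'n ^ 'n"
  assumes "Z \<subseteq> X" "prj X ** H = H"
    and inj: "\<And>v. prj Z *v v = v \<Longrightarrow> H *v v = 0 \<Longrightarrow> v = 0"
  shows "\<exists>G K. inv_on X G K \<and> G ** prj Z = H ** prj Z"
proof -
  let ?ax = "\<lambda>j. axis j 1 :: 'k ^ 'n"
  let ?W = "{v :: 'k ^ 'n. prj X *v v = v}"
  let ?f = "\<lambda>j. H *v ?ax j"
  have lin: "Vector_Spaces.linear (*s) (*s) ((*v) H)"
    by (rule matrix_vector_mul_linear_gen)
  have injs: "inj_on ((*v) H) (vec.span (?ax ` Z))"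
    unfolding span_axis
    by (rule inj_onI) (metis (mono_tags, lifting) eq_iff_diff_eq_0 inj matrix_vector_mult_diff_distrib mem_Collect_eq)
  have indS: "vec.independent ((*v) H ` ?ax ` Z)"
    using vec.linear_independent_injective_image[OF lin independent_axis injs] .
  have injf: "inj_on ?f Z"
  proof (rule inj_onI)
    fix i j assume "i \<in> Z" "j \<in> Z" "?f i = ?f j"
    then have "?ax i = ?ax j"
      using inj_onD[OF injs] by (meson image_eqI vec.span_base)
    then show "i = j" by (simp add: axis_eq_axis)
  qed
  have "H *v v \<in> ?W" for v
    using assms(2) by (simp add: matrix_vector_mul_assoc)
  then have "?f ` Z \<subseteq> ?W" by blast
  moreover have "vec.independent (?f ` Z)"
    using indS by (simp add: image_image)
  ultimately obtain S' where S': "?f ` Z \<subseteq> S'" "S' \<subseteq> ?W" "vec.independent S'" "?W \<subseteq> vec.span S'"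
    by (rule vec.maximal_independent_subset_extend)
  have finS': "finite S'" using S'(3) vec.finiteI_independent by blast
  have "card S' = vec.dim ?W"
    using vec.basis_card_eq_dim[OF S'(2,4,3)] .
  also have "\<dots> = card (?ax ` X)"
    by (simp add: span_axis[symmetric] vec.dim_eq_card_independent independent_axis)
  also have "\<dots> = card X"
    by (rule card_image) (rule inj_on_subset[OF inj_axis subset_UNIV])
  finally have cS': "card S' = card X" .
  have "card (S' - ?f ` Z) = card (X - Z)"
    using S'(1) assms(1) cS' finS'
    by (simp add: card_Diff_subset card_image[OF injf] finite_subset[OF S'(1)])
  \<comment> \<open>Both sets have |X| - |Z| elements, and any bijection serves: the order of the
    added vectors is immaterial.\<close>
  then obtain f' where f': "bij_betw f' (X - Z) (S' - ?f ` Z)"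
    using finite_same_card_bij[of "X - Z" "S' - ?f ` Z"] finS' by auto
  define c where "c j = (if j \<in> Z then ?f j else f' j)" for j
  have "bij_betw c Z (?f ` Z)"
    using injf by (subst bij_betw_cong[of _ _ ?f]) (auto simp: c_def bij_betw_def)
  moreover have "bij_betw c (X - Z) (S' - ?f ` Z)"
    using f' by (subst bij_betw_cong[of _ _ f']) (auto simp: c_def)
  ultimately have "bij_betw c (Z \<union> (X - Z)) (?f ` Z \<union> (S' - ?f ` Z))"
    by (rule bij_betw_combine) blast
  then have bc: "bij_betw c X S'"
    using assms(1) S'(1) by (simp add: Un_absorb1)
  define G where "G = (\<chi> i j. if j \<in> X then c j $ i else 0)"
  have cW: "c j $ i = 0" if "j \<in> X" "i \<notin> X" for i j
  proof -
    have "prj X *v c j = c j" using bc S'(2) that(1) by (auto simp: bij_betw_def)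
    then show ?thesis using that(2) by (metis prj_vec_nth)
  qed
  have G1: "prj X ** G = G"
    unfolding prj_absorb_left using cW by (auto simp: G_def)
  have G2: "G ** prj X = G"
    by (auto simp: prj_absorb_right G_def)
  have Gv: "G *v v = (\<Sum>j\<in>X. v $ j *s c j)" for v
    by (auto simp: vec_eq_iff matrix_vector_mult_def G_def mult.commute intro!: sum.mono_neutral_cong_right)
  have "\<forall>v. (G + prj (- X)) *v v = 0 \<longrightarrow> v = 0"
  proof (intro allI impI)
    fix v assume v: "(G + prj (- X)) *v v = 0"
    \<comment> \<open>Off \<open>X\<close> only the identity part acts, which kills the outer
      coordinates of a kernel vector; what is left is a vanishing combination of the basis
      \<open>S'\<close>.\<close>
    have "prj (- X) ** (G + prj (- X)) = prj (- X)"
      by (simp add: matrix_add_ldistrib prj_Compl_orth(1)[OF G1] prj_prj)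
    then have v2: "prj (- X) *v v = 0"
      using v by (metis matrix_vector_mul_assoc matrix_vector_mult_0_right)
    then have "G *v v = 0"
      using v by (simp add: matrix_vector_mult_add_rdistrib)
    then have "(\<Sum>j\<in>X. v $ j *s c j) = 0" by (simp add: Gv)
    also have "(\<Sum>j\<in>X. v $ j *s c j) = (\<Sum>w\<in>S'. v $ (inv_into X c w) *s w)"
      using bc by (subst sum.reindex_bij_betw[OF bc, symmetric]) (auto simp: bij_betw_def intro!: sum.cong)
    finally have "\<forall>w\<in>S'. v $ (inv_into X c w) = 0"
      using spec[OF iffD1[OF vec.independent_explicit_finite_subsets S'(3)], of S'] finS' by auto
    then have "v $ j = 0" if "j \<in> X" for j
      using bc that by (auto simp: bij_betw_def)
    moreover have "v $ j = 0" if "j \<notin> X" for j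
      using v2 that by (metis ComplI prj_vec_nth zero_index)
    ultimately show "v = 0" by (auto simp: vec_eq_iff)
  qed
  then have "det (G + prj (- X)) \<noteq> 0"
    by (simp add: invertible_det_nz[symmetric] invertible_left_inverse matrix_left_invertible_ker)
  then have "inv_on X G (prj X ** matrix_inv (G + prj (- X)) ** prj X)"
    by (rule inv_on_of_det[OF G1 G2])
  moreover have "G ** prj Z = H ** prj Z"
    using assms(1) by (auto simp: vec_eq_iff mult_prj_nth G_def c_def mult_axis)
  ultimately show ?thesis by blast
qed

section \<open>Polynomial and locally rational functions\<close>

lemma polyfun_sum: "finite S \<Longrightarrow> (\<And>s. s \<in> S \<Longrightarrow> f s \<in> polyfun) \<Longrightarrow> (\<lambda>y. \<Sum>s\<in>S. f s y) \<in> polyfun"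
  by (induction S rule: finite_induct) (auto intro: polyfun.intros)

lemma polyfun_prod: "finite S \<Longrightarrow> (\<And>s. s \<in> S \<Longrightarrow> f s \<in> polyfun) \<Longrightarrow> (\<lambda>y. \<Prod>s\<in>S. f s y) \<in> polyfun"
  by (induction S rule: finite_induct) (auto intro: polyfun.intros)

lemma polyfun_compose:
  assumes "p \<in> polyfun" "\<And>i. (\<lambda>y. \<Phi> y i) \<in> polyfun"
  shows "(\<lambda>y. p (\<Phi> y)) \<in> polyfun"
  using assms(1) by induction (auto intro: polyfun.intros assms(2))

definition polymat :: "(('i \<Rightarrow> 'k::comm_ring_1) \<Rightarrow> 'k ^ 'm ^ 'n) \<Rightarrow> bool" where
  "polymat A \<longleftrightarrow> (\<forall>i j. (\<lambda>y. A y $ i $ j) \<in> polyfun)"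

lemma polymat_const: "polymat (\<lambda>y. A)"
  by (simp add: polymat_def polyfun.const)

lemma polymat_add: "polymat A \<Longrightarrow> polymat B \<Longrightarrow> polymat (\<lambda>y. A y + B y)"
  by (simp add: polymat_def polyfun.add)

lemma polymat_mult: "polymat A \<Longrightarrow> polymat B \<Longrightarrow> polymat (\<lambda>y. A y ** B y)"
  by (simp add: polymat_def matrix_matrix_mult_def polyfun_sum polyfun.mult)

lemma polymat_sum: "finite S \<Longrightarrow> (\<And>s. s \<in> S \<Longrightarrow> polymat (A s)) \<Longrightarrow> polymat (\<lambda>y. \<Sum>s\<in>S. A s y)"
  by (simp add: polymat_def polyfun_sum)

lemma polyfun_det: "polymat A \<Longrightarrow> (\<lambda>y. det (A y)) \<in> polyfun"
  unfolding det_def polymat_def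
  by (intro polyfun_sum polyfun.mult polyfun_prod polyfun.const) (auto simp: finite_permutations)

text \<open>The local ring at \<open>y0\<close>: functions that agree with a quotient of polynomials wherever the
  denominator is nonzero, the denominator being nonzero at \<open>y0\<close>.\<close>

definition reg :: "('i \<Rightarrow> 'k::field) \<Rightarrow> (('i \<Rightarrow> 'k) \<Rightarrow> 'k) \<Rightarrow> bool" where
  "reg y0 f \<longleftrightarrow> (\<exists>p\<in>polyfun. \<exists>D\<in>polyfun. D y0 \<noteq> 0 \<and> (\<forall>y. D y \<noteq> 0 \<longrightarrow> f y = p y / D y))"

lemma reg_polyfun: "p \<in> polyfun \<Longrightarrow> reg y0 p"
  unfolding reg_def by (rule bexI[of _ p], rule bexI[of _ "\<lambda>_. 1"]) (auto intro: polyfun.const)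

lemma reg_add:
  assumes "reg y0 f" "reg y0 g" shows "reg y0 (\<lambda>y. f y + g y)"
proof -
  obtain p D q E where *: "p \<in> polyfun" "D \<in> polyfun" "D y0 \<noteq> 0" "\<forall>y. D y \<noteq> 0 \<longrightarrow> f y = p y / D y"
    "q \<in> polyfun" "E \<in> polyfun" "E y0 \<noteq> 0" "\<forall>y. E y \<noteq> 0 \<longrightarrow> g y = q y / E y"
    using assms unfolding reg_def by blast
  show ?thesis unfolding reg_def
    by (rule bexI[of _ "\<lambda>y. p y * E y + q y * D y"], rule bexI[of _ "\<lambda>y. D y * E y"])
      (use * in \<open>auto intro!: polyfun.add polyfun.mult simp: add_frac_eq\<close>)
qed

lemma reg_mult:
  assumes "reg y0 f" "reg y0 g" shows "reg y0 (\<lambda>y. f y * g y)"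
proof -
  obtain p D q E where *: "p \<in> polyfun" "D \<in> polyfun" "D y0 \<noteq> 0" "\<forall>y. D y \<noteq> 0 \<longrightarrow> f y = p y / D y"
    "q \<in> polyfun" "E \<in> polyfun" "E y0 \<noteq> 0" "\<forall>y. E y \<noteq> 0 \<longrightarrow> g y = q y / E y"
    using assms unfolding reg_def by blast
  show ?thesis unfolding reg_def
    by (rule bexI[of _ "\<lambda>y. p y * q y"], rule bexI[of _ "\<lambda>y. D y * E y"])
      (use * in \<open>auto intro!: polyfun.mult\<close>)
qed

text \<open>Serves to evaluate a polynomial that detects an orbit in n on a section with regular
  entries.\<close>

lemma reg_compose:
  assumes "p \<in> polyfun" "\<And>i. reg y0 (\<lambda>y. \<Phi> y i)"
  shows "reg y0 (\<lambda>y. p (\<Phi> y))"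
  using assms(1) by induction (auto intro: reg_polyfun polyfun.const assms(2) reg_add reg_mult)

definition regmat :: "('i \<Rightarrow> 'k::field) \<Rightarrow> (('i \<Rightarrow> 'k) \<Rightarrow> 'k ^ 'm ^ 'n) \<Rightarrow> bool" where
  "regmat y0 A \<longleftrightarrow> (\<forall>i j. reg y0 (\<lambda>y. A y $ i $ j))"

lemma regmat_polymat: "polymat A \<Longrightarrow> regmat y0 A"
  by (simp add: polymat_def regmat_def reg_polyfun)

lemma reg_sum: "finite S \<Longrightarrow> (\<And>s. s \<in> S \<Longrightarrow> reg y0 (f s)) \<Longrightarrow> reg y0 (\<lambda>y. \<Sum>s\<in>S. f s y)"
  by (induction S rule: finite_induct) (auto intro: reg_add reg_polyfun polyfun.const)

lemma regmat_mult: "regmat y0 A \<Longrightarrow> regmat y0 B \<Longrightarrow> regmat y0 (\<lambda>y. A y ** B y)"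
  by (simp add: regmat_def matrix_matrix_mult_def reg_sum reg_mult)

lemma regmat_sum: "finite S \<Longrightarrow> (\<And>s. s \<in> S \<Longrightarrow> regmat y0 (A s)) \<Longrightarrow> regmat y0 (\<lambda>y. \<Sum>s\<in>S. A s y)"
  by (simp add: regmat_def reg_sum)

text \<open>By Cramer's rule all entries share the denominator \<open>det (A y)\<close>, a
  polynomial in \<open>y\<close> that is nonzero at \<open>y0\<close>.\<close>

lemma regmat_matrix_inv:
  assumes "polymat A" "det (A y0) \<noteq> 0"
  shows "regmat y0 (\<lambda>y. matrix_inv (A y))"
  unfolding regmat_def
proof (intro allI)
  fix i j
  let ?q = "\<lambda>y. det (\<chi> p q. if q = i then axis j 1 $ p else A y $ p $ q)"
  have "polymat (\<lambda>y. \<chi> p q. if q = i then axis j 1 $ p else A y $ p $ q)"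
    unfolding polymat_def
  proof (intro allI)
    fix p q
    show "(\<lambda>y. (\<chi> p q. if q = i then axis j 1 $ p else A y $ p $ q) $ p $ q) \<in> polyfun"
      using assms(1) by (cases "q = i") (simp_all add: polymat_def polyfun.const)
  qed
  then have "?q \<in> polyfun" by (rule polyfun_det)
  then show "reg y0 (\<lambda>y. matrix_inv (A y) $ i $ j)"
    unfolding reg_def
    by (rule bexI[rotated], intro bexI[of _ "\<lambda>y. det (A y)"])
      (use assms in \<open>auto simp: matrix_inv_nth polyfun_det\<close>)
qed

section \<open>Standard forms over a quiver of coordinate subspaces\<close>

text \<open>The interface through which the flags enter: \<open>I t\<close> indexes a basis of Y_t,
  and \<open>B t\<close> the part of it that spans E_t. The disjointness axioms make the sums over
  arrows direct, and nonempty blocks make the inclusions along arrows strict.\<close>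

locale block_quiver =
  fixes Vt Ar :: "nat set" and src tgt :: "nat \<Rightarrow> nat" and I B :: "nat \<Rightarrow> 'n::finite set"
  assumes finite_Vt: "finite Vt" and finite_Ar: "finite Ar"
    and src_in: "\<alpha> \<in> Ar \<Longrightarrow> src \<alpha> \<in> Vt"
    and tgt_in: "\<alpha> \<in> Ar \<Longrightarrow> tgt \<alpha> \<in> Vt"
    and I_eq: "t \<in> Vt \<Longrightarrow> I t = B t \<union> (\<Union>\<alpha>\<in>{\<alpha>\<in>Ar. tgt \<alpha> = t}. I (src \<alpha>))"
    and B_I_disj: "\<alpha> \<in> Ar \<Longrightarrow> B (tgt \<alpha>) \<inter> I (src \<alpha>) = {}"
    and I_I_disj: "\<alpha> \<in> Ar \<Longrightarrow> \<beta> \<in> Ar \<Longrightarrow> \<alpha> \<noteq> \<beta> \<Longrightarrow> tgt \<alpha> = tgt \<beta> \<Longrightarrow> I (src \<alpha>) \<inter> I (src \<beta>) = {}"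
    and B_nonempty: "t \<in> Vt \<Longrightarrow> B t \<noteq> {}"
    and B_cover: "(\<Union>t\<in>Vt. B t) = UNIV"
    and B_disj: "s \<in> Vt \<Longrightarrow> t \<in> Vt \<Longrightarrow> s \<noteq> t \<Longrightarrow> B s \<inter> B t = {}"
begin

definition inc :: "nat \<Rightarrow> nat set" where
  "inc t = {\<alpha>\<in>Ar. tgt \<alpha> = t}"

lemma finite_inc [simp]: "finite (inc t)"
  using finite_Ar by (simp add: inc_def)

lemma incD: "\<alpha> \<in> inc t \<Longrightarrow> \<alpha> \<in> Ar \<and> tgt \<alpha> = t \<and> src \<alpha> \<in> Vt \<and> t \<in> Vt"
  by (auto simp: inc_def src_in tgt_in)

abbreviation p :: "nat \<Rightarrow> 'k::field ^ 'n ^ 'n" where "p t \<equiv> prj (I t)"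
abbreviation b :: "nat \<Rightarrow> 'k::field ^ 'n ^ 'n" where "b t \<equiv> prj (B t)"

lemma I_diff: "t \<in> Vt \<Longrightarrow> I t - B t = (\<Union>\<alpha>\<in>inc t. I (src \<alpha>))"
  using I_eq[of t] B_I_disj by (auto simp: inc_def)

lemma I_src_sub: "\<alpha> \<in> Ar \<Longrightarrow> I (src \<alpha>) \<subseteq> I (tgt \<alpha>) - B (tgt \<alpha>)"
  using I_diff[OF tgt_in] by (auto simp: inc_def)

lemma B_sub: "t \<in> Vt \<Longrightarrow> B t \<subseteq> I t"
  using I_eq by blast

lemma card_I_less: "\<alpha> \<in> Ar \<Longrightarrow> card (I (src \<alpha>)) < card (I (tgt \<alpha>))"
  using I_src_sub[of \<alpha>] B_nonempty[OF tgt_in, of \<alpha>] B_sub[OF tgt_in, of \<alpha>]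
  by (intro psubset_card_mono) auto

text \<open>The size of \<open>I t\<close> grows strictly along arrows, so arguments can pass from
  sources to targets without naming an order of the vertices.\<close>

lemma vertex_induct [consumes 1, case_names step]:
  assumes "t \<in> Vt" "\<And>t. t \<in> Vt \<Longrightarrow> (\<And>\<alpha>. \<alpha> \<in> inc t \<Longrightarrow> P (src \<alpha>)) \<Longrightarrow> P t"
  shows "P t"
  using assms(1)
proof (induction "card (I t)" arbitrary: t rule: less_induct)
  case less
  show ?case
    by (rule assms(2)[OF less.prems], rule less.hyps) (use card_I_less in \<open>auto dest: incD\<close>)
qed

lemma p_src:
  assumes "\<alpha> \<in> Ar"
  shows "p (tgt \<alpha>) ** p (src \<alpha>) = p (src \<alpha>)" "p (src \<alpha>) ** p (tgt \<alpha>) = p (src \<alpha>)"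
  using I_src_sub[OF assms] by (auto simp: prj_prj intro!: arg_cong[of _ _ prj])

lemma p_src_orth: "\<alpha> \<in> inc t \<Longrightarrow> \<beta> \<in> inc t \<Longrightarrow> \<alpha> \<noteq> \<beta> \<Longrightarrow> p (src \<alpha>) ** p (src \<beta>) = 0"
  using I_I_disj[of \<alpha> \<beta>] by (auto simp: prj_prj prj_empty inc_def)

lemma p_b: "t \<in> Vt \<Longrightarrow> p t ** b t = b t" "t \<in> Vt \<Longrightarrow> b t ** p t = b t"
  using B_sub by (auto simp: prj_prj intro!: arg_cong[of _ _ prj])

lemma b_src: "\<alpha> \<in> Ar \<Longrightarrow> b (tgt \<alpha>) ** p (src \<alpha>) = 0"
  by (simp add: prj_prj B_I_disj prj_empty)

lemma prj_I_diff: "t \<in> Vt \<Longrightarrow> prj (I t - B t) = (\<Sum>\<alpha>\<in>inc t. p (src \<alpha>))"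
  unfolding I_diff by (rule prj_UN) (use I_I_disj in \<open>auto simp: inc_def finite_Ar\<close>)

lemma p_decomp: "t \<in> Vt \<Longrightarrow> p t = b t + (\<Sum>\<alpha>\<in>inc t. p (src \<alpha>))"
  unfolding prj_I_diff[symmetric]
  by (subst prj_Un[symmetric]) (use B_sub in \<open>auto intro!: arg_cong[of _ _ prj]\<close>)

lemma sum_b: "(\<Sum>t\<in>Vt. b t) = mat 1"
  by (subst prj_UN[symmetric]) (use B_disj finite_Vt in \<open>auto simp: B_cover prj_UNIV\<close>)

lemma b_b: "s \<in> Vt \<Longrightarrow> t \<in> Vt \<Longrightarrow> b s ** b t = (if s = t then b t else 0)"
  using B_disj by (auto simp: prj_prj prj_empty)

section \<open>Gluing maps along the inclusions of the spaces Y_t\<close>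

lemma eq_on_blocks:
  assumes "\<And>t. t \<in> Vt \<Longrightarrow> A ** b t = C ** b t"
  shows "A = C"
proof -
  have "A ** (\<Sum>t\<in>Vt. b t) = C ** (\<Sum>t\<in>Vt. b t)"
    using assms by (simp add: matrix_mult_sum_right)
  then show ?thesis by (simp add: sum_b)
qed

text \<open>Only the columns of \<open>f t\<close> in the block of \<open>t\<close> are used; since
  the blocks partition the coordinates, any family gives one matrix.\<close>

definition glue :: "(nat \<Rightarrow> 'k::field ^ 'n ^ 'n) \<Rightarrow> 'k ^ 'n ^ 'n" where
  "glue f = (\<Sum>t\<in>Vt. f t ** b t)"

lemma glue_b: "t \<in> Vt \<Longrightarrow> glue f ** b t = f t ** b t"
proof -
  assume t: "t \<in> Vt"
  have "glue f ** b t = (\<Sum>s\<in>Vt. f s ** (b s ** b t))"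
    by (simp add: glue_def matrix_mult_sum_left matrix_mul_assoc)
  also have "\<dots> = (\<Sum>s\<in>Vt. if s = t then f t ** b t else 0)"
    by (rule sum.cong) (use t in \<open>auto simp: b_b\<close>)
  finally show ?thesis using t finite_Vt by simp
qed

text \<open>For a family that agrees along every arrow, the induction over Y_t = E_t + (sum of the
  source spaces) recovers \<open>f t\<close> on all of Y_t. This turns compatible maps at the
  vertices into one endomorphism of V.\<close>

lemma glue_p:
  assumes "t \<in> Vt"
    and "\<And>\<alpha>. \<alpha> \<in> Ar \<Longrightarrow> f (tgt \<alpha>) ** p (src \<alpha>) = f (src \<alpha>) ** p (src \<alpha>)"
  shows "glue f ** p t = f t ** p t"
  using assms(1)
proof (induction t rule: vertex_induct)
  case (step t)
  have "glue f ** p t = f t ** b t + (\<Sum>\<alpha>\<in>inc t. f t ** p (src \<alpha>))"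
    unfolding p_decomp[OF step.hyps] matrix_add_ldistrib matrix_mult_sum_right
    using step assms(2) by (auto simp: glue_b dest: incD intro!: sum.cong)
  then show ?case
    unfolding p_decomp[OF step.hyps] by (simp add: matrix_add_ldistrib matrix_mult_sum_right)
qed

text \<open>Control on the blocks suffices, because Y_t is built from its block and the source
  spaces, and \<open>Z\<close> grows along arrows. Applied with \<open>Z t = I t - B t\<close> and
  with \<open>Z t = I t\<close>.\<close>

lemma maps_into:
  fixes x :: "'k::field ^ 'n ^ 'n"
  assumes "t \<in> Vt" and Z: "\<And>\<alpha>. \<alpha> \<in> Ar \<Longrightarrow> Z (src \<alpha>) \<subseteq> Z (tgt \<alpha>)"
    and x: "\<And>t. t \<in> Vt \<Longrightarrow> prj (Z t) ** x ** b t = x ** b t"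
  shows "prj (Z t) ** (x ** p t) = x ** p t"
  using assms(1)
proof (induction t rule: vertex_induct)
  case (step t)
  have "prj (Z t) ** (x ** p (src \<alpha>)) = x ** p (src \<alpha>)" if "\<alpha> \<in> inc t" for \<alpha>
  proof -
    have "prj (Z t) ** prj (Z (src \<alpha>)) = (prj (Z (src \<alpha>)) :: 'k ^ 'n ^ 'n)"
      using Z[of \<alpha>] incD[OF that] by (auto simp: prj_prj intro!: arg_cong[of _ _ prj])
    then show ?thesis using step.IH[OF that] by (metis matrix_mul_assoc)
  qed
  then show ?case
    unfolding p_decomp[OF step.hyps] using x[OF step.hyps]
    by (simp add: matrix_add_ldistrib matrix_mult_sum_right matrix_mul_assoc)
qed

text \<open>The radical n in coordinates where the adapted basis is standard; \<open>pres\<close> is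
  the seaweed algebra in the same sense.\<close>

definition nil :: "('k::field ^ 'n ^ 'n) set" where
  "nil = {x. \<forall>t\<in>Vt. prj (I t - B t) ** x ** b t = x ** b t}"

definition pres :: "'k::field ^ 'n ^ 'n \<Rightarrow> bool" where
  "pres g \<longleftrightarrow> (\<forall>t\<in>Vt. p t ** g ** b t = g ** b t)"

text \<open>The inverse is carried along, so that both elements satisfy the same conditions and both
  restrict to every Y_t.\<close>

definition grp :: "'k::field ^ 'n ^ 'n \<Rightarrow> 'k ^ 'n ^ 'n \<Rightarrow> bool" where
  "grp g h \<longleftrightarrow> g ** h = mat 1 \<and> h ** g = mat 1 \<and> pres g \<and> pres h"

lemma nil_p: "x \<in> nil \<Longrightarrow> t \<in> Vt \<Longrightarrow> prj (I t - B t) ** (x ** p t) = x ** p t"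
  by (rule maps_into) (use I_src_sub in \<open>auto simp: nil_def\<close>)

text \<open>On Y_t the map \<open>x\<close> is the sum of its components in the source spaces, so
  the backward maps of the standard representation determine \<open>x\<close>.\<close>

lemma nil_p_sum: "x \<in> nil \<Longrightarrow> t \<in> Vt \<Longrightarrow> (\<Sum>\<alpha>\<in>inc t. p (src \<alpha>) ** x ** p t) = x ** p t"
  using nil_p[of x t] by (simp add: prj_I_diff matrix_mult_sum_left matrix_mul_assoc)

lemma pres_p: "pres g \<Longrightarrow> t \<in> Vt \<Longrightarrow> p t ** (g ** p t) = g ** p t"
  by (rule maps_into) (use I_src_sub in \<open>auto simp: pres_def\<close>)

lemma nil_pres:
  fixes x :: "'k::field ^ 'n ^ 'n"
  assumes x: "x \<in> nil"
  shows "pres x"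
proof -
  have "p t ** x ** b t = x ** b t" if "t \<in> Vt" for t
  proof -
    have q: "prj (I t - B t) ** (x ** b t) = x ** b t"
      using x that by (simp add: nil_def matrix_mul_assoc)
    have "p t ** prj (I t - B t) = (prj (I t - B t) :: 'k ^ 'n ^ 'n)"
      by (auto simp: prj_prj intro!: arg_cong[of _ _ prj])
    then have "p t ** (prj (I t - B t) ** (x ** b t)) = prj (I t - B t) ** (x ** b t)"
      by (simp add: matrix_mul_assoc)
    then show ?thesis unfolding q by (simp add: matrix_mul_assoc)
  qed
  then show ?thesis by (simp add: pres_def)
qed

text \<open>Types the two families inside square matrices: \<open>N \<alpha>\<close> goes from the
  source space of \<alpha> to the target space, \<open>N' \<alpha>\<close> goes back, and both
  vanish elsewhere.\<close>

definition shaped :: "(nat \<Rightarrow> 'k::field ^ 'n ^ 'n) \<Rightarrow> (nat \<Rightarrow> 'k ^ 'n ^ 'n) \<Rightarrow> bool" where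
  "shaped N N' \<longleftrightarrow> (\<forall>\<alpha>\<in>Ar. p (tgt \<alpha>) ** N \<alpha> = N \<alpha> \<and> N \<alpha> ** p (src \<alpha>) = N \<alpha>
     \<and> p (src \<alpha>) ** N' \<alpha> = N' \<alpha> \<and> N' \<alpha> ** p (tgt \<alpha>) = N' \<alpha>)"

definition relns :: "(nat \<Rightarrow> 'k::field ^ 'n ^ 'n) \<Rightarrow> (nat \<Rightarrow> 'k ^ 'n ^ 'n) \<Rightarrow> bool" where
  "relns N N' \<longleftrightarrow> (\<forall>\<alpha>\<in>Ar. N' \<alpha> ** N \<alpha> = (\<Sum>\<gamma>\<in>inc (src \<alpha>). N \<gamma> ** N' \<gamma>))
     \<and> (\<forall>\<alpha>\<in>Ar. \<forall>\<beta>\<in>Ar. \<alpha> \<noteq> \<beta> \<and> tgt \<alpha> = tgt \<beta> \<longrightarrow> N' \<beta> ** N \<alpha> = 0)"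

text \<open>Injectivity of the maps into \<open>t\<close> and independence of their images, as injectivity of the sum of
  these maps.\<close>

definition delta :: "(nat \<Rightarrow> 'k::field ^ 'n ^ 'n) \<Rightarrow> bool" where
  "delta N \<longleftrightarrow> (\<forall>t\<in>Vt. \<forall>v. prj (I t - B t) *v v = v \<longrightarrow> (\<Sum>\<alpha>\<in>inc t. N \<alpha>) *v v = 0 \<longrightarrow> v = 0)"

text \<open>An isomorphism from the system of inclusions of the Y_t to the system of forward maps
  \<open>N\<close>. Backward maps do not enter; they are transported afterwards.\<close>

definition frame :: "(nat \<Rightarrow> 'k::field ^ 'n ^ 'n) \<Rightarrow> (nat \<Rightarrow> 'k ^ 'n ^ 'n) \<Rightarrow> (nat \<Rightarrow> 'k ^ 'n ^ 'n) \<Rightarrow> bool" where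
  "frame N G K \<longleftrightarrow> (\<forall>t\<in>Vt. inv_on (I t) (G t) (K t))
     \<and> (\<forall>\<alpha>\<in>Ar. G (tgt \<alpha>) ** p (src \<alpha>) = N \<alpha> ** G (src \<alpha>))"

section \<open>The standard representation of a nilpotent element\<close>

lemma std_shaped:
  fixes x :: "'k::field ^ 'n ^ 'n"
  shows "shaped (\<lambda>\<alpha>. p (src \<alpha>)) (\<lambda>\<alpha>. p (src \<alpha>) ** x ** p (tgt \<alpha>))"
proof -
  have "p s ** (p s ** x ** p t) = p s ** x ** p t" for s t
    by (simp add: matrix_mul_assoc prj_prj)
  moreover have "p s ** x ** p t ** p t = p s ** x ** p t" for s t
    by (simp add: prj_prj flip: matrix_mul_assoc)
  moreover have "p s ** p s = (p s :: 'k ^ 'n ^ 'n)" for s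
    by (simp add: prj_prj)
  ultimately show ?thesis unfolding shaped_def by (simp add: p_src)
qed

lemma std_delta: "delta (\<lambda>\<alpha>. p (src \<alpha>))"
  unfolding delta_def by (auto simp: prj_I_diff)

text \<open>Since \<open>x\<close> preserves every Y_s, both sides of the first relation are
  \<open>x\<close> restricted to the source space. The second holds because the source spaces of
  distinct arrows into one vertex meet in zero.\<close>

lemma std_relns:
  assumes "x \<in> nil"
  shows "relns (\<lambda>\<alpha>. p (src \<alpha>)) (\<lambda>\<alpha>. p (src \<alpha>) ** x ** p (tgt \<alpha>))"
  unfolding relns_def
proof (intro conjI ballI impI)
  fix \<alpha> assume a: "\<alpha> \<in> Ar"
  have "p (src \<alpha>) ** x ** p (tgt \<alpha>) ** p (src \<alpha>) = p (src \<alpha>) ** (x ** p (src \<alpha>))"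
    using a by (simp add: matrix_mul_assoc[symmetric] p_src)
  also have "\<dots> = x ** p (src \<alpha>)"
    using a assms by (simp add: pres_p nil_pres src_in)
  also have "\<dots> = (\<Sum>\<gamma>\<in>inc (src \<alpha>). p (src \<gamma>) ** x ** p (src \<alpha>))"
    using a assms by (simp add: nil_p_sum src_in)
  also have "\<dots> = (\<Sum>\<gamma>\<in>inc (src \<alpha>). p (src \<gamma>) ** (p (src \<gamma>) ** x ** p (tgt \<gamma>)))"
    by (rule sum.cong) (auto simp: matrix_mul_assoc prj_prj inc_def)
  finally show "p (src \<alpha>) ** x ** p (tgt \<alpha>) ** p (src \<alpha>) = \<dots>" .
next
  fix \<alpha> \<beta> assume a: "\<alpha> \<in> Ar" "\<beta> \<in> Ar" "\<alpha> \<noteq> \<beta> \<and> tgt \<alpha> = tgt \<beta>"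
  have "p (src \<beta>) ** x ** p (tgt \<beta>) ** p (src \<alpha>) = p (src \<beta>) ** (x ** p (src \<alpha>))"
    using a by (simp add: matrix_mul_assoc[symmetric] p_src flip: a(3)[THEN conjunct2])
  also have "\<dots> = p (src \<beta>) ** p (src \<alpha>) ** (x ** p (src \<alpha>))"
    using a assms by (simp add: pres_p nil_pres src_in flip: matrix_mul_assoc)
  also have "\<dots> = 0"
    using a by (subst p_src_orth[of _ "tgt \<alpha>"]) (auto simp: inc_def)
  finally show "p (src \<beta>) ** x ** p (tgt \<beta>) ** p (src \<alpha>) = 0" .
qed

text \<open>\<open>delta\<close> is applied to \<open>w\<close>, whose component in each source
  space is \<open>g \<alpha> *v v\<close>; then each \<open>g \<alpha>\<close> is undone by
  \<open>k \<alpha>\<close>. Automorphisms of the sources therefore do not disturb the independence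
  of the images.\<close>

lemma delta_twist:
  fixes N :: "nat \<Rightarrow> 'k::field ^ 'n ^ 'n"
  assumes de: "delta N" and t: "t \<in> Vt"
    and pN: "\<And>\<alpha>. \<alpha> \<in> inc t \<Longrightarrow> N \<alpha> ** p (src \<alpha>) = N \<alpha>"
    and inv: "\<And>\<alpha>. \<alpha> \<in> inc t \<Longrightarrow> inv_on (I (src \<alpha>)) (g \<alpha>) (k \<alpha>)"
    and v: "prj (I t - B t) *v v = v" "(\<Sum>\<alpha>\<in>inc t. N \<alpha> ** g \<alpha>) *v v = 0"
  shows "v = 0"
proof -
  define w where "w = (\<Sum>\<alpha>\<in>inc t. g \<alpha> *v v)"
  have gp: "p (src \<alpha>) ** g \<beta> = (if \<alpha> = \<beta> then g \<alpha> else 0)" if "\<alpha> \<in> inc t" "\<beta> \<in> inc t" for \<alpha> \<beta>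
    using p_src_orth[OF that] inv_onD(1)[OF inv[OF that(2)]]
    by (metis inv_onD(1)[OF inv[OF that(1)]] matrix_mul_assoc times0_left)
  have pw: "p (src \<alpha>) *v w = g \<alpha> *v v" if "\<alpha> \<in> inc t" for \<alpha>
  proof -
    have "p (src \<alpha>) *v w = (\<Sum>\<beta>\<in>inc t. p (src \<alpha>) ** g \<beta>) *v v"
      by (simp add: w_def matrix_sum_mult_vec[symmetric] matrix_vector_mul_assoc matrix_mult_sum_right)
    also have "(\<Sum>\<beta>\<in>inc t. p (src \<alpha>) ** g \<beta>) = g \<alpha>"
      using that by (simp add: gp cong: sum.cong)
    finally show ?thesis .
  qed
  have "prj (I t - B t) *v w = w"
    using t by (simp add: prj_I_diff matrix_sum_mult_vec pw w_def[symmetric] cong: sum.cong)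
  moreover have "(\<Sum>\<alpha>\<in>inc t. N \<alpha>) *v w = 0"
  proof -
    have "N \<alpha> *v w = (N \<alpha> ** g \<alpha>) *v v" if "\<alpha> \<in> inc t" for \<alpha>
      using pw[OF that] pN[OF that] by (metis matrix_vector_mul_assoc)
    then have "(\<Sum>\<alpha>\<in>inc t. N \<alpha>) *v w = (\<Sum>\<alpha>\<in>inc t. N \<alpha> ** g \<alpha>) *v v"
      by (simp add: matrix_sum_mult_vec)
    then show ?thesis using v(2) by simp
  qed
  ultimately have "w = 0" using de t by (auto simp: delta_def)
  then have gv: "g \<alpha> *v v = 0" if "\<alpha> \<in> inc t" for \<alpha>
    using pw[OF that] by simp
  have "p (src \<alpha>) *v v = 0" if "\<alpha> \<in> inc t" for \<alpha>
    using gv[OF that] inv_onD(6)[OF inv[OF that]]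
    by (metis matrix_vector_mul_assoc matrix_vector_mult_0_right)
  then have "prj (I t - B t) *v v = 0"
    using t by (simp add: prj_I_diff matrix_sum_mult_vec)
  then show "v = 0" using v(1) by simp
qed

text \<open>At a vertex the matrix is prescribed by \<open>H\<close> on the sum of the source spaces
  and free on the block. \<open>delta_twist\<close> makes \<open>H\<close> injective there, and
  \<open>extend_injective\<close> fills the block. Each choice depends on those at the sources,
  hence the recursion over \<open>R\<close>.\<close>

lemma frame_exists:
  fixes N :: "nat \<Rightarrow> 'k::field ^ 'n ^ 'n"
  assumes sh: "shaped N N'" and de: "delta N"
  shows "\<exists>G K. frame N G K"
proof -
  define R where "R = {(s, t). \<exists>\<alpha>\<in>inc t. s = src \<alpha>}"
  have "wf R"
    by (rule wf_subset[OF wf_measure[of "\<lambda>t. card (I t)"]])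
      (use card_I_less in \<open>auto simp: R_def inc_def\<close>)
  \<comment> \<open>A value \<open>r\<close> pairs the matrix at \<open>t\<close> with its inverse.
    Nothing is required off \<open>Vt\<close>, since the choice principle wants a value at every
    natural number.\<close>
  define P where "P f t r = (t \<in> Vt \<longrightarrow> inv_on (I t) (fst r) (snd r) \<and>
      (\<forall>\<alpha>\<in>inc t. fst r ** p (src \<alpha>) = N \<alpha> ** fst (f (src \<alpha>))))"
    for f :: "nat \<Rightarrow> ('k ^ 'n ^ 'n) \<times> ('k ^ 'n ^ 'n)" and t r
  have "\<exists>f. \<forall>t. P f t (f t)"
  proof (rule dependent_wf_choice[OF \<open>wf R\<close>])
    fix f g :: "nat \<Rightarrow> ('k ^ 'n ^ 'n) \<times> ('k ^ 'n ^ 'n)" and t r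
    assume "\<And>z. (z, t) \<in> R \<Longrightarrow> f z = g z"
    then have "f (src \<alpha>) = g (src \<alpha>)" if "\<alpha> \<in> inc t" for \<alpha>
      using that by (auto simp: R_def)
    then show "P f t r = P g t r" by (simp add: P_def)
  next
    fix t and f :: "nat \<Rightarrow> ('k ^ 'n ^ 'n) \<times> ('k ^ 'n ^ 'n)"
    assume IH: "\<And>y. (y, t) \<in> R \<Longrightarrow> P f y (f y)"
    show "\<exists>r. P f t r"
    proof (cases "t \<in> Vt")
      case True
      let ?g = "\<lambda>\<alpha>. fst (f (src \<alpha>))"
      have inv: "inv_on (I (src \<alpha>)) (?g \<alpha>) (snd (f (src \<alpha>)))" if "\<alpha> \<in> inc t" for \<alpha>
        using IH[of "src \<alpha>"] that incD[OF that] by (auto simp: R_def P_def)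
      define H where "H = (\<Sum>\<alpha>\<in>inc t. N \<alpha> ** ?g \<alpha>)"
      have pN: "p t ** N \<alpha> = N \<alpha>" "N \<alpha> ** p (src \<alpha>) = N \<alpha>" if "\<alpha> \<in> inc t" for \<alpha>
        using sh that by (auto simp: shaped_def inc_def)
      have "p t ** H = H"
        by (simp add: H_def matrix_mult_sum_right matrix_mul_assoc pN cong: sum.cong)
      moreover have "v = 0" if "prj (I t - B t) *v v = v" "H *v v = 0" for v
        using delta_twist[OF de True pN(2) inv that(1)] that(2) by (simp add: H_def)
      ultimately obtain G K where GK: "inv_on (I t) G K" "G ** prj (I t - B t) = H ** prj (I t - B t)"
        using extend_injective[of "I t - B t" "I t" H] by blast
      have "G ** p (src \<alpha>) = N \<alpha> ** ?g \<alpha>" if a: "\<alpha> \<in> inc t" for \<alpha>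
      proof -
        have "prj (I t - B t) ** p (src \<alpha>) = (p (src \<alpha>) :: 'k ^ 'n ^ 'n)"
          using I_src_sub[of \<alpha>] incD[OF a] by (auto simp: prj_prj intro!: arg_cong[of _ _ prj])
        then have "G ** p (src \<alpha>) = H ** p (src \<alpha>)"
          using GK(2) by (metis matrix_mul_assoc)
        also have "\<dots> = (\<Sum>\<beta>\<in>inc t. N \<beta> ** (?g \<beta> ** p (src \<alpha>)))"
          by (simp add: H_def matrix_mult_sum_left matrix_mul_assoc)
        also have "\<dots> = (\<Sum>\<beta>\<in>inc t. if \<beta> = \<alpha> then N \<alpha> ** ?g \<alpha> else 0)"
        proof (rule sum.cong[OF refl])
          fix \<beta> assume b: "\<beta> \<in> inc t"
          show "N \<beta> ** (?g \<beta> ** p (src \<alpha>)) = (if \<beta> = \<alpha> then N \<alpha> ** ?g \<alpha> else 0)"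
            using inv_onD(2)[OF inv[OF b]] p_src_orth[OF b a]
            by (metis matrix_mul_assoc times0_right)
        qed
        finally show ?thesis using a by simp
      qed
      with GK(1) have "P f t (G, K)" by (simp add: P_def)
      then show ?thesis by blast
    qed (simp add: P_def)
  qed
  then obtain f where "\<And>t. P f t (f t)" by blast
  then have "frame N (\<lambda>t. fst (f t)) (\<lambda>t. snd (f t))"
    unfolding frame_def P_def by (auto simp: inc_def tgt_in)
  then show ?thesis by blast
qed

section \<open>Transporting a framed representation to standard form\<close>

lemma frame_inv: "frame N G K \<Longrightarrow> t \<in> Vt \<Longrightarrow> inv_on (I t) (G t) (K t)"
  by (simp add: frame_def)

text \<open>In frame coordinates \<open>N \<alpha>\<close> is the inclusion of the source space; the
  second identity states this after composing with the inverse frame at the target.\<close>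

lemma frame_arrow:
  assumes "frame N G K" "shaped N N'" "\<alpha> \<in> Ar"
  shows "N \<alpha> = G (tgt \<alpha>) ** p (src \<alpha>) ** K (src \<alpha>)" "K (tgt \<alpha>) ** N \<alpha> = K (src \<alpha>)"
proof -
  note s = inv_onD[OF frame_inv[OF assms(1) src_in[OF assms(3)]]]
  note t = inv_onD[OF frame_inv[OF assms(1) tgt_in[OF assms(3)]]]
  have "G (tgt \<alpha>) ** p (src \<alpha>) ** K (src \<alpha>) = N \<alpha> ** (G (src \<alpha>) ** K (src \<alpha>))"
    using assms by (simp add: frame_def matrix_mul_assoc)
  also have "\<dots> = N \<alpha>" using assms by (simp add: s shaped_def)
  finally show *: "N \<alpha> = G (tgt \<alpha>) ** p (src \<alpha>) ** K (src \<alpha>)" by simp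
  have "K (tgt \<alpha>) ** N \<alpha> = K (tgt \<alpha>) ** G (tgt \<alpha>) ** p (src \<alpha>) ** K (src \<alpha>)"
    by (subst *) (simp add: matrix_mul_assoc)
  also have "\<dots> = K (src \<alpha>)"
    using assms(3) by (simp add: t p_src s)
  finally show "K (tgt \<alpha>) ** N \<alpha> = K (src \<alpha>)" .
qed

text \<open>What \<open>x\<close> has to be on Y_t: its component in each source space is the
  backward map read through the frame.\<close>

definition xblk where
  "xblk N' G K t = (\<Sum>\<gamma>\<in>inc t. K (src \<gamma>) ** N' \<gamma> ** G t)"

text \<open>The relations make the matrices \<open>xblk N' G K t\<close> agree along arrows, so that
  they glue. In \<open>compat\<close> the mixed relations remove all terms but one, and the
  remaining relation rewrites that term as the sum defining \<open>xblk\<close> at the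
  source.\<close>

lemma frame_standard_form:
  fixes N :: "nat \<Rightarrow> 'k::field ^ 'n ^ 'n"
  assumes fr: "frame N G K" and sh: "shaped N N'" and re: "relns N N'"
  defines "x \<equiv> glue (xblk N' G K)"
  shows "x \<in> nil"
    and "\<alpha> \<in> Ar \<Longrightarrow> N \<alpha> = G (tgt \<alpha>) ** p (src \<alpha>) ** K (src \<alpha>)"
    and "\<alpha> \<in> Ar \<Longrightarrow> N' \<alpha> = G (src \<alpha>) ** (p (src \<alpha>) ** x ** p (tgt \<alpha>)) ** K (tgt \<alpha>)"
proof -
  let ?X = "xblk N' G K"
  note iv = inv_onD[OF frame_inv[OF fr]]
  have Xp: "?X t ** p t = ?X t" if "t \<in> Vt" for t
    by (simp add: xblk_def matrix_mult_sum_left matrix_mul_assoc[symmetric] iv[OF that])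
  \<comment> \<open>Projecting to one source space isolates one summand, since the
    \<open>K (src \<gamma>)\<close> take values in orthogonal coordinate subspaces.\<close>
  have pX: "p (src \<alpha>) ** ?X (tgt \<alpha>) = K (src \<alpha>) ** N' \<alpha> ** G (tgt \<alpha>)" if a: "\<alpha> \<in> Ar" for \<alpha>
  proof -
    have "p (src \<alpha>) ** ?X (tgt \<alpha>) = (\<Sum>\<gamma>\<in>inc (tgt \<alpha>). (p (src \<alpha>) ** K (src \<gamma>)) ** N' \<gamma> ** G (tgt \<alpha>))"
      by (simp add: xblk_def matrix_mult_sum_right matrix_mul_assoc)
    also have "\<dots> = (\<Sum>\<gamma>\<in>inc (tgt \<alpha>). if \<gamma> = \<alpha> then K (src \<alpha>) ** N' \<alpha> ** G (tgt \<alpha>) else 0)"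
    proof (rule sum.cong[OF refl])
      fix \<gamma> assume g: "\<gamma> \<in> inc (tgt \<alpha>)"
      have pk: "p (src \<gamma>) ** K (src \<gamma>) = K (src \<gamma>)" using iv(3) incD[OF g] by blast
      have "p (src \<alpha>) ** K (src \<gamma>) = 0" if "\<gamma> \<noteq> \<alpha>"
        using p_src_orth[of \<alpha> "tgt \<alpha>" \<gamma>] g a that pk by (metis (mono_tags, lifting) CollectI inc_def matrix_mul_assoc times0_left)
      then show "(p (src \<alpha>) ** K (src \<gamma>)) ** N' \<gamma> ** G (tgt \<alpha>)
          = (if \<gamma> = \<alpha> then K (src \<alpha>) ** N' \<alpha> ** G (tgt \<alpha>) else 0)"
        using pk by auto
    qed
    finally show ?thesis using a by (simp add: inc_def finite_Ar)
  qed
  have compat: "?X (tgt \<alpha>) ** p (src \<alpha>) = ?X (src \<alpha>) ** p (src \<alpha>)" if a: "\<alpha> \<in> Ar" for \<alpha>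
  proof -
    have "?X (tgt \<alpha>) ** p (src \<alpha>) = (\<Sum>\<gamma>\<in>inc (tgt \<alpha>). K (src \<gamma>) ** (N' \<gamma> ** N \<alpha>) ** G (src \<alpha>))"
      using fr a by (simp add: xblk_def matrix_mult_sum_left frame_def flip: matrix_mul_assoc)
    also have "\<dots> = (\<Sum>\<gamma>\<in>inc (tgt \<alpha>). if \<gamma> = \<alpha> then K (src \<alpha>) ** (N' \<alpha> ** N \<alpha>) ** G (src \<alpha>) else 0)"
      by (rule sum.cong) (use re a in \<open>auto simp: relns_def inc_def\<close>)
    also have "\<dots> = K (src \<alpha>) ** (N' \<alpha> ** N \<alpha>) ** G (src \<alpha>)"
      using a by (simp add: inc_def finite_Ar)
    also have "\<dots> = (\<Sum>\<delta>\<in>inc (src \<alpha>). (K (src \<alpha>) ** N \<delta>) ** N' \<delta> ** G (src \<alpha>))"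
      using re a by (simp add: relns_def matrix_mult_sum_left matrix_mult_sum_right matrix_mul_assoc)
    also have "\<dots> = ?X (src \<alpha>)"
      unfolding xblk_def
    proof (rule sum.cong[OF refl])
      fix \<delta> assume "\<delta> \<in> inc (src \<alpha>)"
      then show "(K (src \<alpha>) ** N \<delta>) ** N' \<delta> ** G (src \<alpha>) = K (src \<delta>) ** N' \<delta> ** G (src \<alpha>)"
        using frame_arrow(2)[OF fr sh, of \<delta>] incD by auto
    qed
    finally show ?thesis using Xp[OF src_in[OF a]] by simp
  qed
  have xp: "x ** p t = ?X t" if "t \<in> Vt" for t
    using glue_p[OF that, of ?X] compat Xp[OF that] by (simp add: x_def)
  have "prj (I t - B t) ** ?X t = ?X t" if t: "t \<in> Vt" for t
  proof -
    have "prj (I t - B t) ** K (src \<gamma>) = K (src \<gamma>)" if "\<gamma> \<in> inc t" for \<gamma>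
    proof -
      have "prj (I t - B t) ** p (src \<gamma>) = (p (src \<gamma>) :: 'k ^ 'n ^ 'n)"
        using I_src_sub[of \<gamma>] incD[OF that] by (auto simp: prj_prj intro!: arg_cong[of _ _ prj])
      then show ?thesis using iv(3)[of "src \<gamma>"] incD[OF that] by (metis matrix_mul_assoc)
    qed
    then show ?thesis
      by (simp add: xblk_def matrix_mult_sum_right matrix_mul_assoc)
  qed
  then show "x \<in> nil"
    by (simp add: nil_def x_def glue_b flip: matrix_mul_assoc) (simp add: matrix_mul_assoc)
  show "N \<alpha> = G (tgt \<alpha>) ** p (src \<alpha>) ** K (src \<alpha>)" if "\<alpha> \<in> Ar"
    using frame_arrow(1)[OF fr sh that] .
  show "N' \<alpha> = G (src \<alpha>) ** (p (src \<alpha>) ** x ** p (tgt \<alpha>)) ** K (tgt \<alpha>)" if a: "\<alpha> \<in> Ar"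
  proof -
    have "G (src \<alpha>) ** (p (src \<alpha>) ** x ** p (tgt \<alpha>)) ** K (tgt \<alpha>)
        = G (src \<alpha>) ** (p (src \<alpha>) ** ?X (tgt \<alpha>)) ** K (tgt \<alpha>)"
      using xp[OF tgt_in[OF a]] by (simp flip: matrix_mul_assoc)
    also have "\<dots> = (G (src \<alpha>) ** K (src \<alpha>)) ** N' \<alpha> ** (G (tgt \<alpha>) ** K (tgt \<alpha>))"
      unfolding pX[OF a] by (simp add: matrix_mul_assoc)
    also have "\<dots> = N' \<alpha>"
      using sh a by (simp add: iv src_in tgt_in shaped_def)
    finally show ?thesis by simp
  qed
qed

text \<open>An isomorphism that commutes with the inclusions is a compatible family, so
  \<open>G\<close> and \<open>K\<close> glue to \<open>g\<close> and \<open>h\<close>. Adding up the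
  identities for the backward maps gives the conjugation identity on each Y_t.\<close>

lemma std_iso_imp_conj:
  assumes x: "x \<in> nil" "x' \<in> nil"
    and iv: "\<And>t. t \<in> Vt \<Longrightarrow> inv_on (I t) (G t) (K t)"
    and in1: "\<And>\<alpha>. \<alpha> \<in> Ar \<Longrightarrow> p (src \<alpha>) = G (tgt \<alpha>) ** p (src \<alpha>) ** K (src \<alpha>)"
    and in2: "\<And>\<alpha>. \<alpha> \<in> Ar \<Longrightarrow> p (src \<alpha>) ** x' ** p (tgt \<alpha>)
        = G (src \<alpha>) ** (p (src \<alpha>) ** x ** p (tgt \<alpha>)) ** K (tgt \<alpha>)"
  shows "\<exists>g h. grp g h \<and> x' = g ** x ** h"
proof -
  note iv' = inv_onD[OF iv]
  have Gc: "G (tgt \<alpha>) ** p (src \<alpha>) = G (src \<alpha>) ** p (src \<alpha>)" if a: "\<alpha> \<in> Ar" for \<alpha>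
  proof -
    have "G (tgt \<alpha>) ** p (src \<alpha>) = G (tgt \<alpha>) ** p (src \<alpha>) ** (K (src \<alpha>) ** G (src \<alpha>))"
      by (simp add: iv' src_in a prj_prj flip: matrix_mul_assoc)
    also have "\<dots> = p (src \<alpha>) ** G (src \<alpha>)"
      using in1[OF a] by (simp add: matrix_mul_assoc)
    finally show ?thesis by (simp add: iv' src_in a)
  qed
  have Kc: "K (tgt \<alpha>) ** p (src \<alpha>) = K (src \<alpha>) ** p (src \<alpha>)" if a: "\<alpha> \<in> Ar" for \<alpha>
  proof -
    have "K (tgt \<alpha>) ** p (src \<alpha>) = (K (tgt \<alpha>) ** G (tgt \<alpha>)) ** p (src \<alpha>) ** K (src \<alpha>)"
      by (subst in1[OF a]) (simp add: matrix_mul_assoc)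
    also have "\<dots> = K (src \<alpha>)"
      using a by (simp add: iv' src_in tgt_in p_src)
    finally show ?thesis by (simp add: iv' src_in a)
  qed
  define g where "g = glue G"
  define h where "h = glue K"
  have gp: "g ** p t = G t" and hp: "h ** p t = K t" if "t \<in> Vt" for t
    using glue_p[OF that, of G] glue_p[OF that, of K] Gc Kc that by (simp_all add: iv' g_def h_def)
  have gb: "g ** b t = G t ** b t" "h ** b t = K t ** b t" if "t \<in> Vt" for t
    by (simp_all add: g_def h_def glue_b that)
  have "g ** h = mat 1"
  proof (rule eq_on_blocks)
    fix t assume t: "t \<in> Vt"
    have "g ** h ** b t = g ** (p t ** K t) ** b t"
      using gb(2)[OF t] by (simp add: iv' t flip: matrix_mul_assoc)
    also have "\<dots> = G t ** K t ** b t" by (simp add: matrix_mul_assoc gp t)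
    finally show "g ** h ** b t = mat 1 ** b t" by (simp add: iv' t p_b)
  qed
  moreover have "h ** g = mat 1"
    using \<open>g ** h = mat 1\<close> by (simp add: matrix_left_right_inverse)
  moreover have "pres g" "pres h"
    using gb by (simp_all add: pres_def flip: matrix_mul_assoc) (simp_all add: matrix_mul_assoc iv')
  moreover have "x' = g ** x ** h"
  proof (rule eq_on_blocks)
    fix t assume t: "t \<in> Vt"
    have "x' ** p t = (\<Sum>\<alpha>\<in>inc t. p (src \<alpha>) ** x' ** p t)"
      using nil_p_sum[OF x(2) t] by simp
    also have "\<dots> = (\<Sum>\<alpha>\<in>inc t. g ** (p (src \<alpha>) ** x ** p t) ** K t)"
    proof (rule sum.cong[OF refl])
      fix \<alpha> assume a: "\<alpha> \<in> inc t"
      have "p (src \<alpha>) ** x' ** p t = (g ** p (src \<alpha>)) ** (p (src \<alpha>) ** x ** p t) ** K t"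
        using in2[of \<alpha>] incD[OF a] by (auto simp: gp)
      also have "\<dots> = g ** (p (src \<alpha>) ** p (src \<alpha>)) ** x ** p t ** K t"
        by (simp add: matrix_mul_assoc)
      finally show "p (src \<alpha>) ** x' ** p t = g ** (p (src \<alpha>) ** x ** p t) ** K t"
        by (simp add: prj_prj matrix_mul_assoc)
    qed
    also have "\<dots> = g ** (x ** p t) ** K t"
      unfolding nil_p_sum[OF x(1) t, symmetric]
      by (simp add: matrix_mult_sum_left matrix_mult_sum_right)
    also have "\<dots> = g ** x ** (p t ** K t)" by (simp add: matrix_mul_assoc)
    also have "\<dots> = g ** x ** h ** p t" by (simp add: iv' t matrix_mul_assoc[symmetric] hp)
    finally have "x' ** p t ** b t = g ** x ** h ** p t ** b t" by simp
    then show "x' ** b t = g ** x ** h ** b t"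
      using t by (simp add: p_b flip: matrix_mul_assoc)
  qed
  ultimately show ?thesis unfolding grp_def by blast
qed

lemma conj_imp_std_iso:
  assumes x: "x \<in> nil" and gh: "grp g h" and x': "x' = g ** x ** h"
  shows "t \<in> Vt \<Longrightarrow> inv_on (I t) (g ** p t) (h ** p t)"
    and "\<alpha> \<in> Ar \<Longrightarrow> p (src \<alpha>) = (g ** p (tgt \<alpha>)) ** p (src \<alpha>) ** (h ** p (src \<alpha>))"
    and "\<alpha> \<in> Ar \<Longrightarrow> p (src \<alpha>) ** x' ** p (tgt \<alpha>)
        = (g ** p (src \<alpha>)) ** (p (src \<alpha>) ** x ** p (tgt \<alpha>)) ** (h ** p (tgt \<alpha>))"
proof -
  have inv: "g ** h = mat 1" "h ** g = mat 1" using gh by (auto simp: grp_def)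
  have pg: "p t ** (g ** p t) = g ** p t" and ph: "p t ** (h ** p t) = h ** p t" if "t \<in> Vt" for t
    using gh that by (auto simp: grp_def pres_p)
  show "inv_on (I t) (g ** p t) (h ** p t)" if t: "t \<in> Vt" for t
  proof -
    have "g ** p t ** (h ** p t) = g ** (p t ** (h ** p t))" by (simp add: matrix_mul_assoc)
    also have "\<dots> = p t" by (simp add: ph t) (simp add: matrix_mul_assoc inv)
    finally have 1: "g ** p t ** (h ** p t) = p t" .
    have "h ** p t ** (g ** p t) = h ** (p t ** (g ** p t))" by (simp add: matrix_mul_assoc)
    also have "\<dots> = p t" by (simp add: pg t) (simp add: matrix_mul_assoc inv)
    finally have 2: "h ** p t ** (g ** p t) = p t" .
    show ?thesis unfolding inv_on_def
      using 1 2 by (simp add: pg ph t) (simp add: prj_prj flip: matrix_mul_assoc)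
  qed
  show "p (src \<alpha>) = (g ** p (tgt \<alpha>)) ** p (src \<alpha>) ** (h ** p (src \<alpha>))" if a: "\<alpha> \<in> Ar"
  proof -
    have "(g ** p (tgt \<alpha>)) ** p (src \<alpha>) ** (h ** p (src \<alpha>)) = g ** (p (tgt \<alpha>) ** p (src \<alpha>)) ** (h ** p (src \<alpha>))"
      by (simp add: matrix_mul_assoc)
    also have "\<dots> = g ** (p (src \<alpha>) ** (h ** p (src \<alpha>)))"
      using a by (simp add: p_src matrix_mul_assoc)
    also have "\<dots> = p (src \<alpha>)"
      using a by (simp add: ph src_in) (simp add: matrix_mul_assoc inv)
    finally show ?thesis by simp
  qed
  show "p (src \<alpha>) ** x' ** p (tgt \<alpha>)
      = (g ** p (src \<alpha>)) ** (p (src \<alpha>) ** x ** p (tgt \<alpha>)) ** (h ** p (tgt \<alpha>))" if a: "\<alpha> \<in> Ar"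
  proof -
    let ?t = "tgt \<alpha>"
    \<comment> \<open>\<open>h\<close> keeps Y_t stable, so \<open>?z\<close> is
      \<open>x ** h\<close> on Y_t and splits into pieces in the source spaces. \<open>g\<close>
      keeps each of these, so the projection belonging to \<alpha> retains a single piece.\<close>
    let ?z = "x ** (p ?t ** (h ** p ?t))"
    have t: "?t \<in> Vt" using a by (rule tgt_in)
    have z: "?z = (\<Sum>\<beta>\<in>inc ?t. p (src \<beta>) ** ?z)"
      using nil_p_sum[OF x t] by (simp add: matrix_mul_assoc flip: matrix_mult_sum_left)
    have "p (src \<alpha>) ** x' ** p ?t = p (src \<alpha>) ** g ** ?z"
      unfolding ph[OF t] by (simp add: x' matrix_mul_assoc)
    also have "\<dots> = (\<Sum>\<beta>\<in>inc ?t. p (src \<alpha>) ** (g ** p (src \<beta>)) ** ?z)"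
      by (subst z) (simp add: matrix_mult_sum_right matrix_mul_assoc)
    also have "\<dots> = (\<Sum>\<beta>\<in>inc ?t. if \<beta> = \<alpha> then g ** p (src \<alpha>) ** ?z else 0)"
    proof (rule sum.cong[OF refl])
      fix \<beta> assume b: "\<beta> \<in> inc ?t"
      have pb: "p (src \<beta>) ** (g ** p (src \<beta>)) = g ** p (src \<beta>)" using pg incD[OF b] by blast
      have "p (src \<alpha>) ** (g ** p (src \<beta>)) = 0" if "\<beta> \<noteq> \<alpha>"
        using p_src_orth[of \<alpha> ?t \<beta>] a b that pb
        by (metis (mono_tags, lifting) CollectI inc_def matrix_mul_assoc times0_left)
      then show "p (src \<alpha>) ** (g ** p (src \<beta>)) ** ?z = (if \<beta> = \<alpha> then g ** p (src \<alpha>) ** ?z else 0)"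
        using pb by auto
    qed
    also have "\<dots> = g ** (p (src \<alpha>) ** p (src \<alpha>)) ** ?z"
      using a by (simp add: inc_def finite_Ar prj_prj)
    finally show ?thesis by (simp add: matrix_mul_assoc)
  qed
qed

text \<open>\<open>h\<close> keeps Y_t, \<open>x\<close> pushes it into the sum of the source
  spaces, and \<open>g\<close> keeps each source space.\<close>

lemma nil_conj:
  fixes x :: "'k::field ^ 'n ^ 'n"
  assumes x: "x \<in> nil" and gh: "grp g h"
  shows "g ** x ** h \<in> nil"
  unfolding nil_def
proof (intro CollectI ballI)
  fix t assume t: "t \<in> Vt"
  let ?z = "x ** (p t ** (h ** p t))"
  have hp: "p t ** (h ** p t) = h ** p t" using gh t by (simp add: grp_def pres_p)
  have z: "(\<Sum>\<beta>\<in>inc t. p (src \<beta>) ** ?z) = ?z"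
    using nil_p_sum[OF x t] by (simp add: matrix_mul_assoc flip: matrix_mult_sum_left)
  have q: "prj (I t - B t) ** (g ** p (src \<beta>)) = g ** p (src \<beta>)" if b: "\<beta> \<in> inc t" for \<beta>
  proof -
    have "prj (I t - B t) ** p (src \<beta>) = (p (src \<beta>) :: 'k ^ 'n ^ 'n)"
      using I_src_sub[of \<beta>] incD[OF b] by (auto simp: prj_prj intro!: arg_cong[of _ _ prj])
    moreover have "p (src \<beta>) ** (g ** p (src \<beta>)) = g ** p (src \<beta>)"
      using gh incD[OF b] by (simp add: grp_def pres_p)
    ultimately show ?thesis by (metis matrix_mul_assoc)
  qed
  have gz: "g ** ?z = (\<Sum>\<beta>\<in>inc t. g ** p (src \<beta>) ** ?z)"
    by (subst z[symmetric]) (simp add: matrix_mult_sum_right matrix_mul_assoc)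
  have "prj (I t - B t) ** (g ** ?z) = g ** ?z"
    unfolding gz matrix_mult_sum_right
    by (rule sum.cong[OF refl]) (use q in \<open>simp add: matrix_mul_assoc\<close>)
  then have "prj (I t - B t) ** (g ** x ** h ** p t) = g ** x ** h ** p t"
    unfolding hp by (simp add: matrix_mul_assoc)
  then have "prj (I t - B t) ** (g ** x ** h ** (p t ** b t)) = g ** x ** h ** (p t ** b t)"
    by (simp add: matrix_mul_assoc)
  then show "prj (I t - B t) ** (g ** x ** h) ** b t = g ** x ** h ** b t"
    using t by (simp add: p_b matrix_mul_assoc)
qed

section \<open>Frames depending polynomially on the representation\<close>

text \<open>The recursion \<open>G t = (\<Sum>\<alpha>. N \<alpha> ** G (src \<alpha>)) + C t\<close> along the quiver, unrolled \<open>k\<close> times. It is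
  stable from \<open>k = CARD('n)\<close> on because \<open>card (I t)\<close> strictly increases along arrows.\<close>

primrec gf :: "(nat \<Rightarrow> 'k::field ^ 'n ^ 'n) \<Rightarrow> (nat \<Rightarrow> 'k ^ 'n ^ 'n) \<Rightarrow> nat \<Rightarrow> nat \<Rightarrow> 'k ^ 'n ^ 'n" where
  "gf C N 0 t = 0"
| "gf C N (Suc k) t = (\<Sum>\<alpha>\<in>inc t. N \<alpha> ** gf C N k (src \<alpha>)) + C t"

definition gn where "gn C N t = gf C N CARD('n) t"

lemma gf_stable: "t \<in> Vt \<Longrightarrow> card (I t) \<le> k \<Longrightarrow> gf C N (Suc k) t = gf C N k t"
proof (induction k arbitrary: t)
  case 0
  then show ?case using B_nonempty[of t] B_sub[of t] by auto
next
  case (Suc k)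
  have "gf C N (Suc k) (src \<alpha>) = gf C N k (src \<alpha>)" if "\<alpha> \<in> inc t" for \<alpha>
    using Suc.IH[of "src \<alpha>"] Suc.prems card_I_less[of \<alpha>] incD[OF that] by auto
  then show ?case by simp
qed

lemma gn_rec: "t \<in> Vt \<Longrightarrow> gn C N t = (\<Sum>\<alpha>\<in>inc t. N \<alpha> ** gn C N (src \<alpha>)) + C t"
  using gf_stable[of t "CARD('n)" C N] by (simp add: gn_def card_mono)

text \<open>\<open>C t\<close> is supported on the columns of the block, so it vanishes on the
  source spaces and the recursion itself forces the intertwining identity. Only invertibility
  remains, and the determinants express it.\<close>

lemma gn_frame:
  assumes sh: "shaped N N'"
    and C: "\<And>t. t \<in> Vt \<Longrightarrow> p t ** C t = C t" "\<And>t. t \<in> Vt \<Longrightarrow> C t ** b t = C t"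
    and det: "\<And>t. t \<in> Vt \<Longrightarrow> det (gn C N t + prj (- I t)) \<noteq> 0"
  shows "frame N (gn C N) (\<lambda>t. p t ** matrix_inv (gn C N t + prj (- I t)) ** p t)"
proof -
  have 1: "p t ** gn C N t = gn C N t" if "t \<in> Vt" for t
  proof -
    have "p t ** (N \<alpha> ** gn C N (src \<alpha>)) = N \<alpha> ** gn C N (src \<alpha>)" if "\<alpha> \<in> inc t" for \<alpha>
      using sh that by (auto simp: shaped_def inc_def matrix_mul_assoc)
    then show ?thesis
      using C(1)[OF that] by (simp add: gn_rec[OF that] matrix_add_ldistrib matrix_mult_sum_right)
  qed
  have 2: "gn C N t ** p t = gn C N t" if "t \<in> Vt" for t
    using that
  proof (induction t rule: vertex_induct)
    case (step t)
    have "N \<alpha> ** gn C N (src \<alpha>) ** p t = N \<alpha> ** gn C N (src \<alpha>)" if "\<alpha> \<in> inc t" for \<alpha>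
      using step.IH[OF that] p_src(2)[of \<alpha>] incD[OF that] by (metis matrix_mul_assoc)
    moreover have "C t ** p t = C t"
      using C(2)[OF step.hyps] p_b(2)[OF step.hyps] by (metis matrix_mul_assoc)
    ultimately show ?case
      by (simp add: gn_rec[OF step.hyps] matrix_add_rdistrib' matrix_mult_sum_left)
  qed
  have 3: "gn C N (tgt \<alpha>) ** p (src \<alpha>) = N \<alpha> ** gn C N (src \<alpha>)" if a: "\<alpha> \<in> Ar" for \<alpha>
  proof -
    have "C (tgt \<alpha>) ** p (src \<alpha>) = 0"
      using C(2)[OF tgt_in[OF a]] b_src[OF a] by (metis matrix_mul_assoc times0_right)
    then have "gn C N (tgt \<alpha>) ** p (src \<alpha>) = (\<Sum>\<beta>\<in>inc (tgt \<alpha>). N \<beta> ** (gn C N (src \<beta>) ** p (src \<alpha>)))"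
      by (simp add: gn_rec[OF tgt_in[OF a]] matrix_add_rdistrib' matrix_mult_sum_left matrix_mul_assoc)
    also have "\<dots> = (\<Sum>\<beta>\<in>inc (tgt \<alpha>). if \<beta> = \<alpha> then N \<alpha> ** gn C N (src \<alpha>) else 0)"
    proof (rule sum.cong[OF refl])
      fix \<beta> assume b: "\<beta> \<in> inc (tgt \<alpha>)"
      have gb: "gn C N (src \<beta>) ** p (src \<beta>) = gn C N (src \<beta>)" using 2 incD[OF b] by blast
      have "gn C N (src \<beta>) ** p (src \<alpha>) = 0" if "\<beta> \<noteq> \<alpha>"
        using p_src_orth[of \<beta> "tgt \<alpha>" \<alpha>] a b that gb
        by (metis (mono_tags, lifting) CollectI inc_def matrix_mul_assoc times0_right)
      then show "N \<beta> ** (gn C N (src \<beta>) ** p (src \<alpha>)) = (if \<beta> = \<alpha> then N \<alpha> ** gn C N (src \<alpha>) else 0)"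
        using gb by auto
    qed
    finally show ?thesis using a by (simp add: inc_def finite_Ar)
  qed
  show ?thesis
    unfolding frame_def using inv_on_of_det[OF 1 2 det] 3 by blast
qed

text \<open>A frame obeys the recursion driven by its own block columns. At a base point the
  recursion thus returns the given frame, which is why the determinants do not vanish there.\<close>

lemma gn_eq_frame:
  assumes fr: "frame N G K" and "t \<in> Vt"
  shows "gn (\<lambda>t. G t ** b t) N t = G t"
  using assms(2)
proof (induction t rule: vertex_induct)
  case (step t)
  have "N \<alpha> ** gn (\<lambda>t. G t ** b t) N (src \<alpha>) = G t ** p (src \<alpha>)" if "\<alpha> \<in> inc t" for \<alpha>
    using step.IH[OF that] fr incD[OF that] by (auto simp: frame_def)
  then have "gn (\<lambda>t. G t ** b t) N t = G t ** p t"
    by (simp add: gn_rec[OF step.hyps] p_decomp[OF step.hyps] matrix_add_ldistrib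
        matrix_mult_sum_right add.commute)
  then show ?case using inv_onD(2)[OF frame_inv[OF fr step.hyps]] by simp
qed

end

section \<open>Representations in bases\<close>

lemma qsrc_True [simp]: "qsrc Y (\<alpha>, True) = qtgt Y (\<alpha>, False)"
  by (simp add: qtgt_def)

lemma qtgt_True [simp]: "qtgt Y (\<alpha>, True) = qsrc Y (\<alpha>, False)"
  by (simp add: qtgt_def)

lemma mat_on_mmul: "mat_on p u A \<Longrightarrow> mat_on u q C \<Longrightarrow> mat_on p q (mmul u A C)"
  by (auto simp: mat_on_def mmul_def)

lemma mat_on_sum: "(\<And>s. s \<in> S \<Longrightarrow> mat_on p q (A s)) \<Longrightarrow> mat_on p q (\<lambda>i j. \<Sum>s\<in>S. A s i j)"
  by (auto simp: mat_on_def)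

lemma mat_on_idm: "mat_on p p (idm p)"
  by (auto simp: mat_on_def idm_def)

lemma vec_on_mapp: "mat_on p q A \<Longrightarrow> vec_on p (mapp q A v)"
  by (auto simp: mat_on_def vec_on_def mapp_def)

text \<open>Links matrices over natural indices below \<open>d t\<close> with square matrices over
  \<open>'n\<close>: \<open>loc t\<close> numbers the coordinates of Y_t from 0. \<open>emb\<close>
  and \<open>uem\<close> transport along it and are mutually inverse on matrices of the right size
  and support.\<close>

locale rep_frame = block_quiver Vs "arrs Y l" "\<lambda>\<alpha>. qsrc Y (\<alpha>, False)" "\<lambda>\<alpha>. qtgt Y (\<alpha>, False)" I B
  for Vs :: "nat set" and Y :: "nat \<Rightarrow> 'v set" and l :: nat and I B :: "nat \<Rightarrow> 'n::finite set" +
  fixes d :: "nat \<Rightarrow> nat" and loc :: "nat \<Rightarrow> 'n \<Rightarrow> nat"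
  assumes Vs_eq: "Vs = {1..l}"
    and loc: "t \<in> Vs \<Longrightarrow> bij_betw (loc t) (I t) {..<d t}"
begin

abbreviation sr where "sr \<alpha> \<equiv> qsrc Y (\<alpha>, False)"
abbreviation tg where "tg \<alpha> \<equiv> qtgt Y (\<alpha>, False)"

definition unloc :: "nat \<Rightarrow> nat \<Rightarrow> 'n" where "unloc t = inv_into (I t) (loc t)"

definition emb :: "nat \<Rightarrow> nat \<Rightarrow> 'k::field mat \<Rightarrow> 'k ^ 'n ^ 'n" where
  "emb t s A = (\<chi> i j. if i \<in> I t \<and> j \<in> I s then A (loc t i) (loc s j) else 0)"

definition uem :: "nat \<Rightarrow> nat \<Rightarrow> 'k::field ^ 'n ^ 'n \<Rightarrow> 'k mat" where
  "uem t s X = (\<lambda>i j. if i < d t \<and> j < d s then X $ unloc t i $ unloc s j else 0)"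

definition vemb :: "nat \<Rightarrow> (nat \<Rightarrow> 'k::field) \<Rightarrow> 'k ^ 'n" where
  "vemb t v = (\<chi> i. if i \<in> I t then v (loc t i) else 0)"

definition uvec :: "nat \<Rightarrow> 'k::field ^ 'n \<Rightarrow> nat \<Rightarrow> 'k" where
  "uvec t v = (\<lambda>i. if i < d t then v $ unloc t i else 0)"

lemma loc_less: "t \<in> Vs \<Longrightarrow> i \<in> I t \<Longrightarrow> loc t i < d t"
  using loc[of t] by (auto simp: bij_betw_def)

lemma unloc_loc: "t \<in> Vs \<Longrightarrow> i \<in> I t \<Longrightarrow> unloc t (loc t i) = i"
  using loc[of t] by (auto simp: bij_betw_def unloc_def)

lemma loc_unloc: "t \<in> Vs \<Longrightarrow> i < d t \<Longrightarrow> loc t (unloc t i) = i"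
  using loc[of t] by (auto simp: bij_betw_def unloc_def f_inv_into_f)

lemma unloc_in: "t \<in> Vs \<Longrightarrow> i < d t \<Longrightarrow> unloc t i \<in> I t"
  using loc[of t] unfolding bij_betw_def unloc_def by (metis inv_into_into lessThan_iff)

lemma p_emb: "p t ** emb t s A = emb t s A" "emb t s A ** p s = emb t s A"
  by (auto simp: prj_absorb_left prj_absorb_right emb_def)

lemma emb_uem:
  assumes "t \<in> Vs" "s \<in> Vs" "p t ** X = X" "X ** p s = X"
  shows "emb t s (uem t s X) = X"
proof -
  have "X $ i $ j = 0" if "i \<notin> I t \<or> j \<notin> I s" for i j
    using assms(3,4) that by (metis mult_prj_nth prj_mult_nth)
  then show ?thesis
    using assms(1,2) by (auto simp: vec_eq_iff emb_def uem_def loc_less unloc_loc)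
qed

lemma uem_emb:
  assumes "t \<in> Vs" "s \<in> Vs" "mat_on (d t) (d s) A"
  shows "uem t s (emb t s A) = A"
  using assms by (auto simp: emb_def uem_def fun_eq_iff mat_on_def unloc_in loc_unloc not_less)

lemma emb_inj:
  assumes "t \<in> Vs" "s \<in> Vs" "mat_on (d t) (d s) A" "mat_on (d t) (d s) C"
  shows "emb t s A = emb t s C \<longleftrightarrow> A = C"
  using uem_emb assms by metis

lemma mat_on_uem: "mat_on (d t) (d s) (uem t s X)"
  by (auto simp: mat_on_def uem_def)

lemma emb_mmul: 
  assumes "u \<in> Vs"
  shows "emb t s (mmul (d u) A C) = emb t u A ** emb u s C"
proof -
  have "(\<Sum>k<d u. A (loc t i) k * C k (loc s j)) = (\<Sum>k\<in>UNIV. emb t u A $ i $ k * emb u s C $ k $ j)"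
    if "i \<in> I t" "j \<in> I s" for i j
  proof -
    have "(\<Sum>k<d u. A (loc t i) k * C k (loc s j)) = (\<Sum>k\<in>I u. A (loc t i) (loc u k) * C (loc u k) (loc s j))"
      by (rule sum.reindex_bij_betw[OF loc[OF assms], symmetric])
    also have "\<dots> = (\<Sum>k\<in>UNIV. emb t u A $ i $ k * emb u s C $ k $ j)"
      using that by (intro sum.mono_neutral_cong_left) (auto simp: emb_def)
    finally show ?thesis .
  qed
  then show ?thesis
    by (auto simp: vec_eq_iff matrix_matrix_mult_def mmul_def emb_def[of t s])
      (auto simp: emb_def)
qed

lemma emb_idm: "t \<in> Vs \<Longrightarrow> emb t t (idm (d t)) = p t"
  using unloc_loc[of t] by (auto simp: emb_def idm_def prj_def vec_eq_iff loc_less) metis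

lemma emb_sum: "emb t s (\<lambda>i j. \<Sum>g\<in>S. A g i j) = (\<Sum>g\<in>S. emb t s (A g))"
  by (auto simp: vec_eq_iff emb_def)

lemma emb_zero: "emb t s (\<lambda>i j. 0) = 0"
  by (simp add: vec_eq_iff emb_def)

lemma p_vemb: "p t *v vemb t v = vemb t v"
  by (simp add: vec_eq_iff prj_vec_nth vemb_def)

lemma vemb_uvec: "t \<in> Vs \<Longrightarrow> vemb t (uvec t v) = p t *v v"
  by (auto simp: vec_eq_iff vemb_def uvec_def prj_vec_nth loc_less unloc_loc)

lemma vec_on_uvec: "vec_on (d t) (uvec t v)"
  by (simp add: vec_on_def uvec_def)

lemma uvec_vemb: "t \<in> Vs \<Longrightarrow> vec_on (d t) v \<Longrightarrow> uvec t (vemb t v) = v"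
  by (auto simp: vemb_def uvec_def fun_eq_iff vec_on_def unloc_in loc_unloc not_less)

lemma vemb_zero_iff: "t \<in> Vs \<Longrightarrow> vec_on (d t) v \<Longrightarrow> vemb t v = 0 \<longleftrightarrow> v = (\<lambda>i. 0)"
proof
  assume "t \<in> Vs" "vec_on (d t) v" "vemb t v = 0"
  then have "v = uvec t 0" using uvec_vemb by metis
  then show "v = (\<lambda>i. 0)" by (simp add: uvec_def fun_eq_iff)
qed (simp add: vemb_def vec_eq_iff)

lemma vemb_sum: "vemb t (\<lambda>i. \<Sum>g\<in>S. w g i) = (\<Sum>g\<in>S. vemb t (w g))"
  by (simp add: vec_eq_iff vemb_def)

lemma emb_vemb:
  assumes "s \<in> Vs"
  shows "emb t s A *v vemb s v = vemb t (mapp (d s) A v)"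
proof -
  have "(\<Sum>k<d s. A (loc t i) k * v k) = (\<Sum>k\<in>UNIV. emb t s A $ i $ k * vemb s v $ k)"
    if "i \<in> I t" for i
  proof -
    have "(\<Sum>k<d s. A (loc t i) k * v k) = (\<Sum>k\<in>I s. A (loc t i) (loc s k) * v (loc s k))"
      by (rule sum.reindex_bij_betw[OF loc[OF assms], symmetric])
    also have "\<dots> = (\<Sum>k\<in>UNIV. emb t s A $ i $ k * vemb s v $ k)"
      using that by (intro sum.mono_neutral_cong_left) (auto simp: emb_def vemb_def)
    finally show ?thesis .
  qed
  then show ?thesis
    by (auto simp: vec_eq_iff matrix_vector_mult_def mapp_def vemb_def[of t]) (auto simp: emb_def)
qed

section \<open>Relations and the filtration condition through the embedding\<close>

definition repshape :: "(nat \<times> bool \<Rightarrow> 'k::field mat) \<Rightarrow> bool" where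
  "repshape M \<longleftrightarrow> (\<forall>\<alpha>. if fst \<alpha> \<in> arrs Y l then mat_on (d (qtgt Y \<alpha>)) (d (qsrc Y \<alpha>)) (M \<alpha>)
           else M \<alpha> = (\<lambda>i j. 0))"

definition fwd :: "(nat \<times> bool \<Rightarrow> 'k::field mat) \<Rightarrow> nat \<Rightarrow> 'k ^ 'n ^ 'n" where
  "fwd M \<alpha> = emb (tg \<alpha>) (sr \<alpha>) (M (\<alpha>, False))"

definition bwd :: "(nat \<times> bool \<Rightarrow> 'k::field mat) \<Rightarrow> nat \<Rightarrow> 'k ^ 'n ^ 'n" where
  "bwd M \<alpha> = emb (sr \<alpha>) (tg \<alpha>) (M (\<alpha>, True))"

lemma shaped_fwd_bwd: "shaped (fwd M) (bwd M)"
  by (simp add: shaped_def fwd_def bwd_def p_emb)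

lemma repshapeD:
  assumes "repshape M" "\<alpha> \<in> arrs Y l"
  shows "mat_on (d (tg \<alpha>)) (d (sr \<alpha>)) (M (\<alpha>, False))" "mat_on (d (sr \<alpha>)) (d (tg \<alpha>)) (M (\<alpha>, True))"
  using assms unfolding repshape_def by (metis fst_conv, metis fst_conv qsrc_True qtgt_True)

lemma rep_eqI:
  assumes "repshape M" "repshape M'"
    and "\<And>\<alpha>. \<alpha> \<in> arrs Y l \<Longrightarrow> fwd M \<alpha> = fwd M' \<alpha>" "\<And>\<alpha>. \<alpha> \<in> arrs Y l \<Longrightarrow> bwd M \<alpha> = bwd M' \<alpha>"
  shows "M = M'"
proof
  fix \<beta> :: "nat \<times> bool"
  obtain \<alpha> c where b: "\<beta> = (\<alpha>, c)" by (cases \<beta>)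
  show "M \<beta> = M' \<beta>"
  proof (cases "\<alpha> \<in> arrs Y l")
    case True
    then show ?thesis
      using assms(3,4)[OF True] repshapeD[OF assms(1) True] repshapeD[OF assms(2) True]
      by (cases c) (simp_all add: b fwd_def bwd_def emb_inj src_in tgt_in)
  next
    case False
    then show ?thesis using assms(1,2) b unfolding repshape_def by (metis fst_conv)
  qed
qed

lemma relns_iff:
  assumes M: "repshape M"
  shows "is_rep Y l d M \<longleftrightarrow> relns (fwd M) (bwd M)"
proof -
  have A: "(mmul (d (tg s)) (M (s, True)) (M (s, False))
        = (\<lambda>i j. \<Sum>g\<in>{g\<in>arrs Y l. tg g = sr s}. mmul (d (sr g)) (M (g, False)) (M (g, True)) i j))
     \<longleftrightarrow> bwd M s ** fwd M s = (\<Sum>\<gamma>\<in>inc (sr s). fwd M \<gamma> ** bwd M \<gamma>)" (is "?L = ?R \<longleftrightarrow> _")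
    if s: "s \<in> arrs Y l" for s
  proof -
    have 1: "mat_on (d (sr s)) (d (sr s)) ?L"
      by (rule mat_on_mmul[OF repshapeD(2)[OF M s] repshapeD(1)[OF M s]])
    have 2: "mat_on (d (sr s)) (d (sr s)) ?R"
    proof (rule mat_on_sum)
      fix g assume "g \<in> {g\<in>arrs Y l. tg g = sr s}"
      then show "mat_on (d (sr s)) (d (sr s)) (mmul (d (sr g)) (M (g, False)) (M (g, True)))"
        using mat_on_mmul[OF repshapeD(1)[OF M, of g] repshapeD(2)[OF M, of g]] by auto
    qed
    have "emb (sr s) (sr s) ?R = (\<Sum>\<gamma>\<in>inc (sr s). fwd M \<gamma> ** bwd M \<gamma>)"
      unfolding emb_sum inc_def
      by (rule sum.cong) (auto simp: emb_mmul src_in fwd_def bwd_def)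
    moreover have "emb (sr s) (sr s) ?L = bwd M s ** fwd M s"
      using s by (simp add: emb_mmul tgt_in fwd_def bwd_def)
    ultimately show ?thesis
      using emb_inj[OF src_in[OF s] src_in[OF s] 1 2] by simp
  qed
  have B: "mmul (d (tg s)) (M (s', True)) (M (s, False)) = (\<lambda>i j. 0) \<longleftrightarrow> bwd M s' ** fwd M s = 0"
    if s: "s \<in> arrs Y l" "s' \<in> arrs Y l" "tg s = tg s'" for s s'
  proof -
    have "mat_on (d (sr s')) (d (sr s)) (mmul (d (tg s)) (M (s', True)) (M (s, False)))"
      by (rule mat_on_mmul) (use repshapeD(2)[OF M s(2)] repshapeD(1)[OF M s(1)] s(3) in simp_all)
    moreover have "mat_on (d (sr s')) (d (sr s)) (\<lambda>i j. 0)" by (simp add: mat_on_def)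
    moreover have "emb (sr s') (sr s) (mmul (d (tg s)) (M (s', True)) (M (s, False))) = bwd M s' ** fwd M s"
      using s by (simp add: emb_mmul tgt_in fwd_def bwd_def flip: s(3))
    ultimately show ?thesis
      using emb_inj[OF src_in[OF s(2)] src_in[OF s(1)]] by (metis emb_zero)
  qed
  show ?thesis
    unfolding is_rep_def repshape_def[symmetric] relns_def using M A B by auto
qed

text \<open>A kernel vector of the total map has one component whose image equals a sum of images of
  the others, hence lies in the intersection and vanishes. Conversely a point of an intersection
  yields the kernel vector \<open>W\<close>.\<close>

lemma delta_iff:
  assumes M: "repshape M"
  shows "(\<forall>s\<in>arrs Y l.
        (\<forall>v. vec_on (d (sr s)) v \<and> mapp (d (sr s)) (M (s, False)) v = (\<lambda>i. 0) \<longrightarrow> v = (\<lambda>i. 0))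
      \<and> img (d (sr s)) (M (s, False)) \<inter>
          {(\<lambda>i. \<Sum>\<beta>\<in>{\<beta>\<in>arrs Y l - {s}. tg \<beta> = tg s}. w \<beta> i) | w.
             \<forall>\<beta>\<in>{\<beta>\<in>arrs Y l - {s}. tg \<beta> = tg s}. w \<beta> \<in> img (d (sr \<beta>)) (M (\<beta>, False))}
        \<subseteq> {\<lambda>i. 0}) \<longleftrightarrow> delta (fwd M)" (is "(\<forall>s\<in>_. ?inj s \<and> ?ind s) \<longleftrightarrow> _")
proof
  assume L: "\<forall>s\<in>arrs Y l. ?inj s \<and> ?ind s"
  show "delta (fwd M)" unfolding delta_def
  proof (intro ballI allI impI)
    fix t v assume t: "t \<in> Vs" and v: "prj (I t - B t) *v v = v"
      and 0: "(\<Sum>\<alpha>\<in>inc t. fwd M \<alpha>) *v v = 0"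
    have fm: "fwd M \<alpha> *v v = vemb t (mapp (d (sr \<alpha>)) (M (\<alpha>, False)) (uvec (sr \<alpha>) v))"
      if a: "\<alpha> \<in> inc t" for \<alpha>
    proof -
      have "fwd M \<alpha> *v v = fwd M \<alpha> *v vemb (sr \<alpha>) (uvec (sr \<alpha>) v)"
        using incD[OF a] by (simp add: vemb_uvec matrix_vector_mul_assoc fwd_def p_emb)
      then show ?thesis using incD[OF a] by (auto simp: fwd_def emb_vemb)
    qed
    have "p (sr \<alpha>) *v v = 0" if a: "\<alpha> \<in> inc t" for \<alpha>
    proof -
      let ?S = "{\<beta>\<in>arrs Y l - {\<alpha>}. tg \<beta> = tg \<alpha>}"
      have aA: "\<alpha> \<in> arrs Y l" "tg \<alpha> = t" using incD[OF a] by auto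
      have S: "inc t = insert \<alpha> ?S" "\<alpha> \<notin> ?S" "finite ?S"
        using a by (auto simp: inc_def finite_Ar)
      define m where "m \<beta> = mapp (d (sr \<beta>)) (M (\<beta>, False)) (uvec (sr \<beta>) v)" for \<beta>
      \<comment> \<open>The sign is put into the argument, so that \<open>w \<beta>\<close> is
        visibly in the image of the map at \<beta>.\<close>
      define w where "w \<beta> = mapp (d (sr \<beta>)) (M (\<beta>, False)) (uvec (sr \<beta>) (- v))" for \<beta>
      have wm: "w \<beta> i = - m \<beta> i" for \<beta> i
        by (simp add: w_def m_def mapp_def uvec_def sum_negf[symmetric])
      have mon: "vec_on (d t) (m \<beta>)" if "\<beta> \<in> inc t" for \<beta>
        unfolding m_def using repshapeD(1)[OF M, of \<beta>] incD[OF that] by (auto intro: vec_on_mapp)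
      have "vemb t (\<lambda>i. \<Sum>\<beta>\<in>inc t. m \<beta> i) = 0"
        using 0 by (simp add: vemb_sum matrix_sum_mult_vec fm m_def cong: sum.cong)
      moreover have "vec_on (d t) (\<lambda>i. \<Sum>\<beta>\<in>inc t. m \<beta> i)"
        using mon by (simp add: vec_on_def)
      ultimately have "(\<lambda>i. \<Sum>\<beta>\<in>inc t. m \<beta> i) = (\<lambda>i. 0)"
        using vemb_zero_iff[OF t] by blast
      then have "m \<alpha> i + (\<Sum>\<beta>\<in>?S. m \<beta> i) = 0" for i
        unfolding S(1) using S(2,3) by (simp add: fun_eq_iff)
      then have "m \<alpha> = (\<lambda>i. \<Sum>\<beta>\<in>?S. w \<beta> i)"
        by (simp add: wm sum_negf fun_eq_iff eq_neg_iff_add_eq_0)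
      moreover have "w \<beta> \<in> img (d (sr \<beta>)) (M (\<beta>, False))" for \<beta>
        unfolding w_def img_def using vec_on_uvec by blast
      moreover have "m \<alpha> \<in> img (d (sr \<alpha>)) (M (\<alpha>, False))"
        unfolding m_def img_def using vec_on_uvec by blast
      ultimately have "m \<alpha> \<in> img (d (sr \<alpha>)) (M (\<alpha>, False)) \<inter>
          {(\<lambda>i. \<Sum>\<beta>\<in>?S. w \<beta> i) | w. \<forall>\<beta>\<in>?S. w \<beta> \<in> img (d (sr \<beta>)) (M (\<beta>, False))}" by blast
      then have "m \<alpha> = (\<lambda>i. 0)" using L aA(1) by blast
      then have "uvec (sr \<alpha>) v = (\<lambda>i. 0)" using L aA(1) vec_on_uvec unfolding m_def by blast
      then have "vemb (sr \<alpha>) (uvec (sr \<alpha>) v) = 0" by (simp add: vemb_def vec_eq_iff)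
      then show ?thesis using vemb_uvec[OF src_in[OF aA(1)], of v] by metis
    qed
    then have "prj (I t - B t) *v v = 0"
      using t by (simp add: prj_I_diff matrix_sum_mult_vec)
    then show "v = 0" using v by simp
  qed
next
  assume de: "delta (fwd M)"
  have orth: "fwd M \<beta> *v vemb (sr \<alpha>) v = 0" if "\<alpha> \<in> inc t" "\<beta> \<in> inc t" "\<alpha> \<noteq> \<beta>" for \<alpha> \<beta> t v
  proof -
    have "fwd M \<beta> *v vemb (sr \<alpha>) v = (fwd M \<beta> ** p (sr \<beta>)) *v (p (sr \<alpha>) *v vemb (sr \<alpha>) v)"
      by (simp add: fwd_def p_emb p_vemb)
    also have "\<dots> = (fwd M \<beta> ** (p (sr \<beta>) ** p (sr \<alpha>))) *v vemb (sr \<alpha>) v"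
      by (simp add: matrix_vector_mul_assoc matrix_mul_assoc)
    finally show ?thesis by (simp add: p_src_orth[OF that(2,1) that(3)[symmetric]])
  qed
  have fwdsum: "(\<Sum>\<beta>\<in>inc t. fwd M \<beta>) *v vemb (sr \<alpha>) v = fwd M \<alpha> *v vemb (sr \<alpha>) v" if a: "\<alpha> \<in> inc t" for \<alpha> t v
  proof -
    have "(\<Sum>\<beta>\<in>inc t. fwd M \<beta>) *v vemb (sr \<alpha>) v
        = (\<Sum>\<beta>\<in>inc t. if \<beta> = \<alpha> then fwd M \<alpha> *v vemb (sr \<alpha>) v else 0)"
      unfolding matrix_sum_mult_vec by (rule sum.cong) (use orth[OF a] in auto)
    then show ?thesis using a by simp
  qed
  have supp: "prj (I t - B t) *v vemb (sr \<alpha>) v = vemb (sr \<alpha>) v" if a: "\<alpha> \<in> inc t" for \<alpha> t v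
  proof -
    have "I (sr \<alpha>) \<subseteq> I t - B t" using I_src_sub[of \<alpha>] incD[OF a] by auto
    then show ?thesis by (auto simp: vec_eq_iff prj_vec_nth vemb_def)
  qed
  have inj: "v = (\<lambda>i. 0)" if s: "s \<in> arrs Y l" and v: "vec_on (d (sr s)) v"
      "mapp (d (sr s)) (M (s, False)) v = (\<lambda>i. 0)" for s v
  proof -
    have si: "s \<in> inc (tg s)" using s by (simp add: inc_def)
    have "(\<Sum>\<beta>\<in>inc (tg s). fwd M \<beta>) *v vemb (sr s) v = 0"
      unfolding fwdsum[OF si] using s v(2) by (simp add: fwd_def emb_vemb src_in) (simp add: vemb_def vec_eq_iff)
    then have "vemb (sr s) v = 0"
      using de supp[OF si] tgt_in[OF s] unfolding delta_def by blast
    then show ?thesis using vemb_zero_iff[OF src_in[OF s] v(1)] by simp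
  qed
  show "\<forall>s\<in>arrs Y l. ?inj s \<and> ?ind s"
  proof (intro ballI conjI subsetI)
    fix s assume s: "s \<in> arrs Y l"
    show "?inj s" using inj[OF s] by blast
    let ?S = "{\<beta>\<in>arrs Y l - {s}. tg \<beta> = tg s}"
    have si: "s \<in> inc (tg s)" using s by (simp add: inc_def)
    have Si: "\<beta> \<in> inc (tg s)" "\<beta> \<noteq> s" if "\<beta> \<in> ?S" for \<beta> using that by (auto simp: inc_def)
    have finS: "finite ?S" using finite_Ar by simp
    fix y assume "y \<in> img (d (sr s)) (M (s, False)) \<inter>
        {(\<lambda>i. \<Sum>\<beta>\<in>?S. w \<beta> i) | w. \<forall>\<beta>\<in>?S. w \<beta> \<in> img (d (sr \<beta>)) (M (\<beta>, False))}"
    then obtain v w where v: "vec_on (d (sr s)) v" "y = mapp (d (sr s)) (M (s, False)) v"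
      and w: "y = (\<lambda>i. \<Sum>\<beta>\<in>?S. w \<beta> i)" "\<forall>\<beta>\<in>?S. w \<beta> \<in> img (d (sr \<beta>)) (M (\<beta>, False))"
      unfolding img_def by blast
    have "\<forall>\<beta>\<in>?S. \<exists>u. w \<beta> = mapp (d (sr \<beta>)) (M (\<beta>, False)) u"
      using w(2) unfolding img_def by blast
    from bchoice[OF this] obtain u
      where u: "\<And>\<beta>. \<beta> \<in> ?S \<Longrightarrow> w \<beta> = mapp (d (sr \<beta>)) (M (\<beta>, False)) (u \<beta>)"
      by blast
    \<comment> \<open>Both expressions for \<open>y\<close> have the same image, so their difference
      is killed by the total map; its component at \<open>s\<close> is the preimage
      \<open>v\<close>.\<close>
    define W where "W = vemb (sr s) v - (\<Sum>\<beta>\<in>?S. vemb (sr \<beta>) (u \<beta>))"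
    have lin: "A *v W = A *v vemb (sr s) v - (\<Sum>\<beta>\<in>?S. A *v vemb (sr \<beta>) (u \<beta>))" for A
      unfolding W_def matrix_vector_mult_diff_distrib
      by (simp add: matrix_mult_vec_sum)
    have "prj (I (tg s) - B (tg s)) *v W = W"
    proof -
      have "(\<Sum>\<beta>\<in>?S. prj (I (tg s) - B (tg s)) *v vemb (sr \<beta>) (u \<beta>)) = (\<Sum>\<beta>\<in>?S. vemb (sr \<beta>) (u \<beta>))"
        by (rule sum.cong[OF refl]) (rule supp[OF Si(1)])
      then show ?thesis unfolding lin by (simp only: supp[OF si]) (simp only: W_def)
    qed
    moreover have "(\<Sum>\<beta>\<in>inc (tg s). fwd M \<beta>) *v W = 0"
    proof -
      have fw: "fwd M \<beta> *v vemb (sr \<beta>) (u \<beta>) = vemb (tg s) (w \<beta>)" if "\<beta> \<in> ?S" for \<beta>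
        using that by (auto simp: fwd_def emb_vemb src_in u)
      have "(\<Sum>\<beta>\<in>?S. (\<Sum>\<beta>\<in>inc (tg s). fwd M \<beta>) *v vemb (sr \<beta>) (u \<beta>)) = (\<Sum>\<beta>\<in>?S. vemb (tg s) (w \<beta>))"
        by (rule sum.cong[OF refl]) (simp only: fwdsum[OF Si(1)] fw)
      moreover have "fwd M s *v vemb (sr s) v = vemb (tg s) y"
        using s by (simp add: fwd_def emb_vemb src_in v(2))
      ultimately show ?thesis
        unfolding lin by (simp only: fwdsum[OF si] w(1) vemb_sum diff_self)
    qed
    ultimately have "W = 0" using de tgt_in[OF s] unfolding delta_def by blast
    then have "p (sr s) *v vemb (sr s) v - (\<Sum>\<beta>\<in>?S. p (sr s) *v vemb (sr \<beta>) (u \<beta>)) = 0"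
      using lin[of "p (sr s)"] by simp
    moreover have "p (sr s) *v vemb (sr \<beta>) (u \<beta>) = 0" if "\<beta> \<in> ?S" for \<beta>
    proof -
      have "p (sr s) *v vemb (sr \<beta>) (u \<beta>) = (p (sr s) ** p (sr \<beta>)) *v vemb (sr \<beta>) (u \<beta>)"
        by (simp add: p_vemb flip: matrix_vector_mul_assoc)
      then show ?thesis by (simp add: p_src_orth[OF si Si(1)[OF that] Si(2)[OF that, symmetric]])
    qed
    ultimately have "vemb (sr s) v = 0" by (simp only: p_vemb sum.neutral_const diff_zero cong: sum.cong)
    then have "v = (\<lambda>i. 0)" using vemb_zero_iff[OF src_in[OF s] v(1)] by simp
    then show "y \<in> {\<lambda>i. 0}" by (simp add: v(2) mapp_def)
  qed
qed

lemma RepD_iff: "M \<in> RepD Y l d \<longleftrightarrow> repshape M \<and> relns (fwd M) (bwd M) \<and> delta (fwd M)"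
proof (cases "repshape M")
  case True
  then show ?thesis
    unfolding RepD_def mem_Collect_eq relns_iff[OF True] delta_iff[OF True] by simp
next
  case False
  then have "\<not> is_rep Y l d M" unfolding is_rep_def repshape_def by blast
  with False show ?thesis by (simp add: RepD_def)
qed

definition iso :: "(nat \<times> bool \<Rightarrow> 'k::field mat) \<Rightarrow> (nat \<times> bool \<Rightarrow> 'k mat) \<Rightarrow> bool" where
  "iso M M' \<longleftrightarrow> (\<exists>G K. (\<forall>t\<in>Vs. inv_on (I t) (G t) (K t)) \<and>
     (\<forall>\<alpha>\<in>arrs Y l. fwd M' \<alpha> = G (tg \<alpha>) ** fwd M \<alpha> ** K (sr \<alpha>)
        \<and> bwd M' \<alpha> = G (sr \<alpha>) ** bwd M \<alpha> ** K (tg \<alpha>)))"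

section \<open>Orbits as isomorphism classes\<close>

lemma isGL_inv_on:
  assumes "isGL l d g h" "t \<in> Vs"
  shows "inv_on (I t) (emb t t (g t)) (emb t t (h t))"
proof -
  have "mmul (d t) (g t) (h t) = idm (d t)" "mmul (d t) (h t) (g t) = idm (d t)"
    using assms by (auto simp: isGL_def Vs_eq)
  then have "emb t t (g t) ** emb t t (h t) = p t" "emb t t (h t) ** emb t t (g t) = p t"
    using assms(2) by (simp_all add: emb_idm flip: emb_mmul)
  then show ?thesis by (simp add: inv_on_def p_emb)
qed

lemma inv_on_isGL:
  assumes "\<And>t. t \<in> Vs \<Longrightarrow> inv_on (I t) (G t) (K t)"
  shows "isGL l d (\<lambda>t. uem t t (G t)) (\<lambda>t. uem t t (K t))"
  unfolding isGL_def Vs_eq[symmetric]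
proof (intro ballI conjI mat_on_uem)
  fix t assume t: "t \<in> Vs"
  note i = inv_onD[OF assms[OF t]]
  have "emb t t (mmul (d t) (uem t t (G t)) (uem t t (K t))) = emb t t (idm (d t))"
    using t i by (simp add: emb_mmul emb_uem emb_idm)
  then show "mmul (d t) (uem t t (G t)) (uem t t (K t)) = idm (d t)"
    using emb_inj[OF t t mat_on_mmul[OF mat_on_uem mat_on_uem] mat_on_idm] by blast
  have "emb t t (mmul (d t) (uem t t (K t)) (uem t t (G t))) = emb t t (idm (d t))"
    using t i by (simp add: emb_mmul emb_uem emb_idm)
  then show "mmul (d t) (uem t t (K t)) (uem t t (G t)) = idm (d t)"
    using emb_inj[OF t t mat_on_mmul[OF mat_on_uem mat_on_uem] mat_on_idm] by blast
qed

lemma fwd_bwd_gl_act: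
  assumes "\<alpha> \<in> arrs Y l"
  shows "fwd (gl_act Y l d g h M) \<alpha> = emb (tg \<alpha>) (tg \<alpha>) (g (tg \<alpha>)) ** fwd M \<alpha> ** emb (sr \<alpha>) (sr \<alpha>) (h (sr \<alpha>))"
    and "bwd (gl_act Y l d g h M) \<alpha> = emb (sr \<alpha>) (sr \<alpha>) (g (sr \<alpha>)) ** bwd M \<alpha> ** emb (tg \<alpha>) (tg \<alpha>) (h (tg \<alpha>))"
  using assms by (simp_all add: fwd_def bwd_def gl_act_def emb_mmul src_in tgt_in)

lemma repshape_gl_act:
  assumes "repshape M" "isGL l d g h"
  shows "repshape (gl_act Y l d g h M)"
  unfolding repshape_def
proof (intro allI)
  fix \<beta> :: "nat \<times> bool"
  obtain \<alpha> c where b: "\<beta> = (\<alpha>, c)" by (cases \<beta>)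
  show "if fst \<beta> \<in> arrs Y l then mat_on (d (qtgt Y \<beta>)) (d (qsrc Y \<beta>)) (gl_act Y l d g h M \<beta>)
      else gl_act Y l d g h M \<beta> = (\<lambda>i j. 0)"
  proof (cases "\<alpha> \<in> arrs Y l")
    case True
    have "mat_on (d t) (d t) (g t) \<and> mat_on (d t) (d t) (h t)" if "t \<in> Vs" for t
      using assms(2) that by (simp add: isGL_def Vs_eq)
    then show ?thesis
      using True repshapeD[OF assms(1) True] src_in[OF True] tgt_in[OF True]
      by (cases c) (auto simp: b gl_act_def intro!: mat_on_mmul)
  next
    case False
    then have "M \<beta> = (\<lambda>i j. 0)" using assms(1) b unfolding repshape_def by (metis fst_conv)
    then show ?thesis using False b by (simp add: gl_act_def)
  qed
qed

text \<open>\<open>repshape\<close> fixes the entries beyond the matrix sizes and the values at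
  indices outside the quiver, so an isomorphism on the arrows already gives equality with the
  translate by a group element.\<close>

lemma gl_orbit_eq:
  assumes M: "repshape M"
  shows "gl_orbit Y l d M = {M'. repshape M' \<and> iso M M'}"
proof (intro set_eqI iffI CollectI conjI)
  fix M' assume "M' \<in> gl_orbit Y l d M"
  then obtain g h where gh: "isGL l d g h" "M' = gl_act Y l d g h M" by (auto simp: gl_orbit_def)
  show "repshape M'" using repshape_gl_act[OF M gh(1)] gh(2) by simp
  show "iso M M'" unfolding iso_def gh(2)
    by (intro exI[of _ "\<lambda>t. emb t t (g t)"] exI[of _ "\<lambda>t. emb t t (h t)"])
      (simp add: isGL_inv_on[OF gh(1)] fwd_bwd_gl_act)
next
  fix M' assume "M' \<in> {M'. repshape M' \<and> iso M M'}"
  then obtain G K where M': "repshape M'" and inv: "\<And>t. t \<in> Vs \<Longrightarrow> inv_on (I t) (G t) (K t)"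
    and eq: "\<And>\<alpha>. \<alpha> \<in> arrs Y l \<Longrightarrow> fwd M' \<alpha> = G (tg \<alpha>) ** fwd M \<alpha> ** K (sr \<alpha>)
        \<and> bwd M' \<alpha> = G (sr \<alpha>) ** bwd M \<alpha> ** K (tg \<alpha>)"
    unfolding iso_def by blast
  let ?g = "\<lambda>t. uem t t (G t)" and ?h = "\<lambda>t. uem t t (K t)"
  have GL: "isGL l d ?g ?h" using inv by (rule inv_on_isGL)
  have e: "emb t t (?g t) = G t" "emb t t (?h t) = K t" if "t \<in> Vs" for t
    using inv_onD[OF inv[OF that]] that by (simp_all add: emb_uem)
  have "M' = gl_act Y l d ?g ?h M"
    by (rule rep_eqI[OF M' repshape_gl_act[OF M GL]])
      (simp_all add: eq fwd_bwd_gl_act e src_in tgt_in)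
  then show "M' \<in> gl_orbit Y l d M" using GL by (auto simp: gl_orbit_def)
qed

lemma iso_refl:
  fixes M :: "nat \<times> bool \<Rightarrow> 'k::field mat"
  shows "iso M M"
proof -
  have "inv_on (I t) (p t) (p t :: 'k ^ 'n ^ 'n)" for t by (simp add: inv_on_def prj_prj)
  then show ?thesis unfolding iso_def
    by (intro exI[of _ "\<lambda>t. p t"]) (auto simp: fwd_def bwd_def p_emb)
qed

lemma inv_on_cancel:
  assumes "inv_on X G K" "inv_on Z G' K'" "prj X ** A = A" "A ** prj Z = A"
  shows "K ** (G ** A ** K') ** G' = A"
proof -
  have "K ** (G ** A ** K') ** G' = (K ** G) ** A ** (K' ** G')" by (simp add: matrix_mul_assoc)
  then show ?thesis using assms by (simp add: inv_onD)
qed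

lemma inv_on_mult:
  assumes "inv_on X G K" "inv_on X G' K'"
  shows "inv_on X (G' ** G) (K ** K')"
proof -
  have "G' ** G ** (K ** K') = G' ** (G ** K) ** K'" "K ** K' ** (G' ** G) = K ** (K' ** G') ** G"
    by (simp_all add: matrix_mul_assoc)
  moreover have "prj X ** (G' ** G) = G' ** G" "prj X ** (K ** K') = K ** K'"
    using assms by (simp_all add: matrix_mul_assoc inv_onD)
  moreover have "G' ** G ** prj X = G' ** G" "K ** K' ** prj X = K ** K'"
    using assms by (simp_all add: inv_onD flip: matrix_mul_assoc)
  ultimately show ?thesis
    unfolding inv_on_def using assms by (simp add: inv_onD)
qed

lemma iso_sym:
  assumes "iso M M'"
  shows "iso M' M"
proof -
  obtain G K where inv: "\<And>t. t \<in> Vs \<Longrightarrow> inv_on (I t) (G t) (K t)"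
    and eq: "\<And>\<alpha>. \<alpha> \<in> arrs Y l \<Longrightarrow> fwd M' \<alpha> = G (tg \<alpha>) ** fwd M \<alpha> ** K (sr \<alpha>)
        \<and> bwd M' \<alpha> = G (sr \<alpha>) ** bwd M \<alpha> ** K (tg \<alpha>)"
    using assms unfolding iso_def by blast
  have "fwd M \<alpha> = K (tg \<alpha>) ** fwd M' \<alpha> ** G (sr \<alpha>)" "bwd M \<alpha> = K (sr \<alpha>) ** bwd M' \<alpha> ** G (tg \<alpha>)"
    if "\<alpha> \<in> arrs Y l" for \<alpha>
    using eq[OF that] inv_on_cancel[OF inv[OF tgt_in[OF that]] inv[OF src_in[OF that]], of "fwd M \<alpha>"]
      inv_on_cancel[OF inv[OF src_in[OF that]] inv[OF tgt_in[OF that]], of "bwd M \<alpha>"]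
    by (simp_all add: fwd_def bwd_def p_emb)
  then show ?thesis unfolding iso_def using inv inv_on_sym by blast
qed

lemma iso_trans:
  assumes "iso M M'" "iso M' M''"
  shows "iso M M''"
proof -
  obtain G K where inv: "\<And>t. t \<in> Vs \<Longrightarrow> inv_on (I t) (G t) (K t)"
    and eq: "\<And>\<alpha>. \<alpha> \<in> arrs Y l \<Longrightarrow> fwd M' \<alpha> = G (tg \<alpha>) ** fwd M \<alpha> ** K (sr \<alpha>)
        \<and> bwd M' \<alpha> = G (sr \<alpha>) ** bwd M \<alpha> ** K (tg \<alpha>)"
    using assms(1) unfolding iso_def by blast
  obtain G' K' where inv': "\<And>t. t \<in> Vs \<Longrightarrow> inv_on (I t) (G' t) (K' t)"
    and eq': "\<And>\<alpha>. \<alpha> \<in> arrs Y l \<Longrightarrow> fwd M'' \<alpha> = G' (tg \<alpha>) ** fwd M' \<alpha> ** K' (sr \<alpha>)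
        \<and> bwd M'' \<alpha> = G' (sr \<alpha>) ** bwd M' \<alpha> ** K' (tg \<alpha>)"
    using assms(2) unfolding iso_def by blast
  show ?thesis unfolding iso_def
    by (intro exI[of _ "\<lambda>t. G' t ** G t"] exI[of _ "\<lambda>t. K t ** K' t"])
      (simp add: inv_on_mult inv inv' eq eq' matrix_mul_assoc)
qed

lemma gl_orbit_eq_iff:
  assumes "repshape M" "repshape M'"
  shows "gl_orbit Y l d M = gl_orbit Y l d M' \<longleftrightarrow> iso M M'"
  using assms by (auto simp: gl_orbit_eq intro: iso_refl iso_sym iso_trans)

text \<open>Adjacent factors cancel in products, so the relations carry over. For the filtration
  condition, composing with \<open>K t\<close> leads back to the original maps twisted by
  automorphisms of the sources.\<close>

lemma RepD_iso:
  assumes M: "M \<in> RepD Y l d" and M': "repshape M'" "iso M M'"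
  shows "M' \<in> RepD Y l d"
proof -
  have re: "relns (fwd M) (bwd M)" and de: "delta (fwd M)" using M by (auto simp: RepD_iff)
  obtain G K where inv: "\<And>t. t \<in> Vs \<Longrightarrow> inv_on (I t) (G t) (K t)"
    and eq: "\<And>\<alpha>. \<alpha> \<in> arrs Y l \<Longrightarrow> fwd M' \<alpha> = G (tg \<alpha>) ** fwd M \<alpha> ** K (sr \<alpha>)"
      "\<And>\<alpha>. \<alpha> \<in> arrs Y l \<Longrightarrow> bwd M' \<alpha> = G (sr \<alpha>) ** bwd M \<alpha> ** K (tg \<alpha>)"
    using M'(2) unfolding iso_def by blast
  note iv = inv_onD[OF inv]
  have fb: "fwd M' \<alpha> ** bwd M' \<alpha> = G (tg \<alpha>) ** (fwd M \<alpha> ** bwd M \<alpha>) ** K (tg \<alpha>)" if "\<alpha> \<in> arrs Y l" for \<alpha>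
  proof -
    have "fwd M' \<alpha> ** bwd M' \<alpha> = G (tg \<alpha>) ** fwd M \<alpha> ** (K (sr \<alpha>) ** G (sr \<alpha>)) ** bwd M \<alpha> ** K (tg \<alpha>)"
      by (simp add: eq that matrix_mul_assoc)
    also have "\<dots> = G (tg \<alpha>) ** (fwd M \<alpha> ** p (sr \<alpha>)) ** bwd M \<alpha> ** K (tg \<alpha>)"
      by (simp add: iv src_in that matrix_mul_assoc)
    finally show ?thesis by (simp add: fwd_def p_emb matrix_mul_assoc)
  qed
  have bf: "bwd M' \<beta> ** fwd M' \<alpha> = G (sr \<beta>) ** (bwd M \<beta> ** fwd M \<alpha>) ** K (sr \<alpha>)"
    if "\<alpha> \<in> arrs Y l" "\<beta> \<in> arrs Y l" "tg \<alpha> = tg \<beta>" for \<alpha> \<beta>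
  proof -
    have "bwd M' \<beta> ** fwd M' \<alpha> = G (sr \<beta>) ** bwd M \<beta> ** (K (tg \<beta>) ** G (tg \<beta>)) ** fwd M \<alpha> ** K (sr \<alpha>)"
      by (simp add: eq that matrix_mul_assoc)
    also have "\<dots> = G (sr \<beta>) ** (bwd M \<beta> ** p (tg \<beta>)) ** fwd M \<alpha> ** K (sr \<alpha>)"
      by (simp add: iv tgt_in that matrix_mul_assoc)
    finally show ?thesis by (simp add: bwd_def p_emb matrix_mul_assoc)
  qed
  have "relns (fwd M') (bwd M')"
    unfolding relns_def
  proof (intro conjI ballI impI)
    fix \<alpha> assume a: "\<alpha> \<in> arrs Y l"
    have "(\<Sum>\<gamma>\<in>inc (sr \<alpha>). fwd M' \<gamma> ** bwd M' \<gamma>)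
        = (\<Sum>\<gamma>\<in>inc (sr \<alpha>). G (sr \<alpha>) ** (fwd M \<gamma> ** bwd M \<gamma>) ** K (sr \<alpha>))"
      by (rule sum.cong) (use fb in \<open>auto simp: inc_def\<close>)
    also have "\<dots> = G (sr \<alpha>) ** (bwd M \<alpha> ** fwd M \<alpha>) ** K (sr \<alpha>)"
      using re a by (simp add: relns_def matrix_mult_sum_left matrix_mult_sum_right)
    finally show "bwd M' \<alpha> ** fwd M' \<alpha> = (\<Sum>\<gamma>\<in>inc (sr \<alpha>). fwd M' \<gamma> ** bwd M' \<gamma>)"
      using bf[OF a a] by simp
  next
    fix \<alpha> \<beta> assume "\<alpha> \<in> arrs Y l" "\<beta> \<in> arrs Y l" "\<alpha> \<noteq> \<beta> \<and> tg \<alpha> = tg \<beta>"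
    then show "bwd M' \<beta> ** fwd M' \<alpha> = 0" using bf re by (simp add: relns_def)
  qed
  moreover have "delta (fwd M')"
    unfolding delta_def
  proof (intro ballI allI impI)
    fix t v assume t: "t \<in> Vs" and v: "prj (I t - B t) *v v = v"
      and 0: "(\<Sum>\<alpha>\<in>inc t. fwd M' \<alpha>) *v v = 0"
    have "K t ** fwd M' \<alpha> = fwd M \<alpha> ** K (sr \<alpha>)" if a: "\<alpha> \<in> inc t" for \<alpha>
    proof -
      have a': "\<alpha> \<in> arrs Y l" "tg \<alpha> = t" using incD[OF a] by auto
      have "K t ** fwd M' \<alpha> = (K t ** G t) ** fwd M \<alpha> ** K (sr \<alpha>)"
        by (simp add: eq(1)[OF a'(1)] a'(2) matrix_mul_assoc)
      also have "\<dots> = fwd M \<alpha> ** K (sr \<alpha>)"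
        unfolding iv(6)[OF t] by (simp add: fwd_def a'(2) p_emb)
      finally show ?thesis .
    qed
    then have "(\<Sum>\<alpha>\<in>inc t. fwd M \<alpha> ** K (sr \<alpha>)) *v v = K t *v ((\<Sum>\<alpha>\<in>inc t. fwd M' \<alpha>) *v v)"
      by (simp add: matrix_vector_mul_assoc matrix_mult_sum_right)
    then have z: "(\<Sum>\<alpha>\<in>inc t. fwd M \<alpha> ** K (sr \<alpha>)) *v v = 0" using 0 by simp
    show "v = 0"
      by (rule delta_twist[OF de t _ _ v z, of "\<lambda>\<alpha>. G (sr \<alpha>)"])
        (use incD inv in \<open>auto simp: fwd_def p_emb intro: inv_on_sym\<close>)
  qed
  ultimately show ?thesis using M'(1) by (simp add: RepD_iff)
qed

section \<open>The standard representation and its local inverse\<close>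

definition psi :: "'k::field ^ 'n ^ 'n \<Rightarrow> nat \<times> bool \<Rightarrow> 'k mat" where
  "psi x = (\<lambda>(\<alpha>, c). if \<alpha> \<in> arrs Y l
     then (if c then uem (sr \<alpha>) (tg \<alpha>) (p (sr \<alpha>) ** x ** p (tg \<alpha>)) else uem (tg \<alpha>) (sr \<alpha>) (p (sr \<alpha>)))
     else (\<lambda>i j. 0))"

lemma repshape_psi: "repshape (psi x)"
  by (auto simp: repshape_def psi_def mat_on_uem)

lemma fwd_bwd_psi:
  assumes "\<alpha> \<in> arrs Y l"
  shows "fwd (psi x) \<alpha> = p (sr \<alpha>)" "bwd (psi x) \<alpha> = p (sr \<alpha>) ** x ** p (tg \<alpha>)"
  using assms std_shaped[of x] unfolding shaped_def
  by (simp_all add: fwd_def bwd_def psi_def emb_uem src_in tgt_in)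

lemma relns_cong:
  assumes "\<And>\<alpha>. \<alpha> \<in> arrs Y l \<Longrightarrow> N \<alpha> = N1 \<alpha> \<and> N' \<alpha> = N1' \<alpha>"
  shows "relns N N' \<longleftrightarrow> relns N1 N1'"
proof -
  have "(\<Sum>\<gamma>\<in>inc s. N \<gamma> ** N' \<gamma>) = (\<Sum>\<gamma>\<in>inc s. N1 \<gamma> ** N1' \<gamma>)" for s
    using assms by (auto simp: inc_def intro!: sum.cong)
  then show ?thesis using assms by (simp add: relns_def)
qed

lemma psi_RepD: "x \<in> nil \<Longrightarrow> psi x \<in> RepD Y l d"
  unfolding RepD_iff
proof (intro conjI repshape_psi)
  assume x: "x \<in> nil"
  show "relns (fwd (psi x)) (bwd (psi x))"
    using std_relns[OF x] relns_cong[of "fwd (psi x)" "\<lambda>\<alpha>. p (sr \<alpha>)" "bwd (psi x)"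
        "\<lambda>\<alpha>. p (sr \<alpha>) ** x ** p (tg \<alpha>)"] by (simp add: fwd_bwd_psi)
  have "(\<Sum>\<gamma>\<in>inc s. fwd (psi x) \<gamma>) = (\<Sum>\<gamma>\<in>inc s. p (sr \<gamma>))" for s
    by (rule sum.cong) (auto simp: inc_def fwd_bwd_psi)
  then show "delta (fwd (psi x))" using std_delta unfolding delta_def by simp
qed

lemma psi_iso_iff:
  assumes "x \<in> nil" "x' \<in> nil"
  shows "iso (psi x) (psi x') \<longleftrightarrow> (\<exists>g h. grp g h \<and> x' = g ** x ** h)"
proof
  assume "iso (psi x) (psi x')"
  then obtain G K where "\<And>t. t \<in> Vs \<Longrightarrow> inv_on (I t) (G t) (K t)"
    "\<And>\<alpha>. \<alpha> \<in> arrs Y l \<Longrightarrow> p (sr \<alpha>) = G (tg \<alpha>) ** p (sr \<alpha>) ** K (sr \<alpha>)"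
    "\<And>\<alpha>. \<alpha> \<in> arrs Y l \<Longrightarrow> p (sr \<alpha>) ** x' ** p (tg \<alpha>) = G (sr \<alpha>) ** (p (sr \<alpha>) ** x ** p (tg \<alpha>)) ** K (tg \<alpha>)"
    unfolding iso_def by (simp only: fwd_bwd_psi cong: ball_cong) blast
  then show "\<exists>g h. grp g h \<and> x' = g ** x ** h"
    by (rule std_iso_imp_conj[OF assms])
next
  assume "\<exists>g h. grp g h \<and> x' = g ** x ** h"
  then obtain g h where "grp g h" "x' = g ** x ** h" by blast
  note c = conj_imp_std_iso[OF assms(1) this]
  show "iso (psi x) (psi x')" unfolding iso_def
    by (intro exI[of _ "\<lambda>t. g ** p t"] exI[of _ "\<lambda>t. h ** p t"] conjI ballI)
      (simp_all only: fwd_bwd_psi, (rule c, assumption)+)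
qed

lemma polymat_emb: "polymat (\<lambda>y. emb t s (\<lambda>i j. y (\<beta>, i, j)))"
  unfolding polymat_def
proof (intro allI)
  fix i j
  show "(\<lambda>y. emb t s (\<lambda>i j. y (\<beta>, i, j)) $ i $ j) \<in> polyfun"
    by (cases "i \<in> I t \<and> j \<in> I s") (auto simp: emb_def intro: polyfun.const polyfun.coord)
qed

lemma polymat_gf:
  assumes "\<And>\<alpha>. polymat (\<lambda>y. N y \<alpha>)"
  shows "polymat (\<lambda>y. gf C (N y) k t)"
proof (induction k arbitrary: t)
  case 0
  then show ?case by (simp add: polymat_const)
next
  case (Suc k)
  then show ?case by (auto intro!: polymat_add polymat_sum polymat_mult polymat_const assms)
qed

text \<open>The complements are those of \<open>M0\<close>, and \<open>D\<close> marks where the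
  recursion still gives invertible matrices. \<open>\<xi>\<close> is defined everywhere, but its
  values matter only off the zeros of \<open>D\<close>; there the conclusion covers every filtered
  \<open>M\<close>. With \<open>M = M0\<close> it also shows that each filtered representation is
  isomorphic to some \<open>psi x\<close>.\<close>

lemma local_section:
  fixes M0 :: "nat \<times> bool \<Rightarrow> 'k::field mat"
  assumes M0: "M0 \<in> RepD Y l d"
  obtains \<xi> :: "((nat \<times> bool) \<times> nat \<times> nat \<Rightarrow> 'k) \<Rightarrow> 'k ^ 'n ^ 'n" and D
  where "D \<in> polyfun" "D (repcoords M0) \<noteq> 0" "regmat (repcoords M0) \<xi>"
    "\<And>M. M \<in> RepD Y l d \<Longrightarrow> D (repcoords M) \<noteq> 0 \<Longrightarrow>
       \<xi> (repcoords M) \<in> nil \<and> iso (psi (\<xi> (repcoords M))) M"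
proof -
  obtain G0 K0 where fr0: "frame (fwd M0) G0 K0"
    using frame_exists[OF shaped_fwd_bwd] M0 unfolding RepD_iff by blast
  \<comment> \<open>These columns span the complements chosen at \<open>M0\<close>; they stay
    constant while the representation varies.\<close>
  define C where "C t = G0 t ** b t" for t
  define N where "N y \<alpha> = emb (tg \<alpha>) (sr \<alpha>) (\<lambda>i j. y ((\<alpha>, False), i, j))"
    for y :: "(nat \<times> bool) \<times> nat \<times> nat \<Rightarrow> 'k" and \<alpha>
  define N' where "N' y \<alpha> = emb (sr \<alpha>) (tg \<alpha>) (\<lambda>i j. y ((\<alpha>, True), i, j))"
    for y :: "(nat \<times> bool) \<times> nat \<times> nat \<Rightarrow> 'k" and \<alpha>
  define G where "G y = gn C (N y)" for y
  define H where "H y t = G y t + prj (- I t)" for y t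
  define K where "K y t = p t ** matrix_inv (H y t) ** p t" for y t
  \<comment> \<open>One polynomial for all vertices, nonzero precisely when every
    \<open>H y t\<close> is invertible.\<close>
  define D where "D y = (\<Prod>t\<in>Vs. det (H y t))" for y
  define \<xi> where "\<xi> y = glue (xblk (N' y) (G y) (K y))" for y
  have N: "N (repcoords M) = fwd M" "N' (repcoords M) = bwd M" for M
    by (simp_all add: fun_eq_iff N_def N'_def fwd_def bwd_def repcoords_def)
  have polyN: "polymat (\<lambda>y. N y \<alpha>)" and polyN': "polymat (\<lambda>y. N' y \<alpha>)" for \<alpha>
    unfolding N_def N'_def by (rule polymat_emb)+
  have polyG: "polymat (\<lambda>y. G y t)" for t
    unfolding G_def gn_def by (rule polymat_gf) (rule polyN)
  have polyH: "polymat (\<lambda>y. H y t)" for t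
    unfolding H_def by (intro polymat_add polymat_const polyG)
  have G0: "G (repcoords M0) t = G0 t" if "t \<in> Vs" for t
    unfolding G_def N C_def by (rule gn_eq_frame[OF fr0 that])
  have det0: "det (H (repcoords M0) t) \<noteq> 0" if "t \<in> Vs" for t
    using det_of_inv_on[OF frame_inv[OF fr0 that]] G0[OF that] by (simp add: H_def)
  show ?thesis
  proof (rule that)
    show "D \<in> polyfun" unfolding D_def by (intro polyfun_prod polyfun_det polyH finite_Vt)
    show "D (repcoords M0) \<noteq> 0" using det0 finite_Vt by (simp add: D_def)
    have regK: "regmat (repcoords M0) (\<lambda>y. K y t)" if "t \<in> Vs" for t
      unfolding K_def
      by (intro regmat_mult regmat_polymat[OF polymat_const] regmat_matrix_inv polyH det0 that)
    show "regmat (repcoords M0) \<xi>"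
      unfolding \<xi>_def glue_def xblk_def
      by (intro regmat_sum regmat_mult regmat_polymat[OF polymat_const] regmat_polymat[OF polyN']
          regmat_polymat[OF polyG] regK finite_inc finite_Vt) (auto dest: incD)
    fix M assume M: "M \<in> RepD Y l d" and DM: "D (repcoords M) \<noteq> 0"
    have C: "p t ** C t = C t" "C t ** b t = C t" if "t \<in> Vs" for t
      using inv_onD(1)[OF frame_inv[OF fr0 that]]
      by (simp_all add: C_def matrix_mul_assoc) (simp add: prj_prj flip: matrix_mul_assoc)
    have "det (H (repcoords M) t) \<noteq> 0" if "t \<in> Vs" for t
      using DM that finite_Vt by (simp add: D_def)
    then have "frame (fwd M) (G (repcoords M)) (K (repcoords M))"
      using gn_frame[OF shaped_fwd_bwd C, of M] unfolding G_def N K_def H_def by blast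
    note st = frame_standard_form[OF this shaped_fwd_bwd] frame_inv[OF this]
    have "relns (fwd M) (bwd M)" using M by (simp add: RepD_iff)
    note st = st(1-3)[OF this] st(4)
    have xi: "\<xi> (repcoords M) = glue (xblk (bwd M) (G (repcoords M)) (K (repcoords M)))"
      by (simp add: \<xi>_def N)
    have "iso (psi (\<xi> (repcoords M))) M"
      unfolding iso_def xi
      by (intro exI[of _ "G (repcoords M)"] exI[of _ "K (repcoords M)"] conjI ballI)
        (simp_all only: fwd_bwd_psi, (rule st, assumption)+)
    then show "\<xi> (repcoords M) \<in> nil \<and> iso (psi (\<xi> (repcoords M))) M"
      using st(1) xi by simp
  qed
qed

end

text \<open>Both images are quotients of \<open>A\<close> by the same equivalence relation, so
  \<open>g\<close> descends along \<open>f\<close>.\<close>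

lemma bij_betw_of_same_kernel:
  assumes "\<And>x y. x \<in> A \<Longrightarrow> y \<in> A \<Longrightarrow> f x = f y \<longleftrightarrow> g x = g y"
  shows "\<exists>h. bij_betw h (f ` A) (g ` A)"
proof -
  let ?h = "\<lambda>z. g (SOME x. x \<in> A \<and> f x = z)"
  have h: "?h (f x) = g x" if "x \<in> A" for x
    using someI[of "\<lambda>y. y \<in> A \<and> f y = f x" x] that assms by auto
  have "bij_betw ?h (f ` A) (g ` A)"
    unfolding bij_betw_def
  proof
    show "inj_on ?h (f ` A)" by (rule inj_onI) (use h assms in auto)
    show "?h ` f ` A = g ` A" using h by (force simp: image_image)
  qed
  then show ?thesis by blast
qed

section \<open>Comparison of orbits and of their openness\<close>

lemma inj_matcoords: "inj matcoords"
  by (auto simp: inj_def matcoords_def vec_eq_iff fun_eq_iff)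

lemma inj_repcoords: "inj repcoords"
  by (auto simp: inj_def repcoords_def fun_eq_iff)

context rep_frame
begin

text \<open>The forward entries are constant and the backward entries linear in \<open>A y\<close>,
  so polynomial conditions on representations pull back along \<open>psi\<close>.\<close>

lemma polyfun_psi:
  fixes A :: "('i \<Rightarrow> 'k::field) \<Rightarrow> 'k ^ 'n ^ 'n"
  assumes "polymat A"
  shows "(\<lambda>y. repcoords (psi (A y)) \<iota>) \<in> polyfun"
proof -
  obtain \<alpha> c i j where \<iota>: "\<iota> = ((\<alpha>, c), i, j)" by (metis prod.exhaust)
  have *: "(\<lambda>y. uem t s (X y) i j) \<in> polyfun" if "polymat X" for t s and X :: "('i \<Rightarrow> 'k) \<Rightarrow> 'k ^ 'n ^ 'n"
    using that by (cases "i < d t \<and> j < d s") (auto simp: uem_def polymat_def polyfun.const)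
  have "polymat (\<lambda>y. p (sr \<alpha>) ** A y ** p (tg \<alpha>))"
    by (intro polymat_mult polymat_const assms)
  then show ?thesis
    using *[of "\<lambda>y. p (sr \<alpha>) ** A y ** p (tg \<alpha>)"] *[OF polymat_const]
    by (cases "\<alpha> \<in> arrs Y l"; cases c) (simp_all add: \<iota> repcoords_def psi_def polyfun.const)
qed

text \<open>Both sets of orbits are indexed by \<open>nil\<close> with the same identifications, and
  openness is compared orbit by orbit for a fixed \<open>x\<close>. \<open>P\<close> only accounts
  for the change of basis.\<close>

lemma orbit_correspondence:
  fixes P Pi :: "'k::field ^ 'n ^ 'n"
  assumes PPi: "P ** Pi = mat 1"
    and nn: "nn = (\<lambda>x. P ** x ** Pi) ` nil"
    and QG: "QG = {P ** g ** Pi | g h. grp g h}"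
  shows "(\<exists>f. bij_betw f (conj_orbits QG nn) (gl_orbits Y l d :: (nat \<times> bool \<Rightarrow> 'k mat) set set))
    \<and> ((\<exists>U\<in>conj_orbits QG nn. zar_open_in (matcoords ` nn) (matcoords ` U))
       \<longleftrightarrow> (\<exists>U\<in>(gl_orbits Y l d :: (nat \<times> bool \<Rightarrow> 'k mat) set set).
              zar_open_in (repcoords ` RepD Y l d) (repcoords ` U)))"
proof -
  define cj where "cj x = P ** x ** Pi" for x
  have PiP: "Pi ** P = mat 1" using PPi matrix_left_right_inverse by blast
  have cj_mult: "cj x ** cj y = cj (x ** y)" for x y
  proof -
    have "cj x ** cj y = P ** x ** (Pi ** P) ** y ** Pi" by (simp add: cj_def matrix_mul_assoc)
    then show ?thesis by (simp add: PiP cj_def matrix_mul_assoc)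
  qed
  have uncj: "Pi ** cj x ** P = x" for x
  proof -
    have "Pi ** cj x ** P = (Pi ** P) ** x ** (Pi ** P)" by (simp add: cj_def matrix_mul_assoc)
    then show ?thesis by (simp add: PiP)
  qed
  have injcj: "cj x = cj y \<longleftrightarrow> x = y" for x y using uncj by metis
  have cj1: "cj (mat 1) = mat 1" by (simp add: cj_def PPi)
  have nn': "nn = cj ` nil" by (simp add: nn cj_def)
  have orb: "conj_orbit QG (cj x) = cj ` {x' \<in> nil. iso (psi x) (psi x')}" if x: "x \<in> nil" for x
  proof -
    have act: "cj g ** cj x ** matrix_inv (cj g) = cj (g ** x ** h)" if "grp g h" for g h
    proof -
      have "matrix_inv (cj g) = cj h"
        by (rule matrix_inv_unique) (use that in \<open>simp add: cj_mult grp_def cj1\<close>)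
      then show ?thesis by (simp add: cj_mult)
    qed
    have "conj_orbit QG (cj x) = {cj g ** cj x ** matrix_inv (cj g) | g h. grp g h}"
      unfolding conj_orbit_def QG cj_def by blast
    also have "\<dots> = {cj (g ** x ** h) | g h. grp g h}"
      by (rule Collect_cong) (metis act)
    also have "\<dots> = cj ` {x' \<in> nil. iso (psi x) (psi x')}"
    proof (intro equalityI subsetI)
      fix z assume "z \<in> {cj (g ** x ** h) | g h. grp g h}"
      then obtain g h where "z = cj (g ** x ** h)" "grp g h" by blast
      then show "z \<in> cj ` {x' \<in> nil. iso (psi x) (psi x')}"
        using nil_conj[OF x] psi_iso_iff[OF x] by blast
    next
      fix z assume "z \<in> cj ` {x' \<in> nil. iso (psi x) (psi x')}"
      then obtain x' where "z = cj x'" "x' \<in> nil" "iso (psi x) (psi x')" by blast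
      then show "z \<in> {cj (g ** x ** h) | g h. grp g h}"
        using psi_iso_iff[OF x] by blast
    qed
    finally show ?thesis .
  qed
  have in_orb: "cj x' \<in> conj_orbit QG (cj x) \<longleftrightarrow> iso (psi x) (psi x')" if "x \<in> nil" "x' \<in> nil" for x x'
    using that by (auto simp: orb injcj)
  have conj_orbits: "conj_orbits QG nn = (\<lambda>x. conj_orbit QG (cj x)) ` nil"
    by (auto simp: conj_orbits_def nn')
  \<comment> \<open>The section based at \<open>M\<close> itself applies, since its \<open>D\<close>
    is nonzero there.\<close>
  have standard: "\<exists>x\<in>nil. iso (psi x) M" if "M \<in> RepD Y l d" for M :: "nat \<times> bool \<Rightarrow> 'k mat"
    by (rule local_section[OF that]) (use that in blast)
  have gl_orbits: "gl_orbits Y l d = (\<lambda>x. gl_orbit Y l d (psi x)) ` (nil :: ('k ^ 'n ^ 'n) set)"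
  proof (intro equalityI subsetI)
    fix U :: "(nat \<times> bool \<Rightarrow> 'k mat) set" assume "U \<in> gl_orbits Y l d"
    then obtain M where M: "M \<in> RepD Y l d" "U = gl_orbit Y l d M" by (auto simp: gl_orbits_def)
    obtain x where x: "x \<in> nil" "iso (psi x) M" using standard[OF M(1)] by blast
    then have "U = gl_orbit Y l d (psi x)"
      using M by (simp add: gl_orbit_eq_iff RepD_iff repshape_psi iso_sym)
    then show "U \<in> (\<lambda>x. gl_orbit Y l d (psi x)) ` nil" using x(1) by blast
  next
    fix U :: "(nat \<times> bool \<Rightarrow> 'k mat) set" assume "U \<in> (\<lambda>x. gl_orbit Y l d (psi x)) ` nil"
    then show "U \<in> gl_orbits Y l d" using psi_RepD by (auto simp: gl_orbits_def)
  qed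
  have "\<exists>f. bij_betw f (conj_orbits QG nn) (gl_orbits Y l d :: (nat \<times> bool \<Rightarrow> 'k mat) set set)"
    unfolding conj_orbits gl_orbits
  proof (rule bij_betw_of_same_kernel)
    fix x y :: "'k ^ 'n ^ 'n" assume xy: "x \<in> nil" "y \<in> nil"
    show "conj_orbit QG (cj x) = conj_orbit QG (cj y) \<longleftrightarrow> gl_orbit Y l d (psi x) = gl_orbit Y l d (psi y)"
      unfolding gl_orbit_eq_iff[OF repshape_psi repshape_psi]
    proof
      assume "conj_orbit QG (cj x) = conj_orbit QG (cj y)"
      then show "iso (psi x) (psi y)" using in_orb[OF xy] in_orb[OF xy(2,2)] iso_refl by blast
    next
      assume "iso (psi x) (psi y)"
      then have "iso (psi x) M \<longleftrightarrow> iso (psi y) M" for M using iso_sym iso_trans by blast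
      then show "conj_orbit QG (cj x) = conj_orbit QG (cj y)" by (simp add: orb xy)
    qed
  qed
  moreover have "zar_open_in (matcoords ` nn) (matcoords ` conj_orbit QG (cj x))
     \<longleftrightarrow> zar_open_in (repcoords ` RepD Y l d) (repcoords ` gl_orbit Y l d (psi x))" if x: "x \<in> nil" for x
  proof
    assume "zar_open_in (repcoords ` RepD Y l d) (repcoords ` gl_orbit Y l d (psi x))"
    then obtain Q where Q: "Q \<subseteq> polyfun" "repcoords ` gl_orbit Y l d (psi x)
        = repcoords ` RepD Y l d - {y. \<forall>q\<in>Q. q y = 0}"
      unfolding zar_open_in_def zar_closed_def by blast
    \<comment> \<open>\<open>A\<close> rebuilds a matrix from its coordinates and undoes the change
      of basis. Composed with \<open>psi\<close> it gives a polynomial map on the whole affine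
      space, along which the equations in \<open>Q\<close> are pulled back.\<close>
    define A where "A y = Pi ** (\<chi> i j. y (i, j)) ** P" for y :: "'n \<times> 'n \<Rightarrow> 'k"
    define \<Phi> where "\<Phi> y = repcoords (psi (A y))" for y
    have Acj: "A (matcoords (cj x')) = x'" for x'
      using uncj[of x'] by (simp add: A_def matcoords_def)
    have "polymat (\<lambda>y :: 'n \<times> 'n \<Rightarrow> 'k. (\<chi> i j. y (i, j)) :: 'k ^ 'n ^ 'n)" by (simp add: polymat_def polyfun.coord)
    then have "polymat A" unfolding A_def by (intro polymat_mult polymat_const)
    have \<Phi>: "(\<lambda>y. q (\<Phi> y)) \<in> polyfun" if "q \<in> Q" for q
      unfolding \<Phi>_def
      by (rule polyfun_compose[OF subsetD[OF Q(1) that]]) (rule polyfun_psi[OF \<open>polymat A\<close>])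
    define Z where "Z = {y. \<forall>r\<in>(\<lambda>q y. q (\<Phi> y)) ` Q. r y = 0}"
    have "zar_closed Z" unfolding zar_closed_def Z_def
      by (intro exI[of _ "(\<lambda>q y. q (\<Phi> y)) ` Q"]) (use \<Phi> in auto)
    moreover have "matcoords ` conj_orbit QG (cj x) = matcoords ` nn - Z"
    proof -
      have "matcoords (cj x') \<notin> Z \<longleftrightarrow> iso (psi x) (psi x')" if x': "x' \<in> nil" for x'
      proof -
        have "matcoords (cj x') \<notin> Z \<longleftrightarrow> repcoords (psi x') \<notin> {y. \<forall>q\<in>Q. q y = 0}"
          by (simp add: Z_def \<Phi>_def Acj)
        also have "\<dots> \<longleftrightarrow> repcoords (psi x') \<in> repcoords ` gl_orbit Y l d (psi x)"
          unfolding Q(2) using psi_RepD[OF x'] by blast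
        also have "\<dots> \<longleftrightarrow> iso (psi x) (psi x')"
          by (simp add: inj_image_mem_iff[OF inj_repcoords] gl_orbit_eq repshape_psi)
        finally show ?thesis .
      qed
      then show ?thesis unfolding orb[OF x] nn' by blast
    qed
    ultimately show "zar_open_in (matcoords ` nn) (matcoords ` conj_orbit QG (cj x))"
      unfolding zar_open_in_def by blast
  next
    assume "zar_open_in (matcoords ` nn) (matcoords ` conj_orbit QG (cj x))"
    then obtain R where R: "R \<subseteq> polyfun" "matcoords ` conj_orbit QG (cj x)
        = matcoords ` nn - {y. \<forall>q\<in>R. q y = 0}"
      unfolding zar_open_in_def zar_closed_def by blast
    have Rz: "iso (psi x) (psi x') \<longleftrightarrow> (\<exists>q\<in>R. q (matcoords (cj x')) \<noteq> 0)" if x': "x' \<in> nil" for x'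
    proof -
      have "iso (psi x) (psi x') \<longleftrightarrow> matcoords (cj x') \<in> matcoords ` conj_orbit QG (cj x)"
        by (simp add: inj_image_mem_iff[OF inj_matcoords] in_orb x x')
      also have "\<dots> \<longleftrightarrow> (\<exists>q\<in>R. q (matcoords (cj x')) \<noteq> 0)"
        unfolding R(2) using x' nn' by blast
      finally show ?thesis .
    qed
    \<comment> \<open>All polynomials that vanish on the filtered representations outside the orbit.
      Their zero set depends on no base point, so it remains to avoid it at each point of the orbit,
      for which a local section suffices.\<close>
    define Q where "Q = {q \<in> polyfun. \<forall>M\<in>RepD Y l d. \<not> iso (psi x) M \<longrightarrow> q (repcoords M :: _ \<Rightarrow> 'k) = 0}"
    define Z where "Z = {y. \<forall>q\<in>Q. q y = 0}"
    have "zar_closed Z" unfolding zar_closed_def Z_def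
      by (intro exI[of _ Q]) (auto simp: Q_def)
    moreover have "repcoords M \<notin> Z" if M: "M \<in> RepD Y l d" "iso (psi x) M" for M :: "nat \<times> bool \<Rightarrow> 'k mat"
    proof (rule local_section[OF M(1)])
      fix \<xi> :: "((nat \<times> bool) \<times> nat \<times> nat \<Rightarrow> 'k) \<Rightarrow> 'k ^ 'n ^ 'n" and D
      assume D: "D \<in> polyfun" "D (repcoords M) \<noteq> 0" and \<xi>: "regmat (repcoords M) \<xi>"
        and sec: "\<And>M. M \<in> RepD Y l d \<Longrightarrow> D (repcoords M) \<noteq> 0 \<Longrightarrow>
             \<xi> (repcoords M) \<in> nil \<and> iso (psi (\<xi> (repcoords M))) M"
      have "iso (psi x) (psi (\<xi> (repcoords M)))"
        using sec[OF M(1) D(2)] M(2) iso_sym iso_trans by blast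
      \<comment> \<open>The section sends \<open>M\<close> into the orbit of \<open>x\<close>, so a
        polynomial detecting that orbit in n is nonzero at its value; its pullback along
        \<open>\<xi>\<close> is a quotient regular at \<open>M\<close>.\<close>
      then obtain r where r: "r \<in> R" "r (matcoords (cj (\<xi> (repcoords M)))) \<noteq> 0"
        using Rz sec[OF M(1) D(2)] by blast
      have "regmat (repcoords M) (\<lambda>y. cj (\<xi> y))"
        unfolding cj_def by (intro regmat_mult regmat_polymat[OF polymat_const] \<xi>)
      then have ri: "reg (repcoords M) (\<lambda>y. matcoords (cj (\<xi> y)) i)" for i
        by (cases i) (simp add: regmat_def matcoords_def)
      have "reg (repcoords M) (\<lambda>y. r (matcoords (cj (\<xi> y))))"
        by (rule reg_compose[OF subsetD[OF R(1) r(1)], where \<Phi> = "\<lambda>y. matcoords (cj (\<xi> y))"]) (rule ri)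
      then obtain u E where u: "u \<in> polyfun" "E \<in> polyfun" "E (repcoords M) \<noteq> 0"
        "\<And>y. E y \<noteq> 0 \<Longrightarrow> r (matcoords (cj (\<xi> y))) = u y / E y"
        unfolding reg_def by (elim bexE conjE) simp
      \<comment> \<open>The factors \<open>E\<close> and \<open>D\<close> make \<open>q\<close> vanish where \<open>u / E\<close> or the section \<open>\<xi>\<close> is meaningless.\<close>
      define q where "q y = u y * E y * D y" for y
      have "q (repcoords M) \<noteq> 0"
        using u(3) u(4)[OF u(3)] r(2) D(2) by (auto simp: q_def)
      moreover have "q (repcoords M') = 0" if M': "M' \<in> RepD Y l d" "\<not> iso (psi x) M'" for M' :: "nat \<times> bool \<Rightarrow> 'k mat"
      proof (rule ccontr)
        assume "q (repcoords M') \<noteq> 0"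
        then have nz: "u (repcoords M') \<noteq> 0" "E (repcoords M') \<noteq> 0" "D (repcoords M') \<noteq> 0"
          by (auto simp: q_def)
        then have "r (matcoords (cj (\<xi> (repcoords M')))) \<noteq> 0" using u(4) by simp
        then have "iso (psi x) (psi (\<xi> (repcoords M')))"
          using Rz sec[OF M'(1) nz(3)] r(1) by blast
        then show False using sec[OF M'(1) nz(3)] M'(2) iso_trans by blast
      qed
      moreover have "q \<in> polyfun" unfolding q_def by (intro polyfun.mult u D)
      ultimately show "repcoords M \<notin> Z" unfolding Z_def Q_def by blast
    qed
    moreover have "repcoords M \<in> Z" if "M \<in> RepD Y l d" "\<not> iso (psi x) M" for M :: "nat \<times> bool \<Rightarrow> 'k mat"
      using that unfolding Z_def Q_def by blast
    moreover have "gl_orbit Y l d (psi x) = {M \<in> RepD Y l d. iso (psi x) M}"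
      using RepD_iso[OF psi_RepD[OF x]] by (auto simp: gl_orbit_eq repshape_psi RepD_iff)
    ultimately show "zar_open_in (repcoords ` RepD Y l d) (repcoords ` gl_orbit Y l d (psi x))"
      unfolding zar_open_in_def by (intro exI[of _ Z]) auto
  qed
  ultimately show ?thesis unfolding conj_orbits gl_orbits by blast
qed

end

section \<open>The quiver of a seaweed\<close>

text \<open>\<open>As\<close> stands for the numbers a_i, \<open>Bs\<close> for the numbers n - b_j,
  and Y_t is to be spanned by the basis vectors numbered from L t + 1 to R t. The spaces enter only
  through strict inclusions, which are those of the intervals.\<close>

locale break_points =
  fixes n l :: nat and m :: "nat \<Rightarrow> nat" and As Bs :: "nat set" and R L :: "nat \<Rightarrow> nat"
    and Y :: "nat \<Rightarrow> 'v set"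
  assumes m_mono: "strict_mono_on {0..l} m" and m_0: "m 0 = 0" and m_l: "m l = n"
    and AB: "As \<union> Bs = m ` {0..l}" and zero_B: "0 \<in> Bs" and n_A: "n \<in> As"
    and R_in: "t \<in> {1..l} \<Longrightarrow> R t \<in> As" and R_ge: "t \<in> {1..l} \<Longrightarrow> m t \<le> R t"
    and R_least: "t \<in> {1..l} \<Longrightarrow> x \<in> As \<Longrightarrow> m t \<le> x \<Longrightarrow> R t \<le> x"
    and L_in: "t \<in> {1..l} \<Longrightarrow> L t \<in> Bs" and L_le: "t \<in> {1..l} \<Longrightarrow> L t \<le> m (t - 1)"
    and L_greatest: "t \<in> {1..l} \<Longrightarrow> x \<in> Bs \<Longrightarrow> x \<le> m (t - 1) \<Longrightarrow> x \<le> L t"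
    and Y_less_iff: "s \<in> {1..l} \<Longrightarrow> t \<in> {1..l} \<Longrightarrow> Y s \<subset> Y t \<longleftrightarrow> {L s<..R s} \<subset> {L t<..R t}"
begin

lemma m_less_iff: "s \<le> l \<Longrightarrow> t \<le> l \<Longrightarrow> m s < m t \<longleftrightarrow> s < t"
  using strict_mono_on_less[OF m_mono] by simp

lemma m_le_iff: "s \<le> l \<Longrightarrow> t \<le> l \<Longrightarrow> m s \<le> m t \<longleftrightarrow> s \<le> t"
  using m_less_iff[of t s] by auto

lemma gap: "x \<in> As \<union> Bs \<Longrightarrow> s < l \<Longrightarrow> m s < x \<Longrightarrow> m (Suc s) \<le> x"
  unfolding AB using m_less_iff m_le_iff by auto

lemma R_eq: "t \<in> {1..l} \<Longrightarrow> m t \<in> As \<Longrightarrow> R t = m t"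
  using R_ge[of t] R_least[of t "m t"] by auto

text \<open>If m_t is no a_i, the first a_i at or beyond m_t is already at or beyond m_(t+1),
  because no break lies in between.\<close>

lemma R_next:
  assumes "1 \<le> t" "t < l" "m t \<notin> As"
  shows "R (Suc t) = R t"
proof -
  have "m t < R t" using R_ge[of t] R_in[of t] assms by (metis atLeastAtMost_iff le_neq_implies_less less_imp_le)
  then have "m (Suc t) \<le> R t" using gap[of "R t" t] R_in[of t] assms by auto
  moreover have "m t \<le> R (Suc t)"
    using R_ge[of "Suc t"] m_le_iff[of t "Suc t"] assms by auto
  ultimately show ?thesis
    using R_least[of "Suc t" "R t"] R_least[of t "R (Suc t)"] R_in[of t] R_in[of "Suc t"] assms by auto
qed

lemma L_eq: "t < l \<Longrightarrow> m t \<in> Bs \<Longrightarrow> L (Suc t) = m t"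
  using L_le[of "Suc t"] L_greatest[of "Suc t" "m t"] by auto

lemma L_next:
  assumes "1 \<le> t" "t < l" "m t \<notin> Bs"
  shows "L (Suc t) = L t"
proof -
  have "L (Suc t) \<le> m t" "L (Suc t) \<in> Bs"
    using L_le[of "Suc t"] L_in[of "Suc t"] assms by simp_all
  moreover from this have "L (Suc t) \<noteq> m t" using assms(3) by (intro notI) simp
  ultimately have 1: "L (Suc t) < m t" "L (Suc t) \<in> Bs" by simp_all
  have "\<not> m (t - 1) < L (Suc t)"
  proof
    have "t - 1 < l" "Suc (t - 1) = t" using assms by auto
    moreover assume "m (t - 1) < L (Suc t)"
    ultimately show False using gap[of "L (Suc t)" "t - 1"] 1 by simp
  qed
  moreover have "L t \<le> m t"
  proof (rule order.trans)
    show "L t \<le> m (t - 1)" using L_le[of t] assms by simp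
    have "t - 1 \<le> l" using assms by linarith
    then show "m (t - 1) \<le> m t" using m_le_iff[of "t - 1" t] assms by simp
  qed
  ultimately show ?thesis
    using L_greatest[of t "L (Suc t)"] L_greatest[of "Suc t" "L t"] L_in[of t] 1 assms by auto
qed

lemma m_pred_less: "t \<in> {1..l} \<Longrightarrow> m (t - 1) < m t"
  using m_less_iff[of "t - 1" t] by auto

lemma L_less_R: "t \<in> {1..l} \<Longrightarrow> L t < m t" "t \<in> {1..l} \<Longrightarrow> m (t - 1) < R t"
  using m_pred_less L_le R_ge by (meson le_less_trans less_le_trans)+

text \<open>If m_s lies in both sets, the intervals of s and s+1 are separated at m_s. If it lies
  only in \<open>As\<close>, they share the left end and the first stops at m_s; if only in
  \<open>Bs\<close>, they share the right end and the second starts after m_s.\<close>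

lemma step_cases:
  assumes s: "1 \<le> s" "s < l"
  shows "Y s \<subset> Y (Suc s) \<longleftrightarrow> m s \<in> As - Bs" and "Y (Suc s) \<subset> Y s \<longleftrightarrow> m s \<in> Bs - As"
proof -
  have mem: "s \<in> {1..l}" "Suc s \<in> {1..l}" using s by auto
  have "m s \<in> As \<union> Bs" unfolding AB using s by auto
  then consider (both) "m s \<in> As" "m s \<in> Bs" | (A) "m s \<in> As" "m s \<notin> Bs" | (B) "m s \<notin> As" "m s \<in> Bs"
    by blast
  then have "(Y s \<subset> Y (Suc s) \<longleftrightarrow> m s \<in> As - Bs) \<and> (Y (Suc s) \<subset> Y s \<longleftrightarrow> m s \<in> Bs - As)"
  proof cases
    case both
    have "m s \<in> {L s<..R s}" "m s \<notin> {L (Suc s)<..R (Suc s)}"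
      "R (Suc s) \<in> {L (Suc s)<..R (Suc s)}" "R (Suc s) \<notin> {L s<..R s}"
      using R_eq[OF mem(1)] L_eq both L_less_R[OF mem(1)] L_less_R[OF mem(2)] s by auto
    then show ?thesis unfolding Y_less_iff[OF mem] Y_less_iff[OF mem(2,1)] using both by blast
  next
    case A
    have "{L s<..R s} \<subset> {L (Suc s)<..R (Suc s)}"
    proof
      show "{L s<..R s} \<subseteq> {L (Suc s)<..R (Suc s)}"
        using R_eq[OF mem(1)] L_next[OF s] A L_less_R(2)[OF mem(2)] by auto
      have "R (Suc s) \<in> {L (Suc s)<..R (Suc s)}" "R (Suc s) \<notin> {L s<..R s}"
        using R_eq[OF mem(1)] L_next[OF s] A L_less_R(1)[OF mem(1)] L_less_R(2)[OF mem(2)] by auto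
      then show "{L s<..R s} \<noteq> {L (Suc s)<..R (Suc s)}" by blast
    qed
    then show ?thesis unfolding Y_less_iff[OF mem] Y_less_iff[OF mem(2,1)] using A by blast
  next
    case B
    have "{L (Suc s)<..R (Suc s)} \<subset> {L s<..R s}"
    proof
      show "{L (Suc s)<..R (Suc s)} \<subseteq> {L s<..R s}"
        using R_next[OF s] L_eq[OF s(2)] B L_less_R(1)[OF mem(1)] by auto
      have "m s \<in> {L s<..R s}" "m s \<notin> {L (Suc s)<..R (Suc s)}"
        using L_eq[OF s(2)] B L_less_R(1)[OF mem(1)] R_ge[OF mem(1)] by auto
      then show "{L (Suc s)<..R (Suc s)} \<noteq> {L s<..R s}" by blast
    qed
    then show ?thesis unfolding Y_less_iff[OF mem] Y_less_iff[OF mem(2,1)] using B by blast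
  qed
  then show "Y s \<subset> Y (Suc s) \<longleftrightarrow> m s \<in> As - Bs" "Y (Suc s) \<subset> Y s \<longleftrightarrow> m s \<in> Bs - As" by auto
qed

lemma arrs_iff: "\<alpha> \<in> arrs Y l \<longleftrightarrow> 1 \<le> \<alpha> \<and> \<alpha> < l \<and> \<not> (m \<alpha> \<in> As \<and> m \<alpha> \<in> Bs)"
proof (cases "1 \<le> \<alpha> \<and> \<alpha> < l")
  case True
  then have "m \<alpha> \<in> As \<union> Bs" unfolding AB by auto
  then show ?thesis using True step_cases[of \<alpha>] by (auto simp: arrs_def)
qed (auto simp: arrs_def)

text \<open>The source interval is the part of the target interval on one side of the target block:
  to its left for an arrow s -> s+1, to its right for s+1 -> s.\<close>

lemma arrow_cases:
  assumes "\<alpha> \<in> arrs Y l"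
  obtains (right) "1 \<le> \<alpha>" "\<alpha> < l" "m \<alpha> \<in> As" "m \<alpha> \<notin> Bs"
      "qsrc Y (\<alpha>, False) = \<alpha>" "qtgt Y (\<alpha>, False) = Suc \<alpha>" "{L \<alpha><..R \<alpha>} = {L (Suc \<alpha>)<..m \<alpha>}"
  | (left) "1 \<le> \<alpha>" "\<alpha> < l" "m \<alpha> \<notin> As" "m \<alpha> \<in> Bs"
      "qsrc Y (\<alpha>, False) = Suc \<alpha>" "qtgt Y (\<alpha>, False) = \<alpha>" "{L (Suc \<alpha>)<..R (Suc \<alpha>)} = {m \<alpha><..R \<alpha>}"
proof -
  have al: "1 \<le> \<alpha>" "\<alpha> < l" and nb: "\<not> (m \<alpha> \<in> As \<and> m \<alpha> \<in> Bs)" using assms arrs_iff by auto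
  have "m \<alpha> \<in> As \<union> Bs" unfolding AB using al by auto
  then consider "m \<alpha> \<in> As" "m \<alpha> \<notin> Bs" | "m \<alpha> \<notin> As" "m \<alpha> \<in> Bs" using nb by blast
  then show ?thesis
  proof cases
    case 1
    show ?thesis
      by (rule right) (use 1 al step_cases[OF al] R_eq[of \<alpha>] L_next[of \<alpha>] in \<open>simp_all add: qsrc_def qtgt_def\<close>)
  next
    case 2
    show ?thesis
      by (rule left) (use 2 al step_cases[OF al] R_next[of \<alpha>] L_eq[of \<alpha>] in \<open>simp_all add: qsrc_def qtgt_def\<close>)
  qed
qed

text \<open>The interval of t is a left piece, the block and a right piece. A nonempty left piece
  means that m_(t-1) is not in \<open>Bs\<close>, a nonempty right piece that m_t is not in
  \<open>As\<close>; either produces the arrow whose source is that piece.\<close>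

lemma block_quiver:
  fixes om :: "'n::finite \<Rightarrow> nat"
  assumes om: "bij_betw om UNIV {1..n}"
  shows "block_quiver {1..l} (arrs Y l) (\<lambda>\<alpha>. qsrc Y (\<alpha>, False)) (\<lambda>\<alpha>. qtgt Y (\<alpha>, False))
    (\<lambda>t. om -` {L t<..R t}) (\<lambda>t. om -` {m (t - 1)<..m t})"
proof
  show "finite {1..l}" "finite (arrs Y l)" by (auto simp: arrs_def)
  show "qsrc Y (\<alpha>, False) \<in> {1..l}" "qtgt Y (\<alpha>, False) \<in> {1..l}" if "\<alpha> \<in> arrs Y l" for \<alpha>
    using that by (cases rule: arrow_cases; simp)+
  show "om -` {L t<..R t} = om -` {m (t - 1)<..m t} \<union>
      (\<Union>\<alpha>\<in>{\<alpha> \<in> arrs Y l. qtgt Y (\<alpha>, False) = t}. om -` {L (qsrc Y (\<alpha>, False))<..R (qsrc Y (\<alpha>, False))})"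
    if t: "t \<in> {1..l}" for t
  proof -
    have "{L t<..R t} = {m (t - 1)<..m t} \<union>
        (\<Union>\<alpha>\<in>{\<alpha> \<in> arrs Y l. qtgt Y (\<alpha>, False) = t}. {L (qsrc Y (\<alpha>, False))<..R (qsrc Y (\<alpha>, False))})"
      (is "_ = _ \<union> ?U")
    proof (intro equalityI subsetI)
      fix x assume x: "x \<in> {L t<..R t}"
      consider "x \<le> m (t - 1)" | "x \<in> {m (t - 1)<..m t}" | "m t < x" by force
      then show "x \<in> {m (t - 1)<..m t} \<union> ?U"
      proof cases
        case 1
        define \<alpha> where "\<alpha> = t - 1"
        \<comment> \<open>For t = 1 the left piece is empty because m_0 = 0.\<close>
        have "\<alpha> \<noteq> 0" using 1 x m_0 by (auto simp: \<alpha>_def)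
        then have al: "Suc \<alpha> = t" "1 \<le> \<alpha>" "\<alpha> < l" using t by (auto simp: \<alpha>_def)
        have nB: "m \<alpha> \<notin> Bs" using L_eq[of \<alpha>] al x 1 by (auto simp: \<alpha>_def)
        then have ar: "\<alpha> \<in> arrs Y l" using al arrs_iff by auto
        then show ?thesis
        proof (cases rule: arrow_cases)
          case right
          then have "x \<in> {L (qsrc Y (\<alpha>, False))<..R (qsrc Y (\<alpha>, False))}"
            using x 1 al by (simp add: \<alpha>_def)
          then show ?thesis using right al ar by blast
        qed (use nB in simp)
      next
        case 3
        \<comment> \<open>For t = l the right piece is empty: n belongs to \<open>As\<close>, so R l
          = m l.\<close>
        have "t \<noteq> l" using 3 x R_eq[OF t] n_A m_l by auto
        then have al: "1 \<le> t" "t < l" using t by auto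
        have nA: "m t \<notin> As" using R_eq[OF t] 3 x by auto
        then have ar: "t \<in> arrs Y l" using al arrs_iff by auto
        then show ?thesis
        proof (cases rule: arrow_cases)
          case left
          then have "x \<in> {L (qsrc Y (t, False))<..R (qsrc Y (t, False))}"
            using x 3 by simp
          then show ?thesis using left ar by blast
        qed (use nA in simp)
      qed simp
    next
      fix x assume "x \<in> {m (t - 1)<..m t} \<union> ?U"
      then consider "x \<in> {m (t - 1)<..m t}"
        | \<alpha> where "\<alpha> \<in> arrs Y l" "qtgt Y (\<alpha>, False) = t" "x \<in> {L (qsrc Y (\<alpha>, False))<..R (qsrc Y (\<alpha>, False))}"
        by blast
      then show "x \<in> {L t<..R t}"
      proof cases
        case 1
        then show ?thesis using L_le[OF t] R_ge[OF t] by auto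
      next
        case 2
        from 2(1) show ?thesis
        proof (cases rule: arrow_cases)
          case right
          then show ?thesis using 2(2,3) L_less_R(2)[OF t] by auto
        next
          case left
          then show ?thesis using 2(2,3) L_less_R(1)[OF t] by auto
        qed
      qed
    qed
    then show ?thesis by auto
  qed
  show "om -` {m (qtgt Y (\<alpha>, False) - 1)<..m (qtgt Y (\<alpha>, False))} \<inter>
      om -` {L (qsrc Y (\<alpha>, False))<..R (qsrc Y (\<alpha>, False))} = {}" if "\<alpha> \<in> arrs Y l" for \<alpha>
    using that by (cases rule: arrow_cases) auto
  show "om -` {L (qsrc Y (\<alpha>, False))<..R (qsrc Y (\<alpha>, False))} \<inter>
      om -` {L (qsrc Y (\<beta>, False))<..R (qsrc Y (\<beta>, False))} = {}"
    if "\<alpha> \<in> arrs Y l" "\<beta> \<in> arrs Y l" "\<alpha> \<noteq> \<beta>" "qtgt Y (\<alpha>, False) = qtgt Y (\<beta>, False)" for \<alpha> \<beta>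
    using that(1)
  proof (cases rule: arrow_cases)
    case a: right
    from that(2) show ?thesis
    proof (cases rule: arrow_cases)
      case right
      then show ?thesis using a that(3,4) by simp
    next
      case left
      \<comment> \<open>The two arrows enter the vertex from opposite sides, so its block separates
        their source intervals.\<close>
      then have "\<beta> = Suc \<alpha>" using a that(4) by simp
      then show ?thesis using a left m_le_iff[of \<alpha> \<beta>] by auto
    qed
  next
    case a: left
    from that(2) show ?thesis
    proof (cases rule: arrow_cases)
      case left
      then show ?thesis using a that(3,4) by simp
    next
      case right
      then have "\<alpha> = Suc \<beta>" using a that(4) by simp
      then show ?thesis using a right m_le_iff[of \<beta> \<alpha>] by auto
    qed
  qed
  show "om -` {m (t - 1)<..m t} \<noteq> {}" if t: "t \<in> {1..l}" for t
  proof -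
    have "m t \<le> n" using m_le_iff[of t l] t m_l by auto
    then have "m t \<in> om ` UNIV" using m_pred_less[OF t] om by (auto simp: bij_betw_def)
    then show ?thesis using m_pred_less[OF t] by auto
  qed
  show "(\<Union>t\<in>{1..l}. om -` {m (t - 1)<..m t}) = UNIV"
  proof (intro equalityI subsetI UNIV_I)
    fix i :: 'n
    have oi: "om i \<in> {1..n}" using om by (auto simp: bij_betw_def)
    \<comment> \<open>The block of a coordinate ends at the first break at or beyond its number; m_0
      = 0 excludes t = 0.\<close>
    define t where "t = (LEAST t. om i \<le> m t)"
    have t1: "om i \<le> m t" and t2: "t \<le> l"
      unfolding t_def by (rule LeastI[of _ l], use oi m_l in simp, rule Least_le, use oi m_l in simp)
    have "t \<noteq> 0" by (rule notI) (use t1 oi m_0 in simp)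
    then have "m (t - 1) < om i"
      using not_less_Least[of "t - 1" "\<lambda>t. om i \<le> m t"] t_def by auto
    then show "i \<in> (\<Union>t\<in>{1..l}. om -` {m (t - 1)<..m t})"
      using t1 t2 \<open>t \<noteq> 0\<close> by (intro UN_I[of t]) auto
  qed
  show "om -` {m (s - 1)<..m s} \<inter> om -` {m (t - 1)<..m t} = {}"
    if "s \<in> {1..l}" "t \<in> {1..l}" "s \<noteq> t" for s t
  proof -
    have "m s \<le> m (t - 1) \<or> m t \<le> m (s - 1)"
    proof (cases "s < t")
      case True
      then have "s \<le> t - 1" "s \<le> l" "t - 1 \<le> l" using that by auto
      then show ?thesis using m_le_iff[of s "t - 1"] by blast
    next
      case False
      then have "t \<le> s - 1" "t \<le> l" "s - 1 \<le> l" using that by auto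
      then show ?thesis using m_le_iff[of t "s - 1"] by blast
    qed
    then show ?thesis by auto
  qed
qed

end

text \<open>Stability with equality is stability under \<open>g\<close> and under its inverse, so
  the criterion for the algebra also settles the group.\<close>

lemma stab_grp_iff:
  fixes g h :: "'k::field ^ 'n ^ 'n"
  assumes "g ** h = mat 1"
  shows "g \<in> stab_grp F r \<longleftrightarrow> g \<in> stab_alg F r \<and> h \<in> stab_alg F r"
proof -
  have hg: "h ** g = mat 1" using assms matrix_left_right_inverse by blast
  have gh: "g *v (h *v v) = v" "h *v (g *v v) = v" for v
    by (simp_all add: matrix_vector_mul_assoc assms hg)
  have "(\<lambda>v. g *v v) ` W = W \<longleftrightarrow> (\<forall>v\<in>W. g *v v \<in> W) \<and> (\<forall>v\<in>W. h *v v \<in> W)" for W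
  proof
    assume W: "(\<lambda>v. g *v v) ` W = W"
    have "h *v v \<in> W" if "v \<in> W" for v
    proof -
      have "v \<in> (\<lambda>v. g *v v) ` W" using that W by simp
      then obtain w where "w \<in> W" "v = g *v w" by blast
      then show ?thesis by (simp add: gh)
    qed
    then show "(\<forall>v\<in>W. g *v v \<in> W) \<and> (\<forall>v\<in>W. h *v v \<in> W)" using W by blast
  next
    assume "(\<forall>v\<in>W. g *v v \<in> W) \<and> (\<forall>v\<in>W. h *v v \<in> W)"
    then show "(\<lambda>v. g *v v) ` W = W" using gh(1) by (metis (no_types, lifting) image_eqI image_subsetI subsetI subset_antisym)
  qed
  moreover have "invertible g" using assms hg unfolding invertible_def by blast
  ultimately show ?thesis unfolding stab_grp_def stab_alg_def by auto
qed

locale seaweed =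
  fixes e :: "nat \<Rightarrow> 'k::field ^ 'n"
    and a b :: "nat \<Rightarrow> nat" and r r' :: nat
    and F F' :: "nat \<Rightarrow> ('k ^ 'n) set"
    and n l :: nat and m :: "nat \<Rightarrow> nat"
  assumes n_eq: "n = CARD('n)"
    and l_eq: "l = nvert n a r b r'"
    and m_eq: "m = mpts n a r b r'"
    and type_a: "a 0 = 0" "strict_mono_on {0..r} a" "a r = n"
    and type_b: "b 0 = 0" "strict_mono_on {0..r'} b" "b r' = n"
    and basis: "inj_on e {1..n}" "vec.independent (e ` {1..n})" "vec.span (e ` {1..n}) = UNIV"
    and flagF: "\<forall>i\<le>r. F i = vec.span (e ` {1..a i})"
    and flagF': "\<forall>j\<le>r'. F' j = vec.span (e ` {n - b j + 1..n})"
begin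

text \<open>An arbitrary numbering of the matrix indices, needed because the adapted basis is
  numbered while the index type carries no order. \<open>P\<close> sends the unit vector at
  \<open>j\<close> to the basis vector numbered \<open>om j\<close>.\<close>

definition om :: "'n \<Rightarrow> nat" where "om = (SOME f. bij_betw f UNIV {1..n})"

lemma om: "bij_betw om UNIV {1..n}"
  unfolding om_def by (rule someI_ex[of "\<lambda>f. bij_betw f UNIV {1..n}"]) (rule finite_same_card_bij, simp_all add: n_eq)

lemma Eb_eq: "Eblk e a r b r' t = vec.span (e ` {m (t - 1)<..m t})"
  by (simp add: Eblk_def m_eq n_eq)

lemma om_in: "om i \<in> {1..n}"
  using om by (auto simp: bij_betw_def)

lemma om_image: "J \<subseteq> {1..n} \<Longrightarrow> om ` (om -` J) = J"
  using om by (auto simp: bij_betw_def)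

definition P :: "'k ^ 'n ^ 'n" where "P = (\<chi> k j. e (om j) $ k)"

definition Pi :: "'k ^ 'n ^ 'n" where "Pi = matrix_inv P"

lemma P_axis: "P *v axis j 1 = e (om j)"
  by (simp add: mult_axis P_def vec_eq_iff)

lemma P_Pi: "P ** Pi = mat 1" "Pi ** P = mat 1"
proof -
  have "columns P = e ` om ` UNIV"
    by (auto simp: columns_def column_def P_def)
  then have "columns P = e ` {1..n}" using om by (simp add: bij_betw_def)
  then have "invertible P"
    using basis(3) by (simp add: invertible_right_inverse matrix_right_invertible_span_columns)
  then show "P ** Pi = mat 1" "Pi ** P = mat 1" by (simp_all add: Pi_def matrix_inv_inverse)
qed

lemma span_e:
  assumes "J \<subseteq> {1..n}"
  shows "vec.span (e ` J) = {w. prj (om -` J) *v (Pi *v w) = Pi *v w}"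
proof -
  have "e ` J = e ` om ` (om -` J)" by (simp only: om_image[OF assms])
  then have "e ` J = ((*v) P) ` (\<lambda>j. axis j 1) ` (om -` J)"
    by (simp only: image_image P_axis)
  then have "vec.span (e ` J) = ((*v) P) ` {v. prj (om -` J) *v v = v}"
    by (simp only: vec.linear_span_image[OF matrix_vector_mul_linear_gen] span_axis)
  also have "\<dots> = {w. prj (om -` J) *v (Pi *v w) = Pi *v w}"
  proof (intro equalityI subsetI)
    fix w assume "w \<in> ((*v) P) ` {v. prj (om -` J) *v v = v}"
    then show "w \<in> {w. prj (om -` J) *v (Pi *v w) = Pi *v w}"
      by (auto simp: matrix_vector_mul_assoc[of Pi] P_Pi)
  next
    fix w assume "w \<in> {w. prj (om -` J) *v (Pi *v w) = Pi *v w}"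
    then show "w \<in> ((*v) P) ` {v. prj (om -` J) *v v = v}"
      by (intro image_eqI[of _ _ "Pi *v w"]) (auto simp: matrix_vector_mul_assoc[of P] P_Pi)
  qed
  finally show ?thesis .
qed

lemma span_e_mem:
  assumes "J \<subseteq> {1..n}"
  shows "e (om j) \<in> vec.span (e ` J) \<longleftrightarrow> om j \<in> J"
proof -
  have "Pi *v e (om j) = axis j 1"
    unfolding P_axis[symmetric] by (simp add: matrix_vector_mul_assoc P_Pi)
  then show ?thesis
    unfolding span_e[OF assms] by (auto simp: vec_eq_iff prj_vec_nth axis_def)
qed

lemma span_e_subset_iff:
  assumes "J \<subseteq> {1..n}" "J' \<subseteq> {1..n}"
  shows "vec.span (e ` J) \<subseteq> vec.span (e ` J') \<longleftrightarrow> J \<subseteq> J'"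
proof
  assume L: "vec.span (e ` J) \<subseteq> vec.span (e ` J')"
  show "J \<subseteq> J'"
  proof
    fix x assume "x \<in> J"
    moreover from this obtain j where "x = om j" using om_image[OF assms(1)] by blast
    ultimately show "x \<in> J'" using L span_e_mem[OF assms(1)] span_e_mem[OF assms(2)] by blast
  qed
qed (intro vec.span_mono image_mono)

lemma span_e_psubset_iff:
  assumes "J \<subseteq> {1..n}" "J' \<subseteq> {1..n}"
  shows "vec.span (e ` J) \<subset> vec.span (e ` J') \<longleftrightarrow> J \<subset> J'"
  using span_e_subset_iff[OF assms] span_e_subset_iff[OF assms(2,1)] by (auto simp: psubset_eq)

lemma span_e_Int:
  assumes "J \<subseteq> {1..n}" "J' \<subseteq> {1..n}"
  shows "vec.span (e ` J) \<inter> vec.span (e ` J') = vec.span (e ` (J \<inter> J'))"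
proof -
  have "J \<inter> J' \<subseteq> {1..n}" using assms by blast
  then show ?thesis
    unfolding span_e[OF assms(1)] span_e[OF assms(2)] span_e[OF \<open>J \<inter> J' \<subseteq> {1..n}\<close>]
    by (auto simp: vec_eq_iff prj_vec_nth split: if_splits)
qed

lemma dim_span_e:
  assumes "J \<subseteq> {1..n}"
  shows "vec.dim (vec.span (e ` J)) = card J"
proof -
  have "vec.independent (e ` J)"
    using basis(2) assms by (meson image_mono vec.independent_mono)
  then show ?thesis
    using card_image[OF inj_on_subset[OF basis(1) assms]] vec.dim_span_eq_card_independent by metis
qed

text \<open>Column \<open>j\<close> of the conjugated matrix lists the coordinates of the image of
  the basis vector numbered \<open>om j\<close>, so an inclusion between spans is a zero
  pattern.\<close>

lemma maps_span_e:
  assumes "J \<subseteq> {1..n}" "J' \<subseteq> {1..n}"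
  shows "(\<forall>v\<in>vec.span (e ` J). x *v v \<in> vec.span (e ` J'))
     \<longleftrightarrow> (\<forall>i j. (Pi ** x ** P) $ i $ j \<noteq> 0 \<longrightarrow> om j \<in> J \<longrightarrow> om i \<in> J')" (is "?L \<longleftrightarrow> ?R")
proof
  assume L: ?L
  show ?R
  proof (intro allI impI)
    fix i j assume nz: "(Pi ** x ** P) $ i $ j \<noteq> 0" and j: "om j \<in> J"
    then have "x *v e (om j) \<in> vec.span (e ` J')" using L span_e_mem[OF assms(1)] by blast
    then have 1: "prj (om -` J') *v (Pi *v (x *v e (om j))) = Pi *v (x *v e (om j))"
      unfolding span_e[OF assms(2)] by blast
    have 2: "Pi *v (x *v e (om j)) = (\<chi> i. (Pi ** x ** P) $ i $ j)"
    proof -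
      have "Pi *v (x *v e (om j)) = (Pi ** x ** P) *v axis j 1"
        unfolding P_axis[symmetric] by (simp only: matrix_vector_mul_assoc matrix_mul_assoc)
      then show ?thesis by (simp only: mult_axis)
    qed
    have "(prj (om -` J') *v (Pi *v (x *v e (om j)))) $ i = (Pi ** x ** P) $ i $ j"
      unfolding 1 unfolding 2 by simp
    then show "om i \<in> J'" using nz by (simp add: prj_vec_nth split: if_splits)
  qed
next
  assume R: ?R
  show ?L
  proof
    fix v assume "v \<in> vec.span (e ` J)"
    then have v: "prj (om -` J) *v (Pi *v v) = Pi *v v" unfolding span_e[OF assms(1)] by blast
    have xv: "(Pi ** x ** P) *v (Pi *v v) = ((Pi ** x ** P) ** prj (om -` J)) *v (Pi *v v)"
      by (subst v[symmetric]) (simp only: matrix_vector_mul_assoc matrix_mul_assoc)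
    have "prj (om -` J') ** (Pi ** x ** P) ** prj (om -` J) = (Pi ** x ** P) ** prj (om -` J)"
      unfolding prj_mult_prj_iff using R by (simp only: vimage_eq)
    then have "prj (om -` J') *v ((Pi ** x ** P) *v (Pi *v v)) = (Pi ** x ** P) *v (Pi *v v)"
      unfolding xv by (simp only: matrix_vector_mul_assoc matrix_mul_assoc)
    moreover have "(Pi ** x ** P) *v (Pi *v v) = Pi *v (x *v v)"
      by (simp add: matrix_vector_mul_assoc) (simp add: P_Pi flip: matrix_mul_assoc)
    ultimately show "x *v v \<in> vec.span (e ` J')" unfolding span_e[OF assms(2)] by simp
  qed
qed

abbreviation Eb where "Eb \<equiv> Eblk e a r b r'"
abbreviation Y where "Y \<equiv> Yspace F r F' r' Eb"

definition As where "As = a ` {0..r}"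
definition Bs where "Bs = (\<lambda>j. n - b j) ` {0..r'}"

section \<open>The breaks and the intervals spanning the spaces Y_t\<close>

lemma a_le_iff: "i \<le> r \<Longrightarrow> j \<le> r \<Longrightarrow> a i \<le> a j \<longleftrightarrow> i \<le> j"
  using strict_mono_on_less_eq[OF type_a(2)] by simp

lemma b_le_iff: "i \<le> r' \<Longrightarrow> j \<le> r' \<Longrightarrow> b i \<le> b j \<longleftrightarrow> i \<le> j"
  using strict_mono_on_less_eq[OF type_b(2)] by simp

lemma a_le_n: "i \<le> r \<Longrightarrow> a i \<le> n"
  using a_le_iff[of i r] type_a(3) by simp

lemma breaks_eq: "breaks n a r b r' = As \<union> Bs"
  by (auto simp: breaks_def As_def Bs_def)

lemma finite_breaks: "finite (breaks n a r b r')"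
  by (simp add: breaks_eq As_def Bs_def)

lemma zero_n_breaks: "0 \<in> As" "n \<in> As" "0 \<in> Bs" "n \<in> Bs"
  using type_a type_b
  by (auto simp: As_def Bs_def intro: image_eqI[of _ _ 0] image_eqI[of _ _ r] image_eqI[of _ _ r'])

lemma breaks_le: "x \<in> breaks n a r b r' \<Longrightarrow> x \<le> n"
  using a_le_n by (auto simp: breaks_eq As_def Bs_def)

lemma card_breaks: "card (breaks n a r b r') = Suc l"
proof -
  have "card (breaks n a r b r') \<noteq> 0"
    using finite_breaks zero_n_breaks by (auto simp: breaks_eq card_eq_0_iff)
  then show ?thesis by (simp add: l_eq nvert_def)
qed

lemma length_breaks: "length (sorted_list_of_set (breaks n a r b r')) = Suc l"
  by (simp add: card_breaks)

lemma m_mono: "strict_mono_on {0..l} m"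
  unfolding m_eq mpts_def
  by (rule strict_mono_onI, rule sorted_wrt_nth_less[OF strict_sorted_list_of_set])
    (simp_all add: card_breaks)

lemma m_image: "m ` {0..l} = As \<union> Bs"
proof -
  have "m ` {0..l} = (!) (sorted_list_of_set (breaks n a r b r')) ` {..<Suc l}"
    by (simp add: m_eq mpts_def lessThan_Suc_atMost atLeast0AtMost)
  also have "\<dots> = set (sorted_list_of_set (breaks n a r b r'))"
    unfolding length_breaks[symmetric] by (auto simp: set_conv_nth)
  finally show ?thesis using finite_breaks by (simp add: breaks_eq)
qed

lemma m_0: "m 0 = 0"
proof -
  obtain s where "s \<le> l" "m s = 0" using zero_n_breaks(1) m_image by (metis UnCI atLeastAtMost_iff imageE)
  then show ?thesis using strict_mono_on_less_eq[OF m_mono, of 0 s] by simp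
qed

lemma m_l: "m l = n"
proof -
  obtain s where s: "s \<le> l" "m s = n" using zero_n_breaks(2) m_image by (metis UnCI atLeastAtMost_iff imageE)
  have "m l \<in> As \<union> Bs" unfolding m_image[symmetric] by simp
  then have "m l \<le> n" using breaks_le breaks_eq by blast
  then show ?thesis using strict_mono_on_less_eq[OF m_mono, of s l] s by simp
qed

lemma m_pred: "t \<in> {1..l} \<Longrightarrow> m (t - 1) < m t"
proof -
  assume t: "t \<in> {1..l}"
  then have "t - 1 \<in> {0..l}" "t \<in> {0..l}" "t - 1 < t" by auto
  then show ?thesis by (rule strict_mono_onD[OF m_mono])
qed

lemma m_le_n: "t \<le> l \<Longrightarrow> m t \<le> n"
  using strict_mono_on_less_eq[OF m_mono, of t l] m_l by simp

text \<open>The two least indices in the definition of Y_t, expressed by inequalities between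
  numbers in place of inclusions of E_t.\<close>

definition ui where "ui t = (LEAST i. i \<le> r \<and> m t \<le> a i)"
definition lj where "lj t = (LEAST j. j \<le> r' \<and> n - b j \<le> m (t - 1))"
definition R where "R t = a (ui t)"
definition L where "L t = n - b (lj t)"

lemma ui:
  assumes "t \<in> {1..l}"
  shows "ui t \<le> r" "m t \<le> R t" "i \<le> r \<Longrightarrow> m t \<le> a i \<Longrightarrow> R t \<le> a i"
proof -
  have "r \<le> r \<and> m t \<le> a r" using m_le_n[of t] assms type_a by simp
  then have *: "ui t \<le> r \<and> m t \<le> a (ui t)" unfolding ui_def by (rule LeastI)
  then show "ui t \<le> r" "m t \<le> R t" by (simp_all add: R_def)
  assume i: "i \<le> r" "m t \<le> a i"
  then have "ui t \<le> i" unfolding ui_def by (intro Least_le) simp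
  then show "R t \<le> a i" using * i a_le_iff by (simp add: R_def)
qed

lemma lj:
  assumes "t \<in> {1..l}"
  shows "lj t \<le> r'" "L t \<le> m (t - 1)" "j \<le> r' \<Longrightarrow> n - b j \<le> m (t - 1) \<Longrightarrow> n - b j \<le> L t"
proof -
  have "r' \<le> r' \<and> n - b r' \<le> m (t - 1)" using type_b by simp
  then have *: "lj t \<le> r' \<and> n - b (lj t) \<le> m (t - 1)" unfolding lj_def by (rule LeastI)
  then show "lj t \<le> r'" "L t \<le> m (t - 1)" by (simp_all add: L_def)
  assume j: "j \<le> r'" "n - b j \<le> m (t - 1)"
  then have "lj t \<le> j" unfolding lj_def by (intro Least_le) simp
  then show "n - b j \<le> L t" using * j b_le_iff by (simp add: L_def diff_le_mono2)
qed

lemma R_le_n: "t \<in> {1..l} \<Longrightarrow> R t \<le> n"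
  using ui(1) a_le_n by (simp add: R_def)

lemma block_sub: "t \<in> {1..l} \<Longrightarrow> {m (t - 1)<..m t} \<subseteq> {1..n}"
  using m_le_n[of t] by auto

text \<open>As the block is nonempty, E_t lies in V_i iff m_t <= a_i, and in V'_j iff n - b_j <=
  m_(t-1). So the least indices are \<open>ui t\<close> and \<open>lj t\<close>, and intersecting
  the two spans leaves an interval of basis vectors.\<close>

lemma Y_eq:
  assumes t: "t \<in> {1..l}"
  shows "Y t = vec.span (e ` {L t<..R t})"
proof -
  have Et: "Eb t = vec.span (e ` {m (t - 1)<..m t})" by (rule Eb_eq)
  have 1: "i \<le> r \<and> Eb t \<subseteq> F i \<longleftrightarrow> i \<le> r \<and> m t \<le> a i" for i
  proof (cases "i \<le> r")
    case True
    have "{1..a i} \<subseteq> {1..n}" using a_le_n[OF True] by auto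
    then have "Eb t \<subseteq> F i \<longleftrightarrow> {m (t - 1)<..m t} \<subseteq> {1..a i}"
      using True flagF span_e_subset_iff[OF block_sub[OF t]] by (simp add: Et)
    also have "\<dots> \<longleftrightarrow> m t \<le> a i" using m_pred[OF t] by auto
    finally show ?thesis by simp
  qed simp
  have 2: "j \<le> r' \<and> Eb t \<subseteq> F' j \<longleftrightarrow> j \<le> r' \<and> n - b j \<le> m (t - 1)" for j
  proof (cases "j \<le> r'")
    case True
    have "{n - b j + 1..n} \<subseteq> {1..n}" by auto
    then have "Eb t \<subseteq> F' j \<longleftrightarrow> {m (t - 1)<..m t} \<subseteq> {n - b j + 1..n}"
      using True flagF' span_e_subset_iff[OF block_sub[OF t]] by (simp add: Et)
    also have "\<dots> \<longleftrightarrow> n - b j \<le> m (t - 1)"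
    proof
      assume "{m (t - 1)<..m t} \<subseteq> {n - b j + 1..n}"
      moreover have "Suc (m (t - 1)) \<in> {m (t - 1)<..m t}" using m_pred[OF t] by auto
      ultimately have "Suc (m (t - 1)) \<in> {n - b j + 1..n}" by blast
      then show "n - b j \<le> m (t - 1)" by simp
    next
      assume "n - b j \<le> m (t - 1)"
      then show "{m (t - 1)<..m t} \<subseteq> {n - b j + 1..n}" using m_le_n[of t] t by auto
    qed
    finally show ?thesis by simp
  qed simp
  have "Y t = F (ui t) \<inter> F' (lj t)"
    unfolding Yspace_def 1 2 ui_def lj_def by (rule refl)
  also have "\<dots> = vec.span (e ` {1..R t}) \<inter> vec.span (e ` {L t + 1..n})"
    using ui(1)[OF t] lj(1)[OF t] flagF flagF' by (simp add: R_def L_def)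
  also have "\<dots> = vec.span (e ` ({1..R t} \<inter> {L t + 1..n}))"
    by (rule span_e_Int) (use R_le_n[OF t] in auto)
  also have "{1..R t} \<inter> {L t + 1..n} = {L t<..R t}"
    using R_le_n[OF t] by auto
  finally show ?thesis .
qed

lemma J_sub: "t \<in> {1..l} \<Longrightarrow> {L t<..R t} \<subseteq> {1..n}"
  using R_le_n[of t] by auto

sublocale break_points n l m As Bs R L Y
proof
  show "strict_mono_on {0..l} m" "m 0 = 0" "m l = n" by (rule m_mono m_0 m_l)+
  show "As \<union> Bs = m ` {0..l}" "0 \<in> Bs" "n \<in> As" using m_image zero_n_breaks by simp_all
  fix t assume t: "t \<in> {1..l}"
  show "R t \<in> As" "m t \<le> R t" "L t \<in> Bs" "L t \<le> m (t - 1)"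
    using ui(1,2)[OF t] lj(1,2)[OF t] by (auto simp: As_def Bs_def R_def L_def)
  show "R t \<le> x" if "x \<in> As" "m t \<le> x" for x
    using that ui(3)[OF t] by (auto simp: As_def)
  show "x \<le> L t" if "x \<in> Bs" "x \<le> m (t - 1)" for x
    using that lj(3)[OF t] by (auto simp: Bs_def)
next
  fix s t assume st: "s \<in> {1..l}" "t \<in> {1..l}"
  show "Y s \<subset> Y t \<longleftrightarrow> {L s<..R s} \<subset> {L t<..R t}"
    unfolding Y_eq[OF st(1)] Y_eq[OF st(2)] by (rule span_e_psubset_iff[OF J_sub[OF st(1)] J_sub[OF st(2)]])
qed

text \<open>The coordinates of Y_t carry the numbers from L t + 1 to R t; subtracting
  \<open>Suc (L t)\<close> makes them start at 0, and their count is the dimension.\<close>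

sublocale rep_frame "{1..l}" Y l "\<lambda>t. om -` {L t<..R t}" "\<lambda>t. om -` {m (t - 1)<..m t}"
  "\<lambda>s. vec.dim (Y s)" "\<lambda>t i. om i - Suc (L t)"
proof -
  interpret block_quiver "{1..l}" "arrs Y l" "\<lambda>\<alpha>. qsrc Y (\<alpha>, False)" "\<lambda>\<alpha>. qtgt Y (\<alpha>, False)"
    "\<lambda>t. om -` {L t<..R t}" "\<lambda>t. om -` {m (t - 1)<..m t}"
    by (rule block_quiver[OF om])
  show "rep_frame {1..l} Y l (\<lambda>t. om -` {L t<..R t}) (\<lambda>t. om -` {m (t - 1)<..m t})
      (\<lambda>s. vec.dim (Y s)) (\<lambda>t i. om i - Suc (L t))"
  proof
    fix t assume t: "t \<in> {1..l}"
    have d: "vec.dim (Y t) = R t - L t" unfolding Y_eq[OF t] dim_span_e[OF J_sub[OF t]] by simp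
    have 1: "bij_betw om (om -` {L t<..R t}) {L t<..R t}"
      using om om_image[OF J_sub[OF t]] by (auto simp: bij_betw_def inj_on_def)
    have 2: "bij_betw (\<lambda>x. x - Suc (L t)) {L t<..R t} {..<R t - L t}"
      by (rule bij_betwI[of _ _ _ "\<lambda>x. x + Suc (L t)"]) auto
    show "bij_betw (\<lambda>i. om i - Suc (L t)) (om -` {L t<..R t}) {..<vec.dim (Y t)}"
      using bij_betw_trans[OF 1 2] by (simp add: d o_def)
  qed simp
qed

section \<open>The seaweed algebra, its radical and its group in coordinates\<close>

lemma block_of: "\<exists>t\<in>{1..l}. om j \<in> {m (t - 1)<..m t}"
proof -
  have "j \<in> (\<Union>t\<in>{1..l}. om -` {m (t - 1)<..m t})" unfolding B_cover by simp
  then show ?thesis by blast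
qed

text \<open>Columns in block t may be nonzero only in rows numbered from L t + 1 to R t. The spaces
  \<open>F (ui t)\<close> and \<open>F' (lj t)\<close> give these bounds. Conversely, a flag space
  containing one basis vector of a block contains the whole block, since no break falls inside it,
  and so contains Y_t.\<close>

lemma stab_iff: "x \<in> stab_alg F r \<inter> stab_alg F' r' \<longleftrightarrow> pres (Pi ** x ** P)"
proof -
  let ?x = "Pi ** x ** P"
  have F: "x \<in> stab_alg F r \<longleftrightarrow> (\<forall>k\<le>r. \<forall>i j. ?x $ i $ j \<noteq> 0 \<longrightarrow> om j \<le> a k \<longrightarrow> om i \<le> a k)"
  proof -
    have "(\<forall>v\<in>F k. x *v v \<in> F k) \<longleftrightarrow> (\<forall>i j. ?x $ i $ j \<noteq> 0 \<longrightarrow> om j \<le> a k \<longrightarrow> om i \<le> a k)"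
      if k: "k \<le> r" for k
    proof -
      have "{1..a k} \<subseteq> {1..n}" using a_le_n[OF k] by auto
      then show ?thesis using k flagF maps_span_e om_in by simp
    qed
    then show ?thesis by (auto simp: stab_alg_def)
  qed
  have F': "x \<in> stab_alg F' r' \<longleftrightarrow> (\<forall>k\<le>r'. \<forall>i j. ?x $ i $ j \<noteq> 0 \<longrightarrow> n - b k < om j \<longrightarrow> n - b k < om i)"
  proof -
    have "(\<forall>v\<in>F' k. x *v v \<in> F' k) \<longleftrightarrow> (\<forall>i j. ?x $ i $ j \<noteq> 0 \<longrightarrow> n - b k < om j \<longrightarrow> n - b k < om i)"
      if k: "k \<le> r'" for k
    proof -
      have "{n - b k + 1..n} \<subseteq> {1..n}" by auto
      then show ?thesis using k flagF' maps_span_e om_in by (simp add: Suc_le_eq)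
    qed
    then show ?thesis by (auto simp: stab_alg_def)
  qed
  have pr: "pres ?x \<longleftrightarrow> (\<forall>t\<in>{1..l}. \<forall>i j. ?x $ i $ j \<noteq> 0 \<longrightarrow> om j \<in> {m (t - 1)<..m t} \<longrightarrow> om i \<in> {L t<..R t})"
    unfolding pres_def prj_mult_prj_iff by (simp only: vimage_eq)
  show ?thesis
    unfolding Int_iff F F' pr
  proof (intro iffI conjI ballI allI impI)
    fix t i j
    assume H: "(\<forall>k\<le>r. \<forall>i j. ?x $ i $ j \<noteq> 0 \<longrightarrow> om j \<le> a k \<longrightarrow> om i \<le> a k) \<and>
        (\<forall>k\<le>r'. \<forall>i j. ?x $ i $ j \<noteq> 0 \<longrightarrow> n - b k < om j \<longrightarrow> n - b k < om i)"
      and t: "t \<in> {1..l}" and nz: "?x $ i $ j \<noteq> 0" and j: "om j \<in> {m (t - 1)<..m t}"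
    have "om j \<le> a (ui t)" "n - b (lj t) < om j"
      using j ui(2)[OF t] lj(2)[OF t] by (auto simp: R_def L_def)
    then show "om i \<in> {L t<..R t}"
      using H nz ui(1)[OF t] lj(1)[OF t] by (simp add: R_def L_def)
  next
    fix k i j
    assume H: "\<forall>t\<in>{1..l}. \<forall>i j. ?x $ i $ j \<noteq> 0 \<longrightarrow> om j \<in> {m (t - 1)<..m t} \<longrightarrow> om i \<in> {L t<..R t}"
      and k: "k \<le> r" and nz: "?x $ i $ j \<noteq> 0" and j: "om j \<le> a k"
    obtain t where t: "t \<in> {1..l}" "om j \<in> {m (t - 1)<..m t}" using block_of by blast
    have "m t \<le> a k"
      using gap[of "a k" "t - 1"] t j k by (auto simp: As_def)
    then have "R t \<le> a k" using ui(3)[OF t(1) k] by simp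
    then show "om i \<le> a k" using H t nz by fastforce
  next
    fix k i j
    assume H: "\<forall>t\<in>{1..l}. \<forall>i j. ?x $ i $ j \<noteq> 0 \<longrightarrow> om j \<in> {m (t - 1)<..m t} \<longrightarrow> om i \<in> {L t<..R t}"
      and k: "k \<le> r'" and nz: "?x $ i $ j \<noteq> 0" and j: "n - b k < om j"
    obtain t where t: "t \<in> {1..l}" "om j \<in> {m (t - 1)<..m t}" using block_of by blast
    have "\<not> m (t - 1) < n - b k"
    proof
      have "t - 1 < l" "Suc (t - 1) = t" "n - b k \<in> As \<union> Bs" using t(1) k by (auto simp: Bs_def)
      moreover assume "m (t - 1) < n - b k"
      ultimately have "m t \<le> n - b k" using gap[of "n - b k" "t - 1"] by simp
      then show False using t(2) j by simp
    qed
    then have "n - b k \<le> L t" using lj(3)[OF t(1) k] by simp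
    then show "n - b k < om i" using H t nz by fastforce
  qed
qed

text \<open>A vanishing diagonal block removes the rows of the block from those allowed by
  \<open>pres\<close>, leaving \<open>I t - B t\<close>. The complement of one block is the union of
  the others because the blocks partition the basis.\<close>

lemma nilrad_iff: "x \<in> nilrad F r F' r' Eb l \<longleftrightarrow> Pi ** x ** P \<in> nil"
proof -
  let ?x = "Pi ** x ** P"
  have diag: "(\<forall>v\<in>Eb t. x *v v \<in> vec.span (\<Union>s\<in>{1..l} - {t}. Eb s))
      \<longleftrightarrow> (\<forall>i j. ?x $ i $ j \<noteq> 0 \<longrightarrow> om j \<in> {m (t - 1)<..m t} \<longrightarrow> om i \<notin> {m (t - 1)<..m t})"
    if t: "t \<in> {1..l}" for t
  proof -
    let ?C = "\<Union>s\<in>{1..l} - {t}. {m (s - 1)<..m s}"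
    have "vec.span (\<Union>s\<in>{1..l} - {t}. Eb s) = vec.span (e ` ?C)"
    proof (rule vec.span_eq[THEN iffD2], intro conjI)
      show "(\<Union>s\<in>{1..l} - {t}. Eb s) \<subseteq> vec.span (e ` ?C)"
        unfolding Eb_eq by (intro UN_least vec.span_mono image_mono) blast
      show "e ` ?C \<subseteq> vec.span (\<Union>s\<in>{1..l} - {t}. Eb s)"
      proof (rule order.trans[OF _ vec.span_superset])
        show "e ` ?C \<subseteq> (\<Union>s\<in>{1..l} - {t}. Eb s)"
          unfolding Eb_eq image_UN by (intro UN_mono vec.span_superset) auto
      qed
    qed
    moreover have "?C \<subseteq> {1..n}" using block_sub by blast
    ultimately have "(\<forall>v\<in>Eb t. x *v v \<in> vec.span (\<Union>s\<in>{1..l} - {t}. Eb s))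
      \<longleftrightarrow> (\<forall>i j. ?x $ i $ j \<noteq> 0 \<longrightarrow> om j \<in> {m (t - 1)<..m t} \<longrightarrow> om i \<in> ?C)"
      using maps_span_e[OF block_sub[OF t]] by (simp add: Eb_eq)
    moreover have "om i \<in> ?C \<longleftrightarrow> om i \<notin> {m (t - 1)<..m t}" for i
    proof
      assume "om i \<in> ?C"
      then obtain s where "s \<in> {1..l}" "s \<noteq> t" "i \<in> om -` {m (s - 1)<..m s}" by blast
      then show "om i \<notin> {m (t - 1)<..m t}" using B_disj[of s t] t by blast
    next
      assume "om i \<notin> {m (t - 1)<..m t}"
      then show "om i \<in> ?C" using block_of[of i] by blast
    qed
    ultimately show ?thesis by simp
  qed
  have nil: "?x \<in> nil \<longleftrightarrow> (\<forall>t\<in>{1..l}. \<forall>i j. ?x $ i $ j \<noteq> 0 \<longrightarrow> om j \<in> {m (t - 1)<..m t} \<longrightarrow>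
      om i \<in> {L t<..R t} \<and> om i \<notin> {m (t - 1)<..m t})"
    unfolding nil_def prj_mult_prj_iff mem_Collect_eq by (simp only: Diff_iff vimage_eq)
  have pr: "pres ?x \<longleftrightarrow> (\<forall>t\<in>{1..l}. \<forall>i j. ?x $ i $ j \<noteq> 0 \<longrightarrow> om j \<in> {m (t - 1)<..m t} \<longrightarrow> om i \<in> {L t<..R t})"
    unfolding pres_def prj_mult_prj_iff by (simp only: vimage_eq)
  have "x \<in> nilrad F r F' r' Eb l \<longleftrightarrow> pres ?x \<and>
      (\<forall>t\<in>{1..l}. \<forall>i j. ?x $ i $ j \<noteq> 0 \<longrightarrow> om j \<in> {m (t - 1)<..m t} \<longrightarrow> om i \<notin> {m (t - 1)<..m t})"
    unfolding nilrad_def mem_Collect_eq stab_iff using diag by simp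
  then show ?thesis unfolding nil pr by blast
qed

lemma conj_P: "P ** (Pi ** x ** P) ** Pi = x" "Pi ** (P ** x ** Pi) ** P = x"
proof -
  have "P ** (Pi ** x ** P) ** Pi = (P ** Pi) ** x ** (P ** Pi)" by (simp add: matrix_mul_assoc)
  then show "P ** (Pi ** x ** P) ** Pi = x" by (simp add: P_Pi)
  have "Pi ** (P ** x ** Pi) ** P = (Pi ** P) ** x ** (Pi ** P)" by (simp add: matrix_mul_assoc)
  then show "Pi ** (P ** x ** Pi) ** P = x" by (simp add: P_Pi)
qed

lemma nilrad_eq: "nilrad F r F' r' Eb l = (\<lambda>x. P ** x ** Pi) ` nil"
proof (intro equalityI subsetI)
  fix x assume "x \<in> nilrad F r F' r' Eb l"
  then show "x \<in> (\<lambda>x. P ** x ** Pi) ` nil"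
    by (intro image_eqI[of _ _ "Pi ** x ** P"]) (simp_all only: nilrad_iff conj_P(1))
next
  fix x assume "x \<in> (\<lambda>x. P ** x ** Pi) ` nil"
  then obtain x' where "x = P ** x' ** Pi" "x' \<in> nil" by blast
  then show "x \<in> nilrad F r F' r' Eb l" by (simp only: nilrad_iff conj_P(2))
qed

text \<open>Conjugation by \<open>P\<close> is multiplicative, so a stabilizer element and its
  inverse correspond to a pair satisfying \<open>grp\<close>.\<close>

lemma stab_grp_eq: "stab_grp F r \<inter> stab_grp F' r' = {P ** g ** Pi | g h. grp g h}"
proof (intro equalityI subsetI)
  fix g assume g: "g \<in> stab_grp F r \<inter> stab_grp F' r'"
  then have "invertible g" by (simp add: stab_grp_def)
  then obtain h where gh: "g ** h = mat 1" "h ** g = mat 1" unfolding invertible_def by blast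
  have "pres (Pi ** g ** P)" "pres (Pi ** h ** P)"
    using g stab_grp_iff[OF gh(1)] unfolding stab_iff[symmetric] by simp_all
  moreover have "Pi ** g ** P ** (Pi ** h ** P) = mat 1" if "g ** h = mat 1" for g h
  proof -
    have "Pi ** g ** P ** (Pi ** h ** P) = Pi ** (g ** (P ** Pi) ** h) ** P" by (simp add: matrix_mul_assoc)
    then show ?thesis using that by (simp add: P_Pi)
  qed
  then have "Pi ** g ** P ** (Pi ** h ** P) = mat 1" "Pi ** h ** P ** (Pi ** g ** P) = mat 1"
    using gh by blast+
  ultimately have "grp (Pi ** g ** P) (Pi ** h ** P)" unfolding grp_def by blast
  then show "g \<in> {P ** g ** Pi | g h. grp g h}" by (intro CollectI exI[of _ "Pi ** g ** P"] exI[of _ "Pi ** h ** P"])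
      (simp add: conj_P(1))
next
  fix z assume "z \<in> {P ** g ** Pi | g h. grp g h}"
  then obtain g h where z: "z = P ** g ** Pi" and gh: "g ** h = mat 1" "pres g" "pres h"
    unfolding grp_def by blast
  have "P ** g ** Pi ** (P ** h ** Pi) = P ** g ** (Pi ** P) ** h ** Pi" by (simp add: matrix_mul_assoc)
  also have "\<dots> = P ** (g ** h) ** Pi" by (simp add: P_Pi matrix_mul_assoc)
  finally have i: "z ** (P ** h ** Pi) = mat 1" unfolding z gh by (simp add: P_Pi)
  have "z \<in> stab_alg F r \<inter> stab_alg F' r'" "P ** h ** Pi \<in> stab_alg F r \<inter> stab_alg F' r'"
    unfolding stab_iff z conj_P(2) by (rule gh)+
  then show "z \<in> stab_grp F r \<inter> stab_grp F' r'" using stab_grp_iff[OF i] by simp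
qed

lemmas seaweed_orbits = orbit_correspondence[OF P_Pi(1) nilrad_eq stab_grp_eq]

end

theorem mainTheorem4:
  fixes e :: "nat \<Rightarrow> 'k::field_char_0 ^ 'n"
    and a b :: "nat \<Rightarrow> nat" and r r' :: nat
    and F F' :: "nat \<Rightarrow> ('k ^ 'n) set"
  assumes alg_closed: "\<forall>p::'k poly. degree p > 0 \<longrightarrow> (\<exists>x. poly p x = 0)"
    and type_a: "a 0 = 0" "strict_mono_on {0..r} a" "a r = CARD('n)"
    and type_b: "b 0 = 0" "strict_mono_on {0..r'} b" "b r' = CARD('n)"
    and basis: "inj_on e {1..CARD('n)}" "vec.independent (e ` {1..CARD('n)})"
      "vec.span (e ` {1..CARD('n)}) = UNIV"
    and flagF: "\<forall>i\<le>r. F i = vec.span (e ` {1..a i})"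
    and flagF': "\<forall>j\<le>r'. F' j = vec.span (e ` {CARD('n) - b j + 1..CARD('n)})"
  shows "let l = nvert CARD('n) a r b r';
             E = Eblk e a r b r';
             Y = Yspace F r F' r' E;
             d = (\<lambda>s. vec.dim (Y s));
             \<nn> = nilrad F r F' r' E l;
             QG = stab_grp F r \<inter> stab_grp F' r'
         in (\<exists>f. bij_betw f (conj_orbits QG \<nn>) (gl_orbits Y l d :: (nat \<times> bool \<Rightarrow> 'k mat) set set))
            \<and> ((\<exists>U\<in>conj_orbits QG \<nn>. zar_open_in (matcoords ` \<nn>) (matcoords ` U))
               \<longleftrightarrow> (\<exists>U\<in>(gl_orbits Y l d :: (nat \<times> bool \<Rightarrow> 'k mat) set set).
                      zar_open_in (repcoords ` RepD Y l d) (repcoords ` U)))"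
proof -
  interpret seaweed e a b r r' F F' "CARD('n)" "nvert CARD('n) a r b r'" "mpts CARD('n) a r b r'"
    by unfold_locales (rule refl type_a type_b basis flagF flagF')+
  show ?thesis unfolding Let_def by (rule seaweed_orbits)
qed

end
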